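(* Let $a_n\to\infty$, let $t=t_n$ be determined by $m(t)=a_n$, and write $s=s(t)$, $\mu_3=\mu_3(t)$. (1) Assume that $$0<\liminf_{n\to\infty}\frac{a_n}{s\sqrt n}\le\limsup_{n\to\infty}\frac{a_n}{s\sqrt n}<\infty .$$ Put $\alpha:=t+\dfrac{\mu_3}{2(n-1)s^2}$ and $\beta:=(n-1)s^2$. Then for every fixed $y_1$, as $n\to\infty$, $$p(X_1=y_1\mid S_1^n=na_n)=g_{a_n}(y_1)(1+o(1)),\qquad g_{a_n}(y):=C\,p(y)\,\mathfrak{n}(\alpha\beta+a_n,\beta,y),$$ where $\mathfrak{n}(\mu,\sigma^2,x)$ denotes the normal density with expectation $\mu$ and variance $\sigma^2$ evaluated at $x$, and $C=C_n$ is the normalizing constant (making $g_{a_n}$ a probability density). (2) If instead $\lim_{n\to\infty}\frac{a_n}{s\sqrt n}=0$, then for every $y_1$, as $n\to\infty$, $$p(X_1=y_1\mid S_1^n=na_n)=\pi^{a_n}(y_1)(1+o(1)).$$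
   Context: Standing setting. $X_1,X_2,\dots$ are i.i.d. non-negative unbounded random variables with density $p$ on $\mathbb{R}_+$ of the form $p(x)=\exp(-(g(x)-q(x)))$, $x\ge 0$ ($p=0$ on $(-\infty,0)$), where $g$ is positive, convex, four times differentiable, $g(x)/x\to\infty$ as $x\to\infty$, and $q$ is bounded. Put $h=g'$ and let $\psi=h^{\leftarrow}$ be the inverse of $h$ (for large arguments). $RV(\alpha)$ denotes the functions on $\mathbb{R}_+$ regularly varying at infinity with index $\alpha$. It is assumed that $h\in\mathcal{R}$, i.e. one of the following holds. (Regularly varying case) $h(x)=x^{\beta_0}l(x)$ for some $\beta_0>0$, with $l(x)=c\exp\int_1^x\frac{\epsilon(u)}{u}du$, $c>0$, $\epsilon$ twice differentiable, $\epsilon(x)=o(1)$, $x|\epsilon'(x)|=O(1)$, $x^2|\epsilon''(x)|=O(1)$ as $x\to\infty$; moreover $|h''|\in RV(\theta)$ for some real $\theta\le\beta_0-2$, and $|q|\in RV(\eta)$ for some $\eta<\theta-\frac{3\beta_0}{2}-\frac32$. (Rapidly varying case) $h$ is rapidly varying at infinity, $\psi\in RV(0)$ with $\psi(t)=c\exp\int_1^t\frac{\epsilon(u)}{u}du$, $c>0$, $\epsilon$ twice differentiable, $\epsilon(t)=o(1)$, $t\epsilon'(t)/\epsilon(t)\to0$, $t^2\epsilon''(t)/\epsilon(t)\to0$ as $t\to\infty$; moreover $|q(\psi(t))|\in RV(\eta)$ as a function of $t$, for some $\eta<-\frac12$. $\Phi(t)=E[e^{tX_1}]$ (finite for all $t\ge0$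 and in a neighborhood of $0$), $m(t)=\frac{d}{dt}\log\Phi(t)$, $s^2(t)=m'(t)$ with $s(t)>0$, $\mu_3(t)=\frac{d^3}{dt^3}\log\Phi(t)$. The tilted density is $\pi_t(x)=e^{tx}p(x)/\Phi(t)$; for $a$ in the range of $m$, $\pi^a:=\pi_t$ where $t$ is the unique solution of $m(t)=a$. $S_1^n=X_1+\dots+X_n$, and $p(X_1=\cdot\mid S_1^n=na_n)$ is the conditional density of $X_1$ given $S_1^n=na_n$. *)

theory Defs
  imports "HOL-Probability.Probability" "HOL-Library.Landau_Symbols"
begin

subsection \<open>Regular and rapid variation at infinity\<close>

definition regularly_varying :: "(real \<Rightarrow> real) \<Rightarrow> real \<Rightarrow> bool" where
  "regularly_varying f \<rho> \<longleftrightarrow>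
     (\<exists>x0. (\<forall>x\<ge>x0. 0 < f x) \<and> f \<in> borel_measurable (restrict_space borel {x0..})) \<and>
     (\<forall>c>0. ((\<lambda>x. f (c * x) / f x) \<longlongrightarrow> c powr \<rho>) at_top)"

definition rapidly_varying :: "(real \<Rightarrow> real) \<Rightarrow> bool" where
  "rapidly_varying f \<longleftrightarrow>
     (\<forall>\<^sub>F x in at_top. 0 < f x) \<and>
     (\<forall>c>1. filterlim (\<lambda>x. f (c * x) / f x) at_top at_top) \<and>
     (\<forall>c. 0 < c \<and> c < 1 \<longrightarrow> ((\<lambda>x. f (c * x) / f x) \<longlongrightarrow> 0) at_top)"

text \<open>\<open>D 0\<close> is \<open>k\<close> times differentiable on \<open>S\<close>, with successive derivatives \<open>D 1, \<dots>, D k\<close>.\<close>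

definition derivs_on :: "real set \<Rightarrow> nat \<Rightarrow> (nat \<Rightarrow> real \<Rightarrow> real) \<Rightarrow> bool" where
  "derivs_on S k D \<longleftrightarrow>
     (\<forall>i<k. \<forall>x\<in>S. (D i has_real_derivative D (Suc i) x) (at x within S))"

definition inverse_at_top :: "(real \<Rightarrow> real) \<Rightarrow> (real \<Rightarrow> real) \<Rightarrow> bool" where
  "inverse_at_top h \<psi> \<longleftrightarrow>
     (\<forall>\<^sub>F x in at_top. \<psi> (h x) = x) \<and> (\<forall>\<^sub>F t in at_top. h (\<psi> t) = t)"

text \<open>
  In the two cases below \<open>E 0\<close> is the function \<open>\<epsilon>\<close> of the Karamata representation and
  \<open>E 1\<close>, \<open>E 2\<close> are its derivatives.  The representations are required for large arguments
  only: \<open>\<psi>\<close> need not be an inverse of \<open>h\<close> near \<open>1\<close>.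
\<close>

definition regular_case ::
    "(real \<Rightarrow> real) \<Rightarrow> (real \<Rightarrow> real) \<Rightarrow> (real \<Rightarrow> real) \<Rightarrow> bool" where
  "regular_case h h'' q \<longleftrightarrow>
     (\<exists>\<beta>0>0. \<exists>\<theta> \<eta>. \<exists>c>0. \<exists>E.
        (\<forall>\<^sub>F x in at_top. h x = x powr \<beta>0 * (c * exp (integral {1..x} (\<lambda>u. E 0 u / u)))) \<and>
        derivs_on {1..} 2 E \<and>
        (E 0 \<longlongrightarrow> 0) at_top \<and>
        (\<lambda>x. x * \<bar>E 1 x\<bar>) \<in> O[at_top](\<lambda>_. 1) \<and>
        (\<lambda>x. x\<^sup>2 * \<bar>E 2 x\<bar>) \<in> O[at_top](\<lambda>_. 1) \<and>
        \<theta> \<le> \<beta>0 - 2 \<and> regularly_varying (\<lambda>x. \<bar>h'' x\<bar>) \<theta> \<and>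
        \<eta> < \<theta> - 3 * \<beta>0 / 2 - 3 / 2 \<and> regularly_varying (\<lambda>x. \<bar>q x\<bar>) \<eta>)"

definition rapid_case :: "(real \<Rightarrow> real) \<Rightarrow> (real \<Rightarrow> real) \<Rightarrow> bool" where
  "rapid_case h q \<longleftrightarrow>
     rapidly_varying h \<and>
     (\<exists>\<psi>. inverse_at_top h \<psi> \<and> regularly_varying \<psi> 0 \<and>
       (\<exists>c>0. \<exists>E.
          (\<forall>\<^sub>F t in at_top. \<psi> t = c * exp (integral {1..t} (\<lambda>u. E 0 u / u))) \<and>
          derivs_on {1..} 2 E \<and>
          (E 0 \<longlongrightarrow> 0) at_top \<and>
          (\<forall>\<^sub>F t in at_top. E 0 t \<noteq> 0) \<and>
          ((\<lambda>t. t * E 1 t / E 0 t) \<longlongrightarrow> 0) at_top \<and>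
          ((\<lambda>t. t\<^sup>2 * E 2 t / E 0 t) \<longlongrightarrow> 0) at_top) \<and>
       (\<exists>\<eta>. \<eta> < - (1 / 2) \<and> regularly_varying (\<lambda>t. \<bar>q (\<psi> t)\<bar>) \<eta>))"

subsection \<open>Tilting\<close>

definition mgf :: "'a measure \<Rightarrow> ('a \<Rightarrow> real) \<Rightarrow> real \<Rightarrow> real" where
  "mgf M Y t = (\<integral>\<omega>. exp (t * Y \<omega>) \<partial>M)"

definition tilted_mean :: "'a measure \<Rightarrow> ('a \<Rightarrow> real) \<Rightarrow> real \<Rightarrow> real" where
  "tilted_mean M Y = deriv (\<lambda>t. ln (mgf M Y t))"

definition tilted_sd :: "'a measure \<Rightarrow> ('a \<Rightarrow> real) \<Rightarrow> real \<Rightarrow> real" where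
  "tilted_sd M Y t = sqrt (deriv (tilted_mean M Y) t)"

definition tilted_mu3 :: "'a measure \<Rightarrow> ('a \<Rightarrow> real) \<Rightarrow> real \<Rightarrow> real" where
  "tilted_mu3 M Y = (deriv ^^ 3) (\<lambda>t. ln (mgf M Y t))"

definition tilt_param :: "'a measure \<Rightarrow> ('a \<Rightarrow> real) \<Rightarrow> real \<Rightarrow> real" where
  "tilt_param M Y a = (THE t. tilted_mean M Y t = a)"

definition tilted_density ::
    "'a measure \<Rightarrow> ('a \<Rightarrow> real) \<Rightarrow> (real \<Rightarrow> real) \<Rightarrow> real \<Rightarrow> real \<Rightarrow> real" where
  "tilted_density M Y p t x = exp (t * x) * p x / mgf M Y t"

definition tilted_density_at_mean ::
    "'a measure \<Rightarrow> ('a \<Rightarrow> real) \<Rightarrow> (real \<Rightarrow> real) \<Rightarrow> real \<Rightarrow> real \<Rightarrow> real" where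
  "tilted_density_at_mean M Y p a = tilted_density M Y p (tilt_param M Y a)"

text \<open>
  The density proportional to \<open>p\<close> times the normal density of mean \<open>\<mu>\<close> and \<^emph>\<open>variance\<close> \<open>v\<close>
  (the library's normal density takes the standard deviation).
\<close>

definition normal_modulated :: "(real \<Rightarrow> real) \<Rightarrow> real \<Rightarrow> real \<Rightarrow> real \<Rightarrow> real" where
  "normal_modulated p \<mu> v y =
     (let C = 1 / (\<integral>x. p x * normal_density \<mu> (sqrt v) x \<partial>lborel)
      in C * p y * normal_density \<mu> (sqrt v) y)"

subsection \<open>Conditional density of a summand given the sum\<close>

text \<open>
  \<open>sum_density p n\<close> is the \<open>n\<close>-fold convolution of \<open>p\<close>.  A density is determined only almost
  everywhere; this fixes the version for which pointwise statements are made.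
\<close>

fun sum_density :: "(real \<Rightarrow> real) \<Rightarrow> nat \<Rightarrow> real \<Rightarrow> real" where
  "sum_density p 0 = (\<lambda>_. 0)"
| "sum_density p (Suc 0) = p"
| "sum_density p (Suc (Suc n)) = (\<lambda>s. \<integral>y. p y * sum_density p (Suc n) (s - y) \<partial>lborel)"

text \<open>
  Joint density of the first summand and the sum, divided by the density of the sum;
  see \<open>distributed_sum\<close> and \<open>distributed_fst_sum\<close> below.  Meaningful for \<open>n \<ge> 2\<close>.
\<close>

definition cond_density_given_sum :: "(real \<Rightarrow> real) \<Rightarrow> nat \<Rightarrow> real \<Rightarrow> real \<Rightarrow> real" where
  "cond_density_given_sum p n s y =
     p y * sum_density p (n - 1) (s - y) / sum_density p n s"

lemma sum_density_props:
  assumes [measurable]: "p \<in> borel_measurable borel"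
    and p: "\<And>x. 0 \<le> p x" "\<And>x. p x \<le> B"
    and int: "integrable lborel p" "(\<integral>x. p x \<partial>lborel) = 1"
  shows "sum_density p n \<in> borel_measurable borel \<and>
    (\<forall>x. 0 \<le> sum_density p n x \<and> sum_density p n x \<le> B)"
proof (induction n rule: induct_nat_012)
  case 0
  then show ?case using p[of 0] by (auto intro: order_trans)
next
  case 1
  then show ?case using p by auto
next
  case (ge2 n)
  then have [measurable]: "sum_density p (Suc n) \<in> borel_measurable borel"
    and b: "\<And>x. 0 \<le> sum_density p (Suc n) x" "\<And>x. sum_density p (Suc n) x \<le> B" by auto
  have B: "0 \<le> B" using p[of 0] by linarith
  have "(\<integral>y. p y * sum_density p (Suc n) (s - y) \<partial>lborel) \<le> (\<integral>y. B * p y \<partial>lborel)" for s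
  proof (rule integral_mono')
    show "p y * sum_density p (Suc n) (s - y) \<le> B * p y" for y
      using mult_left_mono[OF b(2) p(1)] by (simp add: mult.commute)
  qed (use p int B in auto)
  then show ?case using b p int by (auto intro!: integral_nonneg_AE)
qed

lemma sum_density_Suc_nn_integral:
  assumes [measurable]: "p \<in> borel_measurable borel"
    and p: "\<And>x. 0 \<le> p x" "\<And>x. p x \<le> B"
    and int: "integrable lborel p" "(\<integral>x. p x \<partial>lborel) = 1"
  shows "ennreal (sum_density p (Suc (Suc n)) s) =
    (\<integral>\<^sup>+y. ennreal (sum_density p (Suc n) (s - y)) * ennreal (p y) \<partial>lborel)"
proof -
  note props = sum_density_props[OF assms, of "Suc n"]
  then have [measurable]: "sum_density p (Suc n) \<in> borel_measurable borel" by auto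
  have "integrable lborel (\<lambda>y. p y * sum_density p (Suc n) (s - y))"
  proof (rule Bochner_Integration.integrable_bound[where f = "\<lambda>y. B * p y"])
    show "AE y in lborel. norm (p y * sum_density p (Suc n) (s - y)) \<le> norm (B * p y)"
    proof (rule AE_I2)
      fix y
      have "p y * sum_density p (Suc n) (s - y) \<le> B * p y"
        using mult_left_mono[of "sum_density p (Suc n) (s - y)" B "p y"] props p
        by (simp add: mult.commute)
      moreover have "0 \<le> p y * sum_density p (Suc n) (s - y)"
        using props p by simp
      ultimately show "norm (p y * sum_density p (Suc n) (s - y)) \<le> norm (B * p y)"
        by simp
    qed
  qed (use int in auto)
  then show ?thesis
    using props p by (subst sum_density.simps, subst nn_integral_eq_integral[symmetric])
      (auto simp: ennreal_mult' mult.commute)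
qed

lemma (in prob_space) indep_var_swap:
  assumes "indep_var S Y T Z"
  shows "indep_var T Z S Y"
proof -
  have "indep_set B A" if "indep_set A B" for A B
    unfolding indep_sets2_eq
  proof (intro conjI ballI)
    fix b a assume "b \<in> B" "a \<in> A"
    then have "prob (a \<inter> b) = prob a * prob b"
      using that unfolding indep_sets2_eq by blast
    then show "prob (b \<inter> a) = prob b * prob a"
      by (simp only: Int_commute mult.commute)
  qed (use that in \<open>auto simp: indep_sets2_eq\<close>)
  then show ?thesis
    using assms unfolding indep_var_eq by blast
qed

lemma (in prob_space) distributed_sum:
  fixes X :: "'i \<Rightarrow> 'a \<Rightarrow> real"
  assumes I: "finite I" "I \<noteq> {}" and indep: "indep_vars (\<lambda>_. borel) X I"
    and dens: "\<And>i. i \<in> I \<Longrightarrow> distributed M lborel (X i) (\<lambda>x. ennreal (p x))"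
    and [measurable]: "p \<in> borel_measurable borel" and p: "\<And>x. 0 \<le> p x" "\<And>x. p x \<le> B"
    and int: "integrable lborel p" "(\<integral>x. p x \<partial>lborel) = 1"
  shows "distributed M lborel (\<lambda>\<omega>. \<Sum>i\<in>I. X i \<omega>) (\<lambda>x. ennreal (sum_density p (card I) x))"
  using I indep dens
proof (induction I rule: finite_ne_induct)
  case (singleton i)
  then show ?case by simp
next
  case (insert i I)
  obtain n where n: "card I = Suc n"
    using insert by (metis card_gt_0_iff gr0_implies_Suc)
  have "indep_var borel (X i) borel (\<lambda>\<omega>. \<Sum>i\<in>I. X i \<omega>)"
    using indep_vars_sum[of I i X] insert by auto
  then have "indep_var borel (\<lambda>\<omega>. \<Sum>i\<in>I. X i \<omega>) borel (X i)"
    by (rule indep_var_swap)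
  moreover have "distributed M lborel (\<lambda>\<omega>. \<Sum>i\<in>I. X i \<omega>) (\<lambda>x. ennreal (sum_density p (card I) x))"
    using insert by (auto intro: indep_vars_subset)
  ultimately have "distributed M lborel (\<lambda>\<omega>. (\<Sum>i\<in>I. X i \<omega>) + X i \<omega>)
      (\<lambda>s. \<integral>\<^sup>+y. ennreal (sum_density p (card I) (s - y)) * ennreal (p y) \<partial>lborel)"
    using insert by (intro distributed_convolution) auto
  moreover have "(\<integral>\<^sup>+y. ennreal (sum_density p (card I) (s - y)) * ennreal (p y) \<partial>lborel)
      = ennreal (sum_density p (card (insert i I)) s)" for s
    using sum_density_Suc_nn_integral[OF assms(5-9), of n s] insert n by simp
  ultimately show ?case using insert by (simp add: add.commute)
qed

lemma (in prob_space) distributed_fst_sum: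
  fixes X :: "nat \<Rightarrow> 'a \<Rightarrow> real"
  assumes n: "n \<ge> 2" and indep: "indep_vars (\<lambda>_. borel) X {1..n}"
    and dens: "\<And>i. i \<in> {1..n} \<Longrightarrow> distributed M lborel (X i) (\<lambda>x. ennreal (p x))"
    and [measurable]: "p \<in> borel_measurable borel" and p: "\<And>x. 0 \<le> p x" "\<And>x. p x \<le> B"
    and int: "integrable lborel p" "(\<integral>x. p x \<partial>lborel) = 1"
  shows "distributed M (lborel \<Otimes>\<^sub>M lborel) (\<lambda>\<omega>. (X 1 \<omega>, \<Sum>i=1..n. X i \<omega>))
    (\<lambda>(y, s). ennreal (p y * sum_density p (n - 1) (s - y)))"
proof -
  let ?f = "sum_density p (n - 1)"
  let ?T = "\<lambda>\<omega>. \<Sum>i=2..n. X i \<omega>"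
  have ins: "{1..n} = insert 1 {2..n}" using n by auto
  have f: "?f \<in> borel_measurable borel" "\<And>x. 0 \<le> ?f x"
    using sum_density_props[OF assms(4-8)] by auto
  note [measurable] = f(1)
  have T: "distributed M lborel ?T (\<lambda>x. ennreal (?f x))"
    using distributed_sum[of "{2..n}" X p B] n dens indep_vars_subset[OF indep] p int by simp
  have X1: "distributed M lborel (X 1) (\<lambda>x. ennreal (p x))" using dens n by simp
  have "indep_var borel (X 1) borel ?T"
    using indep unfolding ins by (intro indep_vars_sum) auto
  then have "indep_var lborel (X 1) lborel ?T"
    by (simp add: indep_var_distribution_eq cong: distr_cong measurable_cong_sets)
  from distributed_joint_indep[OF _ _ X1 T this]
  have J: "distributed M (lborel \<Otimes>\<^sub>M lborel) (\<lambda>\<omega>. (X 1 \<omega>, ?T \<omega>))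
      (\<lambda>(y, t). ennreal (p y) * ennreal (?f t))"
    by (simp add: lborel.sigma_finite_measure_axioms)
  have [measurable]: "X 1 \<in> borel_measurable M" "?T \<in> borel_measurable M"
    using X1 T by (auto dest!: distributed_measurable)
  have sum: "(\<Sum>i=1..n. X i \<omega>) = X 1 \<omega> + ?T \<omega>" for \<omega>
    unfolding ins by simp
  show ?thesis unfolding sum
    unfolding distributed_def
  proof (intro conjI measure_eqI)
    show dm: "(\<lambda>(y, s). ennreal (p y * ?f (s - y))) \<in> borel_measurable (lborel \<Otimes>\<^sub>M lborel)"
      by measurable
    show meas: "(\<lambda>\<omega>. (X 1 \<omega>, X 1 \<omega> + ?T \<omega>)) \<in> M \<rightarrow>\<^sub>M lborel \<Otimes>\<^sub>M lborel"
      by measurable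
    fix A assume "A \<in> sets (distr M (lborel \<Otimes>\<^sub>M lborel) (\<lambda>\<omega>. (X 1 \<omega>, X 1 \<omega> + ?T \<omega>)))"
    then have [measurable]: "A \<in> sets (borel \<Otimes>\<^sub>M borel)"
      by (simp cong: sets_pair_measure_cong)
    have A: "A \<in> sets (lborel \<Otimes>\<^sub>M lborel)"
      by (simp cong: sets_pair_measure_cong)
    from borel_measurable_indicator[OF this]
    have prod2: "(\<lambda>z. ennreal (p (fst z) * ?f (snd z - fst z)) * indicator A z)
        \<in> borel_measurable (lborel \<Otimes>\<^sub>M lborel)"
      by (rule borel_measurable_times_ennreal[rotated]) measurable
    have "(\<lambda>z. (fst z, fst z + snd z)) \<in> lborel \<Otimes>\<^sub>M lborel \<rightarrow>\<^sub>M borel \<Otimes>\<^sub>M (borel :: real measure)"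
      by measurable
    from measurable_compose[OF this borel_measurable_indicator[of A]]
    have ind: "(\<lambda>z. indicator A (fst z, fst z + snd z) :: ennreal)
        \<in> borel_measurable (lborel \<Otimes>\<^sub>M lborel)"
      by simp
    have prod: "(\<lambda>z. ennreal (p (fst z)) * ennreal (?f (snd z)) *
        indicator A (fst z, fst z + snd z)) \<in> borel_measurable (lborel \<Otimes>\<^sub>M lborel)"
      by (rule borel_measurable_times_ennreal[OF _ ind]) measurable
    have "emeasure (distr M (lborel \<Otimes>\<^sub>M lborel) (\<lambda>\<omega>. (X 1 \<omega>, X 1 \<omega> + ?T \<omega>))) A
      = (\<integral>\<^sup>+z. indicator A z \<partial>distr M (lborel \<Otimes>\<^sub>M lborel) (\<lambda>\<omega>. (X 1 \<omega>, X 1 \<omega> + ?T \<omega>)))"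
      by simp
    also have "\<dots> = (\<integral>\<^sup>+\<omega>. indicator A (X 1 \<omega>, X 1 \<omega> + ?T \<omega>) \<partial>M)"
      by (subst nn_integral_distr[OF meas]) auto
    also have "\<dots> = (\<integral>\<^sup>+z. (\<lambda>(y, t). ennreal (p y) * ennreal (?f t)) z *
        (\<lambda>(y, t). indicator A (y, y + t)) z \<partial>(lborel \<Otimes>\<^sub>M lborel))"
      using ind by (subst distributed_nn_integral[OF J]) (auto simp: case_prod_unfold)
    also have "\<dots> = (\<integral>\<^sup>+y. \<integral>\<^sup>+t. ennreal (p y) * ennreal (?f t) * indicator A (y, y + t) \<partial>lborel \<partial>lborel)"
      using prod by (subst lborel.nn_integral_fst[symmetric]) (simp_all add: case_prod_unfold)
    also have "\<dots> = (\<integral>\<^sup>+y. \<integral>\<^sup>+s. ennreal (p y * ?f (s - y)) * indicator A (y, s) \<partial>lborel \<partial>lborel)"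
    proof (rule nn_integral_cong)
      fix y :: real
      have "(\<lambda>s. (y, s)) \<in> borel \<rightarrow>\<^sub>M borel \<Otimes>\<^sub>M (borel :: real measure)"
        by measurable
      from measurable_compose[OF this borel_measurable_indicator[of A]]
      have "(\<lambda>s. indicator A (y, s) :: ennreal) \<in> borel_measurable borel"
        by simp
      then have "(\<lambda>s. ennreal (p y * ?f (s - y)) * indicator A (y, s)) \<in> borel_measurable borel"
        by (rule borel_measurable_times_ennreal[rotated]) measurable
      then show "(\<integral>\<^sup>+t. ennreal (p y) * ennreal (?f t) * indicator A (y, y + t) \<partial>lborel)
        = (\<integral>\<^sup>+s. ennreal (p y * ?f (s - y)) * indicator A (y, s) \<partial>lborel)"
        by (subst (2) nn_integral_real_affine[where c = 1 and t = y])
           (simp_all add: ennreal_mult' p)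
    qed
    also have "\<dots> = (\<integral>\<^sup>+z. (\<lambda>(y, s). ennreal (p y * ?f (s - y))) z * indicator A z \<partial>(lborel \<Otimes>\<^sub>M lborel))"
      using prod2 by (subst lborel.nn_integral_fst[symmetric]) (simp_all add: case_prod_unfold)
    also have "\<dots> = emeasure (density (lborel \<Otimes>\<^sub>M lborel) (\<lambda>(y, s). ennreal (p y * ?f (s - y)))) A"
      by (rule emeasure_density[OF dm A, symmetric])
    finally show "emeasure (distr M (lborel \<Otimes>\<^sub>M lborel) (\<lambda>\<omega>. (X 1 \<omega>, X 1 \<omega> + ?T \<omega>))) A = \<dots>" .
  qed simp
qed

end

theory Submission
  imports Defs
begin

text \<open>
  Tilting by \<open>exp (t * x)\<close> multiplies the density of a sum by a function of that sum, so it does not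
  change the conditional law of a summand.  With \<open>t\<close> chosen so that the tilted mean is \<open>m = a\<^sub>n\<close>,
  the conditional density at \<open>y\<close> becomes the tilted density \<open>\<pi>(y)\<close> times the quotient of two densities of
  standardized tilted sums, with \<open>n - 1\<close> summands at \<open>(m - y) / s\<close> and with \<open>n\<close> summands at \<open>0\<close>
  (\<open>cond_density_via_std_tilt\<close>).  Everything rests on a local limit theorem for these sums, whose
  summands have a law that moves with \<open>n\<close>.

  The tilted law is itself nearly normal.  Laplace's method at the saddle point \<open>x\<close> with \<open>g'(x) = t\<close>
  shows that the standardized tilted density converges pointwise to the standard normal one and stays
  bounded (\<open>std_tilt_lim\<close>, \<open>std_tilt_eventually_le\<close>).  Convexity of \<open>g\<close> controls the tails; the
  Gaussian shape comes from one property common to the regularly and the rapidly varying case: the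
  local scale \<open>\<sigma> = g''\<^bsup>-1/2\<^esup>\<close> has \<open>\<sigma>' \<longrightarrow> 0\<close>, so \<open>g''\<close> is almost constant over a few multiples of
  \<open>\<sigma>\<close>.  By Scheffe's lemma with weight \<open>1 + z\<^sup>2\<close> the pointwise convergence gives one null sequence
  \<open>\<delta>\<^sub>n\<close> that bounds the distance of the characteristic function at \<open>u\<close> from \<open>exp (- u\<^sup>2 / 2)\<close> by
  both \<open>\<delta>\<^sub>n\<close> and \<open>\<delta>\<^sub>n u\<^sup>2 / 2\<close>.  Raised to the power \<open>n\<close> and rescaled this error vanishes, and Fourier
  inversion yields the local limit theorem (\<open>local_limit_uniform\<close>).  The quotient above is therefore
  equivalent to \<open>exp (- (m - y)\<^sup>2 / (2 (n - 1) s\<^sup>2))\<close> as long as \<open>m / (s \<surd>n)\<close> stays bounded, and tends to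
  \<open>1\<close> when \<open>m / (s \<surd>n) \<longrightarrow> 0\<close>, which is the second assertion.

  For the first assertion the same Gaussian factor is found in \<open>g\<^bsub>a n\<^esub>\<close> after completing the square.
  What is left is \<open>exp (\<delta> (y - m)) / Z\<close> with \<open>\<delta> = \<mu>\<^sub>3 / (2 (n - 1) s\<^sup>2)\<close>, where \<open>Z\<close> is the tilted
  expectation of \<open>exp (\<delta> (Y - m) - (Y - m)\<^sup>2 / (2 (n - 1) s\<^sup>2))\<close>; elementary bounds for \<open>Z\<close>
  (\<open>modulation_bounds\<close>) reduce the claim to \<open>\<mu>\<^sub>3 / m \<longrightarrow> 0\<close>.  Once \<open>\<sigma>' \<longrightarrow> 0\<close> is known, this is the only point
  where the two cases part.  The limit law gives \<open>\<mu>\<^sub>3 = o(\<sigma>\<^sup>3)\<close>, which is enough under rapid variation because then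
  \<open>\<sigma>\<^sup>3 = o(x)\<close>.  Under regular variation \<open>\<sigma>\<^sup>3\<close> may exceed \<open>x\<close>; there the odd moments of the
  normal law cancel, and the distance of the Laplace integrand from its limit is \<open>O(x\<^bsup>-1/2\<^esup>)\<close>, which
  makes \<open>\<mu>\<^sub>3\<close> small enough.
\<close>

section \<open>Characteristic functions of densities\<close>

definition prob_density :: "(real \<Rightarrow> real) \<Rightarrow> bool" where
  "prob_density f \<longleftrightarrow> f \<in> borel_measurable borel \<and> (\<forall>x. 0 \<le> f x) \<and>
     integrable lborel f \<and> (LBINT x. f x) = 1"

abbreviation cf :: "(real \<Rightarrow> real) \<Rightarrow> real \<Rightarrow> complex" where
  "cf f \<equiv> char (density lborel (\<lambda>x. ennreal (f x)))"

lemma prob_densityD: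
  assumes "prob_density f"
  shows "f \<in> borel_measurable borel" "\<And>x. 0 \<le> f x" "integrable lborel f" "(LBINT x. f x) = 1"
  using assms unfolding prob_density_def by auto

lemma real_distribution_density:
  assumes "prob_density f"
  shows "real_distribution (density lborel (\<lambda>x. ennreal (f x)))"
proof -
  note [measurable] = prob_densityD(1)[OF assms]
  have "(\<integral>\<^sup>+x. ennreal (f x) \<partial>lborel) = 1"
    using prob_densityD[OF assms] by (subst nn_integral_eq_integral) auto
  then have "prob_space (density lborel (\<lambda>x. ennreal (f x)))"
    by (intro prob_spaceI) (simp add: emeasure_density)
  then show ?thesis
    by (simp add: real_distribution_def real_distribution_axioms_def)
qed

lemma cf_eq:
  assumes "prob_density f"
  shows "cf f \<tau> = (LBINT x. f x *\<^sub>R iexp (\<tau> * x))"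
proof -
  note [measurable] = prob_densityD(1)[OF assms]
  show ?thesis unfolding char_def
    by (subst integral_density) (auto simp: prob_densityD(2)[OF assms])
qed

lemma integrable_dominated_by_product:
  fixes K :: "real \<Rightarrow> real \<Rightarrow> complex"
  assumes K: "(\<lambda>(x, y). K x y) \<in> borel_measurable (borel \<Otimes>\<^sub>M borel)"
    and bound: "\<And>x y. norm (K x y) \<le> f x * g y"
    and f: "integrable lborel f" and g: "integrable lborel g"
  shows "integrable (lborel \<Otimes>\<^sub>M lborel) (\<lambda>(x, y). K x y)"
proof -
  have [measurable]: "(\<lambda>(x, y). K x y) \<in> borel_measurable (lborel \<Otimes>\<^sub>M lborel)"
    using K by (simp cong: measurable_cong_sets sets_pair_measure_cong)
  have [measurable]: "f \<in> borel_measurable borel" "g \<in> borel_measurable borel"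
    using f g by auto
  have "integrable (lborel \<Otimes>\<^sub>M lborel) (\<lambda>(x, y). f x * g y)"
  proof (rule lborel_pair.Fubini_integrable)
    show "integrable lborel (\<lambda>x. \<integral>y. norm (case (x, y) of (x, y) \<Rightarrow> f x * g y) \<partial>lborel)"
      using f g by (simp add: norm_mult abs_mult integrable_abs)
  qed (use g in auto)
  then show ?thesis
    by (rule Bochner_Integration.integrable_bound)
       (auto intro!: AE_I2 order_trans[OF bound] simp del: abs_mult)
qed

lemma integral_swap_dominated_by_product:
  fixes K :: "real \<Rightarrow> real \<Rightarrow> complex"
  assumes K: "(\<lambda>(x, y). K x y) \<in> borel_measurable (borel \<Otimes>\<^sub>M borel)"
    and bound: "\<And>x y. norm (K x y) \<le> f x * g y"
    and f: "integrable lborel f" and g: "integrable lborel g"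
  shows "(LBINT y. (LBINT x. K x y)) = (LBINT x. (LBINT y. K x y))"
  by (rule lborel_pair.Fubini_integral[OF integrable_dominated_by_product[OF assms]])

lemma gaussian_transform:
  assumes "\<sigma> > 0"
  shows "(LBINT \<tau>. normal_density 0 \<sigma> \<tau> *\<^sub>R iexp (\<tau> * x)) = of_real (exp (- (\<sigma> * x)\<^sup>2 / 2))"
proof -
  have "of_real (exp (- (\<sigma> * x)\<^sup>2 / 2)) = char std_normal_distribution (\<sigma> * x)"
    by (simp add: char_std_normal_distribution)
  also have "\<dots> = (LBINT z. std_normal_density z *\<^sub>R iexp (\<sigma> * x * z))"
    unfolding char_def by (subst integral_density) auto
  also have "\<dots> = (LBINT \<tau>. normal_density 0 \<sigma> \<tau> *\<^sub>R iexp (\<tau> * x))"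
    using assms
    by (subst (2) lborel_integral_real_affine[where c = \<sigma> and t = 0])
       (auto simp: normal_density_def real_sqrt_mult field_simps power_mult_distrib
          simp flip: integral_scaleR_right intro!: Bochner_Integration.integral_cong)
  finally show ?thesis by simp
qed

text \<open>A Plancherel bound.  Against the weight \<open>normal_density 0 \<sigma>\<close>, Fubini's theorem turns the integral of
  \<open>|\<phi>|\<^sup>2\<close> into that of \<open>f x * f y * exp (- (\<sigma> * (x - y))\<^sup>2 / 2)\<close>, where the integral over \<open>x\<close> alone is at
  most \<open>C * sqrt (2 * pi) / \<sigma>\<close>; Fatou's lemma then removes the weight as \<open>\<sigma>\<close> grows.  A bound
  on the density is all the regularity that tilted densities offer, since the factor \<open>exp (q x)\<close> need
  not be continuous.\<close>
lemma
  assumes f: "prob_density f" and C: "\<And>x. f x \<le> C"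
  shows integrable_cf_square: "integrable lborel (\<lambda>\<tau>. (cmod (cf f \<tau>))\<^sup>2)"
    and integral_cf_square_le: "(LBINT \<tau>. (cmod (cf f \<tau>))\<^sup>2) \<le> 2 * pi * C"
proof -
  note fD = prob_densityD[OF f]
  note [measurable] = fD(1)
  interpret D: real_distribution "density lborel (\<lambda>x. ennreal (f x))"
    by (rule real_distribution_density[OF f])
  have [measurable]: "cf f \<in> borel_measurable borel" by (rule D.char_measurable)
  have le1: "cmod (cf f \<tau>) \<le> 1" for \<tau> by (rule D.cmod_char_le_1)
  have C0: "0 \<le> C" using fD(2)[of 0] C[of 0] by linarith
  have smooth: "(LBINT \<tau>. normal_density 0 \<sigma> \<tau> * (cmod (cf f \<tau>))\<^sup>2) \<le> C * (sqrt (2 * pi) / \<sigma>)"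
    if \<sigma>: "\<sigma> > 0" for \<sigma>
  proof -
    let ?N = "normal_density 0 \<sigma>"
    define J where "J y = (LBINT x. f x * exp (- (\<sigma> * (x - y))\<^sup>2 / 2))" for y
    have e: "exp (- (\<sigma> * (x - y))\<^sup>2 / 2) = sqrt (2 * pi) / \<sigma> * normal_density y (1 / \<sigma>) x" for x y
      
    proof -
      have "(\<sigma> * (x - y))\<^sup>2 = (x - y)\<^sup>2 * \<sigma>\<^sup>2" by (simp add: power_mult_distrib mult.commute)
      then show ?thesis
        using \<sigma> by (simp add: normal_density_def real_sqrt_mult real_sqrt_divide power_divide)
    qed
    have J0: "0 \<le> J y" for y unfolding J_def by (intro integral_nonneg_AE) (auto simp: fD(2))
    have Jle: "J y \<le> C * (sqrt (2 * pi) / \<sigma>)" for y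
    proof -
      have "J y \<le> (LBINT x. C * (sqrt (2 * pi) / \<sigma> * normal_density y (1 / \<sigma>) x))"
        unfolding J_def e using \<sigma> C fD(2) C0
        by (intro integral_mono') (auto intro!: mult_right_mono mult_nonneg_nonneg divide_right_mono)
      also have "\<dots> = C * (sqrt (2 * pi) / \<sigma>)" using \<sigma> by simp
      finally show ?thesis .
    qed
    have A: "(LBINT \<tau>. ?N \<tau> *\<^sub>R (cf f \<tau> * iexp (- (\<tau> * y)))) = of_real (J y)" for y
    proof -
      have "(LBINT \<tau>. ?N \<tau> *\<^sub>R (cf f \<tau> * iexp (- (\<tau> * y))))
        = (LBINT \<tau>. (LBINT x. (f x * ?N \<tau>) *\<^sub>R iexp (\<tau> * (x - y))))"
      proof (intro Bochner_Integration.integral_cong refl)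
        fix \<tau>
        have "(LBINT x. (f x * ?N \<tau>) *\<^sub>R iexp (\<tau> * (x - y)))
          = (LBINT x. (of_real (?N \<tau>) * iexp (- (\<tau> * y))) * (f x *\<^sub>R iexp (\<tau> * x)))"
          by (intro Bochner_Integration.integral_cong refl)
             (simp add: scaleR_conv_of_real algebra_simps flip: exp_add)
        also have "\<dots> = (of_real (?N \<tau>) * iexp (- (\<tau> * y))) * cf f \<tau>"
          unfolding cf_eq[OF f] by (rule integral_mult_right_zero)
        finally show "?N \<tau> *\<^sub>R (cf f \<tau> * iexp (- (\<tau> * y))) = (LBINT x. (f x * ?N \<tau>) *\<^sub>R iexp (\<tau> * (x - y)))"
          by (simp add: scaleR_conv_of_real mult_ac)
      qed
      also have "\<dots> = (LBINT x. (LBINT \<tau>. (f x * ?N \<tau>) *\<^sub>R iexp (\<tau> * (x - y))))"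
        by (rule integral_swap_dominated_by_product[where f = f and g = ?N])
           (auto simp: fD norm_mult \<sigma> simp del: of_real_mult)
      also have "\<dots> = (LBINT x. of_real (f x * exp (- (\<sigma> * (x - y))\<^sup>2 / 2)))"
      proof (intro Bochner_Integration.integral_cong refl)
        fix x
        have "(LBINT \<tau>. (f x * ?N \<tau>) *\<^sub>R iexp (\<tau> * (x - y)))
           = f x *\<^sub>R (LBINT \<tau>. ?N \<tau> *\<^sub>R iexp (\<tau> * (x - y)))"
          by (simp flip: integral_scaleR_right)
        then show "(LBINT \<tau>. (f x * ?N \<tau>) *\<^sub>R iexp (\<tau> * (x - y))) = of_real (f x * exp (- (\<sigma> * (x - y))\<^sup>2 / 2))"
          unfolding gaussian_transform[OF \<sigma>] by (simp add: scaleR_conv_of_real)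
      qed
      also have "\<dots> = of_real (J y)" unfolding J_def by (rule integral_complex_of_real)
      finally show ?thesis .
    qed
    have "complex_of_real (LBINT \<tau>. ?N \<tau> * (cmod (cf f \<tau>))\<^sup>2) = (LBINT \<tau>. complex_of_real (?N \<tau> * (cmod (cf f \<tau>))\<^sup>2))"
      by (rule integral_complex_of_real[symmetric])
    also have "\<dots> = (LBINT \<tau>. (LBINT y. (f y * ?N \<tau>) *\<^sub>R (cf f \<tau> * iexp (- (\<tau> * y)))))"
    proof (intro Bochner_Integration.integral_cong refl)
      fix \<tau>
      have "cnj (cf f \<tau>) = (LBINT y. f y *\<^sub>R iexp (- (\<tau> * y)))"
        unfolding cf_eq[OF f] using Bochner_Integration.integral_cnj[of lborel "\<lambda>y. f y *\<^sub>R iexp (\<tau> * y)"] by (simp add: exp_cnj)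
      then have "(LBINT y. (f y * ?N \<tau>) *\<^sub>R (cf f \<tau> * iexp (- (\<tau> * y)))) = of_real (?N \<tau>) * cf f \<tau> * cnj (cf f \<tau>)"
        by (simp add: scaleR_conv_of_real mult_ac flip: integral_mult_right_zero)
      then show "of_real (?N \<tau> * (cmod (cf f \<tau>))\<^sup>2) = (LBINT y. (f y * ?N \<tau>) *\<^sub>R (cf f \<tau> * iexp (- (\<tau> * y))))"
        by (simp only: complex_norm_square of_real_mult mult_ac)
    qed
    also have "\<dots> = (LBINT y. (LBINT \<tau>. (f y * ?N \<tau>) *\<^sub>R (cf f \<tau> * iexp (- (\<tau> * y)))))"
      by (rule integral_swap_dominated_by_product[where f = f and g = ?N])
         (auto simp: fD norm_mult le1 \<sigma> intro!: mult_left_le mult_nonneg_nonneg)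
    also have "\<dots> = (LBINT y. of_real (f y * J y))"
    proof (intro Bochner_Integration.integral_cong refl)
      fix y
      have "(LBINT \<tau>. (f y * ?N \<tau>) *\<^sub>R (cf f \<tau> * iexp (- (\<tau> * y))))
        = f y *\<^sub>R (LBINT \<tau>. ?N \<tau> *\<^sub>R (cf f \<tau> * iexp (- (\<tau> * y))))"
        by (simp flip: integral_scaleR_right)
      then show "(LBINT \<tau>. (f y * ?N \<tau>) *\<^sub>R (cf f \<tau> * iexp (- (\<tau> * y)))) = of_real (f y * J y)"
        unfolding A by (simp add: scaleR_conv_of_real)
    qed
    also have "\<dots> = of_real (LBINT y. f y * J y)" by (rule integral_complex_of_real)
    finally have "(LBINT \<tau>. ?N \<tau> * (cmod (cf f \<tau>))\<^sup>2) = (LBINT y. f y * J y)"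
      unfolding of_real_eq_iff .
    also have "\<dots> \<le> (LBINT y. f y * (C * (sqrt (2 * pi) / \<sigma>)))"
      using \<sigma> C0 by (intro integral_mono' mult_left_mono Jle integrable_mult_left mult_nonneg_nonneg J0 fD(2)) (auto simp: fD)
    also have "\<dots> = C * (sqrt (2 * pi) / \<sigma>)" by (simp add: fD(4))
    finally show ?thesis .
  qed
  have ni: "(\<integral>\<^sup>+\<tau>. ennreal ((cmod (cf f \<tau>))\<^sup>2) \<partial>lborel) \<le> ennreal (2 * pi * C)"
  proof -
    let ?u = "\<lambda>k \<tau>. exp (- \<tau>\<^sup>2 / (2 * (real (Suc k))\<^sup>2)) * (cmod (cf f \<tau>))\<^sup>2"
    have le: "(\<integral>\<^sup>+\<tau>. ennreal (?u k \<tau>) \<partial>lborel) \<le> ennreal (2 * pi * C)" for k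
    proof -
      define \<sigma> where "\<sigma> = real (Suc k)"
      have \<sigma>: "\<sigma> > 0" by (simp add: \<sigma>_def)
      have eq: "?u k \<tau> = sqrt (2 * pi) * \<sigma> * (normal_density 0 \<sigma> \<tau> * (cmod (cf f \<tau>))\<^sup>2)" for \<tau>
        using \<sigma> unfolding \<sigma>_def[symmetric] by (simp add: normal_density_def real_sqrt_mult field_simps)
      have int: "integrable lborel (\<lambda>\<tau>. normal_density 0 \<sigma> \<tau> * (cmod (cf f \<tau>))\<^sup>2)"
        by (rule Bochner_Integration.integrable_bound[OF integrable_normal_density[OF \<sigma>, of 0]])
           (auto intro!: AE_I2 mult_left_le simp: abs_mult power_le_one le1)
      have "(\<integral>\<^sup>+\<tau>. ennreal (?u k \<tau>) \<partial>lborel) = ennreal (LBINT \<tau>. ?u k \<tau>)"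
        unfolding eq using int \<sigma> by (intro nn_integral_eq_integral) (auto intro!: AE_I2 mult_nonneg_nonneg)
      also have "(LBINT \<tau>. ?u k \<tau>) = sqrt (2 * pi) * \<sigma> * (LBINT \<tau>. normal_density 0 \<sigma> \<tau> * (cmod (cf f \<tau>))\<^sup>2)"
        unfolding eq by simp
      also have "\<dots> \<le> sqrt (2 * pi) * \<sigma> * (C * (sqrt (2 * pi) / \<sigma>))"
        using \<sigma> by (intro mult_left_mono smooth) auto
      also have "\<dots> = 2 * pi * C" using \<sigma> by (simp add: field_simps)
      finally show ?thesis by (simp add: ennreal_leI)
    qed
    have lim: "(\<lambda>k. ennreal (?u k \<tau>)) \<longlonglongrightarrow> ennreal ((cmod (cf f \<tau>))\<^sup>2)" for \<tau>
    proof (intro tendsto_ennrealI)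
      have "(\<lambda>k. - \<tau>\<^sup>2 / (2 * (real (Suc k))\<^sup>2)) \<longlonglongrightarrow> 0"
      proof (rule tendsto_divide_0[OF tendsto_const])
        have "filterlim (\<lambda>k. real (Suc k)) at_top sequentially"
          using filterlim_real_sequentially by (rule filterlim_compose[OF _ filterlim_Suc])
        then have "filterlim (\<lambda>k. 2 * (real (Suc k))\<^sup>2) at_top sequentially"
          by (intro filterlim_tendsto_pos_mult_at_top[OF tendsto_const] filterlim_pow_at_top) auto
        then show "filterlim (\<lambda>k. 2 * (real (Suc k))\<^sup>2) at_infinity sequentially"
          by (rule filterlim_at_top_imp_at_infinity)
      qed
      from tendsto_mult[OF tendsto_exp[OF this] tendsto_const]
      show "(\<lambda>k. ?u k \<tau>) \<longlonglongrightarrow> (cmod (cf f \<tau>))\<^sup>2" by simp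
    qed
    have "(\<integral>\<^sup>+\<tau>. ennreal ((cmod (cf f \<tau>))\<^sup>2) \<partial>lborel) = (\<integral>\<^sup>+\<tau>. liminf (\<lambda>k. ennreal (?u k \<tau>)) \<partial>lborel)"
      by (intro nn_integral_cong lim_imp_Liminf[OF _ lim, symmetric]) simp
    also have "\<dots> \<le> liminf (\<lambda>k. \<integral>\<^sup>+\<tau>. ennreal (?u k \<tau>) \<partial>lborel)"
      by (intro nn_integral_liminf) auto
    also have "\<dots> \<le> liminf (\<lambda>k::nat. ennreal (2 * pi * C))"
      by (intro Liminf_mono always_eventually allI le)
    also have "\<dots> = ennreal (2 * pi * C)" by (simp add: Liminf_const)
    finally show ?thesis .
  qed
  show i: "integrable lborel (\<lambda>\<tau>. (cmod (cf f \<tau>))\<^sup>2)"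
    by (intro integrableI_bounded) (auto intro: le_less_trans[OF ni])
  have "ennreal (LBINT \<tau>. (cmod (cf f \<tau>))\<^sup>2) \<le> ennreal (2 * pi * C)"
    using ni by (subst (asm) nn_integral_eq_integral[OF i]) auto
  then show "(LBINT \<tau>. (cmod (cf f \<tau>))\<^sup>2) \<le> 2 * pi * C"
    using C0 by (simp add: ennreal_le_iff)
qed

section \<open>Fourier inversion for convolution powers\<close>

text \<open>\<open>sum_density\<close> is the density of a convolution of measures, whose characteristic function is the
  product by Fubini's theorem.\<close>
lemma prob_density_sum_density:
  assumes f: "prob_density f" and C: "\<And>x. f x \<le> C"
  shows "prob_density (sum_density f (Suc n))"
    and "cf (sum_density f (Suc n)) \<tau> = cf f \<tau> ^ Suc n"
    and "sum_density f (Suc n) x \<le> C"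
proof -
  note fD = prob_densityD[OF f]
  note props = sum_density_props[OF fD(1,2) C fD(3,4)]
  show "sum_density f (Suc n) x \<le> C" using props by blast
  interpret D: real_distribution "density lborel (\<lambda>x. ennreal (f x))"
    by (rule real_distribution_density[OF f])
  have "prob_density (sum_density f (Suc n)) \<and> (\<forall>\<tau>. cf (sum_density f (Suc n)) \<tau> = cf f \<tau> ^ Suc n)"
  proof (induction n)
    case 0
    then show ?case using f by simp
  next
    case (Suc n)
    let ?K = "sum_density f (Suc n)" and ?L = "sum_density f (Suc (Suc n))"
    have K: "prob_density ?K" using Suc by blast
    note KD = prob_densityD[OF K]
    note [measurable] = KD(1) fD(1)
    have L: "?L \<in> borel_measurable borel" "\<And>x. 0 \<le> ?L x" using props by blast+
    note [measurable] = L(1)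
    interpret E: real_distribution "density lborel (\<lambda>x. ennreal (?K x))"
      by (rule real_distribution_density[OF K])
    have conv: "density lborel (\<lambda>x. ennreal (?K x)) \<star> density lborel (\<lambda>x. ennreal (f x))
        = density lborel (\<lambda>x. ennreal (?L x))"
      using convolution_density[of "\<lambda>x. ennreal (?K x)" "\<lambda>x. ennreal (f x)"]
        sum_density_Suc_nn_integral[OF fD(1,2) C fD(3,4), of n]
      by (simp add: D.finite_measure_axioms E.finite_measure_axioms del: sum_density.simps)
    interpret P: pair_prob_space "density lborel (\<lambda>x. ennreal (?K x))" "density lborel (\<lambda>x. ennreal (f x))" ..
    have sm: "(\<lambda>(x, y). x + y) \<in> density lborel (\<lambda>x. ennreal (?K x)) \<Otimes>\<^sub>M density lborel (\<lambda>x. ennreal (f x)) \<rightarrow>\<^sub>M (borel :: real measure)"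
      by (simp add: case_prod_unfold cong: measurable_cong_sets sets_pair_measure_cong)
    have "prob_space (density lborel (\<lambda>x. ennreal (?L x)))"
      unfolding conv[symmetric] convolution_def by (rule P.prob_space_distr[OF sm])
    then have "emeasure (density lborel (\<lambda>x. ennreal (?L x))) (space (density lborel (\<lambda>x. ennreal (?L x)))) = 1"
      by (rule prob_space.emeasure_space_1)
    then have one: "(\<integral>\<^sup>+x. ennreal (?L x) \<partial>lborel) = 1"
      by (simp add: emeasure_density del: sum_density.simps)
    then have int: "integrable lborel ?L"
      using L by (intro integrableI_nonneg) (auto simp del: sum_density.simps)
    have "(LBINT x. ?L x) = 1"
      using one L(2) by (subst integral_eq_nn_integral) (auto simp del: sum_density.simps)
    then have PL: "prob_density ?L"
      unfolding prob_density_def using L int by blast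
    have "cf ?L \<tau> = cf ?K \<tau> * cf f \<tau>" for \<tau>
    proof -
      have "cf ?L \<tau> = (\<integral>z. iexp (\<tau> * (fst z + snd z)) \<partial>(density lborel (\<lambda>x. ennreal (?K x)) \<Otimes>\<^sub>M density lborel (\<lambda>x. ennreal (f x))))"
        unfolding conv[symmetric] convolution_def char_def
        by (subst integral_distr[OF sm]) (auto simp: case_prod_unfold)
      also have "\<dots> = (\<integral>x. (\<integral>y. iexp (\<tau> * (x + y)) \<partial>density lborel (\<lambda>x. ennreal (f x))) \<partial>density lborel (\<lambda>x. ennreal (?K x)))"
      proof (subst P.integral_fst'[symmetric])
        show "integrable (density lborel (\<lambda>x. ennreal (?K x)) \<Otimes>\<^sub>M density lborel (\<lambda>x. ennreal (f x))) (\<lambda>z. iexp (\<tau> * (fst z + snd z)))"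
          by (rule P.integrable_iexp) (auto cong: measurable_cong_sets sets_pair_measure_cong)
      qed simp
      also have "\<dots> = (\<integral>x. iexp (\<tau> * x) * cf f \<tau> \<partial>density lborel (\<lambda>x. ennreal (?K x)))"
        unfolding char_def
        by (intro Bochner_Integration.integral_cong refl)
           (simp add: distrib_left exp_add)
      also have "\<dots> = cf ?K \<tau> * cf f \<tau>" unfolding char_def by simp
      finally show ?thesis .
    qed
    then show ?case using PL Suc by (simp del: sum_density.simps)
  qed
  then show "prob_density (sum_density f (Suc n))" "cf (sum_density f (Suc n)) \<tau> = cf f \<tau> ^ Suc n"
    by blast+
qed

lemma integral_iexp_interval:
  fixes a b t :: real
  assumes "a \<le> b" "t \<noteq> 0"
  shows "(LBINT x. indicator {a..b} x *\<^sub>R iexp (- (t * x))) = (iexp (- (t * a)) - iexp (- (t * b))) / (\<i> * t)"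
proof -
  have "(LBINT x. indicator {a..b} x *\<^sub>R iexp (- (t * x)))
     = \<i> / t * iexp (- (t * b)) - \<i> / t * iexp (- (t * a))"
  proof (rule integral_FTC_atLeastAtMost[OF \<open>a \<le> b\<close>])
    fix x :: real
    show "((\<lambda>x. \<i> / t * iexp (- (t * x))) has_vector_derivative iexp (- (t * x))) (at x within {a..b})"
    proof -
      have "((\<lambda>z. \<i> / t * exp (\<i> * - (t * z))) has_field_derivative exp (\<i> * - (t * of_real x))) (at (of_real x :: complex))"
        using \<open>t \<noteq> 0\<close> by (auto intro!: derivative_eq_intros simp: field_simps)
      from has_vector_derivative_real_field[OF this] show ?thesis by simp
    qed
  qed (intro continuous_intros)
  then show ?thesis by (simp add: divide_inverse algebra_simps)
qed

text \<open>Levy's inversion formula expresses the mass of an interval through the characteristic function.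
  If the latter is integrable, then by Fubini's theorem this mass is the integral over the interval
  of the inverse transform, which is thus a density of the same law.\<close>
lemma density_eq_inverse_transform_AE:
  assumes K: "prob_density K" and int: "integrable lborel (cf K)"
  shows "AE x in lborel. complex_of_real (K x) = 1 / (2 * pi) * (LBINT \<tau>. iexp (- (\<tau> * x)) * cf K \<tau>)"
proof -
  note KD = prob_densityD[OF K]
  note [measurable] = KD(1)
  interpret D: real_distribution "density lborel (\<lambda>x. ennreal (K x))"
    by (rule real_distribution_density[OF K])
  have [measurable]: "cf K \<in> borel_measurable borel" by (rule D.char_measurable)
  define Z where "Z x = 1 / (2 * pi) * (LBINT \<tau>. iexp (- (\<tau> * x)) * cf K \<tau>)" for x
  have Zcont: "isCont Z x" for x
    unfolding Z_def isCont_def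
  proof (intro tendsto_intros)
    show "(\<lambda>x. \<integral>\<tau>. iexp (- (\<tau> * x)) * cf K \<tau> \<partial>lborel) \<midarrow>x\<rightarrow> (LBINT \<tau>. iexp (- (\<tau> * x)) * cf K \<tau>)"
      unfolding tendsto_at_iff_sequentially comp_def
      by (intro allI impI integral_dominated_convergence[where w = "\<lambda>\<tau>. cmod (cf K \<tau>)"])
         (auto simp: norm_mult int intro!: tendsto_intros AE_I2)
  qed
  have Zcont': "continuous_on A Z" for A using Zcont by (simp add: continuous_at_imp_continuous_on)
  then have [measurable]: "Z \<in> borel_measurable borel"
    by (intro borel_measurable_continuous_onI)
  have atom: "measure (density lborel (\<lambda>x. ennreal (K x))) {a} = 0" for a
  proof -
    have "AE x in lborel. x \<noteq> a" by (rule AE_lborel_singleton)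
    then have "emeasure (density lborel (\<lambda>x. ennreal (K x))) {a} = 0"
      by (subst emeasure_density) (auto simp: nn_integral_0_iff_AE indicator_def elim!: eventually_mono)
    then show ?thesis by (simp add: measure_def)
  qed
  have Zint: "set_integrable lborel {a..b} Z" for a b
    unfolding set_integrable_def by (rule borel_integrable_compact) (auto simp: Zcont')
  have interval: "(LBINT x. indicator {a..b} x *\<^sub>R Z x) = of_real (measure (density lborel (\<lambda>x. ennreal (K x))) {a<..b})"
    if "a \<le> b" for a b
  proof -
    let ?F = "\<lambda>t. (iexp (- (t * a)) - iexp (- (t * b))) / (\<i> * t) * cf K t"
    have Fb: "cmod (?F t) \<le> (b - a) * cmod (cf K t)" if "t \<noteq> 0" for t
    proof -
      have "cmod ((iexp (- (t * a)) - iexp (- (t * b))) / (\<i> * t)) \<le> b - a"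
        using Levy_Inversion_aux2[of a b "- t"] that \<open>a \<le> b\<close>
        by (simp add: norm_divide norm_mult norm_minus_commute)
      then show ?thesis unfolding norm_mult by (intro mult_right_mono) simp_all
    qed
    have nz: "AE t::real in lborel. t \<noteq> 0" by (rule AE_lborel_singleton)
    have [measurable]: "?F \<in> borel_measurable borel" by measurable
    have lim: "(\<lambda>T. CLBINT t=-(real T)..real T. ?F t) \<longlonglongrightarrow> (LBINT t. ?F t)"
    proof -
      have eq: "(CLBINT t=-(real T)..real T. ?F t) = (LBINT t. indicator {- real T<..<real T} t *\<^sub>R ?F t)" for T
        unfolding interval_lebesgue_integral_def set_lebesgue_integral_def by (simp add: einterval_def greaterThanLessThan_def greaterThan_def lessThan_def Int_def)
      show ?thesis unfolding eq
      proof (rule integral_dominated_convergence[where w = "\<lambda>t. (b - a) * cmod (cf K t)"])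
        show "AE t in lborel. (\<lambda>T. indicator {- real T<..<real T} t *\<^sub>R ?F t) \<longlonglongrightarrow> ?F t"
        proof (rule AE_I2)
          fix t
          have "eventually (\<lambda>T. \<bar>t\<bar> < real T) sequentially"
            using filterlim_real_sequentially by (auto simp: filterlim_at_top_dense)
          then show "(\<lambda>T. indicator {- real T<..<real T} t *\<^sub>R ?F t) \<longlonglongrightarrow> ?F t"
            by (intro tendsto_eventually, rule eventually_mono) (auto simp: indicator_def abs_less_iff)
        qed
        show "AE t in lborel. cmod (indicator {- real T<..<real T} t *\<^sub>R ?F t) \<le> (b - a) * cmod (cf K t)" for T
          using nz by (rule eventually_mono) (use Fb \<open>a \<le> b\<close> in \<open>auto simp: indicator_def\<close>)
      qed (use int in auto)
    qed
    have "(\<lambda>T. 1 / (2 * pi) * (CLBINT t=-(real T)..real T. ?F t)) \<longlonglongrightarrow> of_real (measure (density lborel (\<lambda>x. ennreal (K x))) {a<..b})"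
      using D.Levy_Inversion[OF \<open>a \<le> b\<close> atom atom] by simp
    moreover have "(\<lambda>T. 1 / (2 * pi) * (CLBINT t=-(real T)..real T. ?F t)) \<longlonglongrightarrow> 1 / (2 * pi) * (LBINT t. ?F t)"
      by (intro tendsto_intros lim)
    ultimately have "of_real (measure (density lborel (\<lambda>x. ennreal (K x))) {a<..b}) = 1 / (2 * pi) * (LBINT t. ?F t)"
      by (rule LIMSEQ_unique)
    also have "(LBINT t. ?F t) = (LBINT t. (LBINT x. indicator {a..b} x *\<^sub>R (iexp (- (t * x)) * cf K t)))"
    proof (rule integral_cong_AE)
      show "AE t in lborel. ?F t = (LBINT x. indicator {a..b} x *\<^sub>R (iexp (- (t * x)) * cf K t))"
        using nz
      proof (rule eventually_mono)
        fix t :: real assume "t \<noteq> 0"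
        have "(LBINT x. indicator {a..b} x *\<^sub>R (iexp (- (t * x)) * cf K t))
            = (LBINT x. indicator {a..b} x *\<^sub>R iexp (- (t * x)) * cf K t)"
          by (simp only: mult_scaleR_left)
        also have "\<dots> = ?F t"
          unfolding integral_mult_left_zero integral_iexp_interval[OF \<open>a \<le> b\<close> \<open>t \<noteq> 0\<close>] ..
        finally show "?F t = (LBINT x. indicator {a..b} x *\<^sub>R (iexp (- (t * x)) * cf K t))"
          by (rule sym)
      qed
    qed measurable
    also have "\<dots> = (LBINT x. (LBINT t. indicator {a..b} x *\<^sub>R (iexp (- (t * x)) * cf K t)))"
      by (rule integral_swap_dominated_by_product[where f = "indicator {a..b}" and g = "\<lambda>t. cmod (cf K t)"])
         (use \<open>a \<le> b\<close> in \<open>auto simp: norm_mult int intro!: integrable_real_indicator\<close>)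
    also have "\<dots> = (LBINT x. 2 * pi * (indicator {a..b} x *\<^sub>R Z x))"
      unfolding Z_def by (simp add: mult_scaleR_right)
    also have "\<dots> = 2 * pi * (LBINT x. indicator {a..b} x *\<^sub>R Z x)"
      by (rule integral_mult_right_zero)
    finally show ?thesis by simp
  qed
  have ReZ: "(LBINT x. indicator {a..b} x * Re (Z x)) = measure (density lborel (\<lambda>x. ennreal (K x))) {a<..b}"
    and ImZ: "(LBINT x. indicator {a..b} x * Im (Z x)) = 0" if "a \<le> b" for a b
    using arg_cong[OF interval[OF that], of Re] arg_cong[OF interval[OF that], of Im]
      integral_Re[OF Zint[of a b, unfolded set_integrable_def]] integral_Im[OF Zint[of a b, unfolded set_integrable_def]]
    by simp_all
  \<comment> \<open>a continuous function is nonnegative if all its integrals over intervals are; this applies to the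
    real part of the inverse transform and to both signs of its imaginary part\<close>
  have no_neg: False
    if G: "continuous_on UNIV G" and I: "\<And>a b. a \<le> b \<Longrightarrow> 0 \<le> (LBINT x. indicator {a..b} x * G x)"
      and "G x0 < 0" for G :: "real \<Rightarrow> real" and x0
  proof -
    have "isCont G x0" using G by (simp add: continuous_on_eq_continuous_at)
    then have "eventually (\<lambda>x. G x < G x0 / 2) (at x0)"
      using that(3) unfolding isCont_def by (intro order_tendstoD(2)) auto
    then obtain d where d: "d > 0" "\<And>x. x \<noteq> x0 \<Longrightarrow> dist x x0 < d \<Longrightarrow> G x < G x0 / 2"
      unfolding eventually_at by auto
    have "(LBINT x. indicator {x0..x0 + d/2} x * G x) \<le> (LBINT x. indicator {x0..x0 + d/2} x * (G x0 / 2))"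
    proof (rule integral_mono)
      show "integrable lborel (\<lambda>x. indicator {x0..x0 + d/2} x * G x)"
        using borel_integrable_compact[of "{x0..x0+d/2}" G] G continuous_on_subset by auto
      show "indicator {x0..x0 + d/2} x * G x \<le> indicator {x0..x0 + d/2} x * (G x0 / 2)" for x
        using d(1) d(2)[of x] \<open>G x0 < 0\<close> by (cases "x = x0") (auto simp: indicator_def dist_real_def intro!: less_imp_le)
    qed (intro integrable_mult_left integrable_real_indicator, use d(1) in simp_all)
    also have "\<dots> = d / 2 * (G x0 / 2)" using d(1) by simp
    also have "\<dots> < 0" using d(1) \<open>G x0 < 0\<close> by (simp add: mult_less_0_iff)
    finally show False using I[of x0 "x0 + d/2"] d(1) by simp
  qed
  have Re0: "0 \<le> Re (Z x)" for x
    
  proof (rule ccontr)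
    assume "\<not> 0 \<le> Re (Z x)"
    then show False
      by (intro no_neg[of "\<lambda>x. Re (Z x)" x] continuous_intros Zcont') (simp_all add: ReZ)
  qed
  have "Im (Z x) \<ge> 0" for x
  proof (rule ccontr)
    assume "\<not> 0 \<le> Im (Z x)"
    then show False
      by (intro no_neg[of "\<lambda>x. Im (Z x)" x] continuous_intros Zcont') (simp_all add: ImZ)
  qed
  moreover have "- Im (Z x) \<ge> 0" for x
  proof (rule ccontr)
    assume "\<not> 0 \<le> - Im (Z x)"
    then show False
      by (intro no_neg[of "\<lambda>x. - Im (Z x)" x] continuous_intros Zcont') (simp_all add: ImZ)
  qed
  ultimately have Im0: "Im (Z x) = 0" for x by (metis neg_0_le_iff_le order_antisym)
  have box: "emeasure (density lborel (\<lambda>x. ennreal (Re (Z x)))) {a<..b} = emeasure (density lborel (\<lambda>x. ennreal (K x))) {a<..b}"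
    if "a \<le> b" for a b
  proof -
    have "emeasure (density lborel (\<lambda>x. ennreal (Re (Z x)))) {a<..b} = (\<integral>\<^sup>+x. ennreal (indicator {a..b} x * Re (Z x)) \<partial>lborel)"
    proof (subst emeasure_density)
      have "AE x in lborel. x \<noteq> a" by (rule AE_lborel_singleton)
      then show "(\<integral>\<^sup>+x. ennreal (Re (Z x)) * indicator {a<..b} x \<partial>lborel) = (\<integral>\<^sup>+x. ennreal (indicator {a..b} x * Re (Z x)) \<partial>lborel)"
        by (intro nn_integral_cong_AE) (auto simp: indicator_def elim!: eventually_mono)
    qed auto
    also have "\<dots> = ennreal (LBINT x. indicator {a..b} x * Re (Z x))"
    proof (rule nn_integral_eq_integral)
      show "integrable lborel (\<lambda>x. indicator {a..b} x * Re (Z x))"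
        using integrable_Re[OF Zint[of a b, unfolded set_integrable_def]] by simp
    qed (auto simp: Re0)
    also have "\<dots> = emeasure (density lborel (\<lambda>x. ennreal (K x))) {a<..b}"
      unfolding ReZ[OF that] by (simp add: D.emeasure_eq_measure)
    finally show ?thesis .
  qed
  have "density lborel (\<lambda>x. ennreal (K x)) = density lborel (\<lambda>x. ennreal (Re (Z x)))"
  proof (rule measure_eqI_lessThan)
    fix x
    show "emeasure (density lborel (\<lambda>x. ennreal (K x))) {x<..} < \<infinity>"
      by (simp add: D.emeasure_eq_measure)
    have un: "{x<..} = (\<Union>n::nat. {x<..x + real n})"
      
    proof (intro equalityI subsetI)
      fix y assume "y \<in> {x<..}"
      moreover obtain n :: nat where "y - x \<le> real n" using real_arch_simple by blast
      ultimately have "y \<in> {x<..x + real n}" by simp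
      then show "y \<in> (\<Union>n::nat. {x<..x + real n})" by blast
    qed auto
    have inc: "incseq (\<lambda>n::nat. {x<..x + real n})" by (auto simp: incseq_def)
    show "emeasure (density lborel (\<lambda>x. ennreal (K x))) {x<..} = emeasure (density lborel (\<lambda>x. ennreal (Re (Z x)))) {x<..}"
      unfolding un using inc
      by (subst (1 2) SUP_emeasure_incseq[symmetric]) (auto simp: box)
  qed auto
  then have "AE x in lborel. ennreal (K x) = ennreal (Re (Z x))"
    by (subst (asm) sigma_finite_density_unique) (auto simp: D.sigma_finite_measure_axioms)
  then show ?thesis
    unfolding Z_def[symmetric]
    by (rule eventually_mono) (auto simp: KD(2) Re0 Im0 complex_eq_iff)
qed

lemma integrable_cf_power:
  assumes f: "prob_density f" and C: "\<And>x. f x \<le> C" and n: "n \<ge> 2"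
  shows "integrable lborel (\<lambda>\<tau>. cf f \<tau> ^ n)"
proof (rule Bochner_Integration.integrable_bound[OF integrable_cf_square[OF f C]])
  interpret D: real_distribution "density lborel (\<lambda>x. ennreal (f x))"
    by (rule real_distribution_density[OF f])
  show "(\<lambda>\<tau>. cf f \<tau> ^ n) \<in> borel_measurable lborel" by simp
  show "AE \<tau> in lborel. cmod (cf f \<tau> ^ n) \<le> norm ((cmod (cf f \<tau>))\<^sup>2)"
    using n by (auto simp: norm_power D.cmod_char_le_1 intro!: power_decreasing)
qed

text \<open>The formula holds at every point: inversion of the power \<open>n - 1\<close> fails at most on a null set, and
  the last convolution with \<open>f\<close> does not see that set.  The power \<open>n - 1 \<ge> 2\<close> is integrable by the
  Plancherel bound.\<close>
lemma sum_density_inversion: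
  assumes f: "prob_density f" and C: "\<And>x. f x \<le> C" and n: "n \<ge> 3"
  shows "complex_of_real (sum_density f n x) = 1 / (2 * pi) * (LBINT \<tau>. iexp (- (\<tau> * x)) * cf f \<tau> ^ n)"
proof -
  obtain k where k: "n = Suc (Suc k)" "Suc k \<ge> 2" using n by (metis One_nat_def Suc_1 Suc_le_D Suc_le_mono numeral_3_eq_3)
  note fD = prob_densityD[OF f]
  let ?K = "sum_density f (Suc k)"
  note K = prob_density_sum_density[OF f C, of k]
  note [measurable] = fD(1) prob_densityD(1)[OF K(1)]
  interpret D: real_distribution "density lborel (\<lambda>x. ennreal (f x))"
    by (rule real_distribution_density[OF f])
  have [measurable]: "cf f \<in> borel_measurable borel" by (rule D.char_measurable)
  have int: "integrable lborel (\<lambda>\<tau>. cf f \<tau> ^ Suc k)" by (rule integrable_cf_power[OF f C k(2)])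
  define Z where "Z x = 1 / (2 * pi) * (LBINT \<tau>. iexp (- (\<tau> * x)) * cf f \<tau> ^ Suc k)" for x
  have "AE x in lborel. complex_of_real (?K x) = Z x"
    using density_eq_inverse_transform_AE[OF K(1)] int unfolding Z_def K(2) by simp
  then have AE: "AE y in lborel. complex_of_real (?K (x - y)) = Z (x - y)"
  proof -
    assume a: "AE x in lborel. complex_of_real (?K x) = Z x"
    have refl: "distr lborel borel (\<lambda>y. x - y) = (lborel :: real measure)"
      using lborel_real_affine[of "-1" x] by (simp add: density_1)
    show ?thesis
      by (rule AE_distrD[where M' = borel and f = "\<lambda>y. x - y"]) (simp_all only: refl a, simp)
  qed
  have [measurable]: "Z \<in> borel_measurable borel" unfolding Z_def by measurable
  have "complex_of_real (sum_density f n x) = (LBINT y. complex_of_real (f y * ?K (x - y)))"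
    unfolding k(1) sum_density.simps by (rule integral_complex_of_real[symmetric])
  also have "\<dots> = (LBINT y. f y *\<^sub>R Z (x - y))"
    using AE by (intro integral_cong_AE) (auto elim!: eventually_mono simp: scaleR_conv_of_real simp del: sum_density.simps)
  also have "\<dots> = (LBINT y. 1 / (2 * pi) * (LBINT \<tau>. f y *\<^sub>R (iexp (- (\<tau> * (x - y))) * cf f \<tau> ^ Suc k)))"
    unfolding Z_def integral_scaleR_right by (simp only: mult_scaleR_right)
  also have "\<dots> = 1 / (2 * pi) * (LBINT y. (LBINT \<tau>. f y *\<^sub>R (iexp (- (\<tau> * (x - y))) * cf f \<tau> ^ Suc k)))"
    by (rule integral_mult_right_zero)
  also have "(LBINT y. (LBINT \<tau>. f y *\<^sub>R (iexp (- (\<tau> * (x - y))) * cf f \<tau> ^ Suc k)))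
    = (LBINT \<tau>. (LBINT y. f y *\<^sub>R (iexp (- (\<tau> * (x - y))) * cf f \<tau> ^ Suc k)))"
    by (rule integral_swap_dominated_by_product[where f = f and g = "\<lambda>\<tau>. cmod (cf f \<tau> ^ Suc k)", symmetric])
       (use fD int in \<open>auto simp: norm_mult simp del: power_Suc\<close>)
  also have "\<dots> = (LBINT \<tau>. iexp (- (\<tau> * x)) * cf f \<tau> ^ n)"
  proof (intro Bochner_Integration.integral_cong refl)
    fix \<tau>
    have "(LBINT y. f y *\<^sub>R (iexp (- (\<tau> * (x - y))) * cf f \<tau> ^ Suc k))
      = (LBINT y. (iexp (- (\<tau> * x)) * cf f \<tau> ^ Suc k) * (f y *\<^sub>R iexp (\<tau> * y)))"
      by (intro Bochner_Integration.integral_cong refl) (simp add: scaleR_conv_of_real algebra_simps exp_diff exp_minus field_simps)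
    also have "\<dots> = iexp (- (\<tau> * x)) * cf f \<tau> ^ Suc k * cf f \<tau>"
      unfolding integral_mult_right_zero cf_eq[OF f] ..
    finally show "(LBINT y. f y *\<^sub>R (iexp (- (\<tau> * (x - y))) * cf f \<tau> ^ Suc k)) = iexp (- (\<tau> * x)) * cf f \<tau> ^ n"
      by (simp add: k(1) mult_ac)
  qed
  finally show ?thesis .
qed

section \<open>A local limit theorem for nearly Gaussian arrays\<close>

lemma integral_tendsto_eventually_dominated:
  fixes f :: "'a \<Rightarrow> 'b::{banach, second_countable_topology}"
  assumes f: "f \<in> borel_measurable M" and s: "\<And>n. s n \<in> borel_measurable M" and w: "integrable M w"
    and lim: "\<And>x. (\<lambda>n. s n x) \<longlonglongrightarrow> f x"
    and bound: "eventually (\<lambda>n. \<forall>x. norm (s n x) \<le> w x) sequentially"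
  shows "(\<lambda>n. integral\<^sup>L M (s n)) \<longlonglongrightarrow> integral\<^sup>L M f"
proof -
  obtain k where k: "\<And>n x. n \<ge> k \<Longrightarrow> norm (s n x) \<le> w x"
    using bound by (auto simp: eventually_sequentially)
  show ?thesis
  proof (rule LIMSEQ_offset[where k = k], rule integral_dominated_convergence[OF f s w])
    show "AE x in M. (\<lambda>n. s (n + k) x) \<longlonglongrightarrow> f x"
      using lim by (intro AE_I2 LIMSEQ_ignore_initial_segment)
    show "AE x in M. norm (s (n + k) x) \<le> w x" for n
      using k by (intro AE_I2) simp
  qed
qed

lemma prob_density_std_normal: "prob_density std_normal_density"
  unfolding prob_density_def by simp

lemma integrable_std_normal_weight: "integrable lborel (\<lambda>z. (1 + z\<^sup>2) * std_normal_density z)"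
proof -
  have "integrable lborel (\<lambda>z. std_normal_density z + std_normal_density z * z\<^sup>2)"
    using integrable_std_normal_moment[of 2] by simp
  then show ?thesis by (simp add: algebra_simps)
qed

definition standardized_density :: "(real \<Rightarrow> real) \<Rightarrow> bool" where
  "standardized_density f \<longleftrightarrow> prob_density f \<and> integrable lborel (\<lambda>z. z\<^sup>2 * f z) \<and>
     (LBINT z. z * f z) = 0 \<and> (LBINT z. z\<^sup>2 * f z) = 1"

lemma standardized_densityD:
  assumes "standardized_density f"
  shows "prob_density f" "integrable lborel (\<lambda>z. z * f z)" "integrable lborel (\<lambda>z. z\<^sup>2 * f z)"
    "(LBINT z. z * f z) = 0" "(LBINT z. z\<^sup>2 * f z) = 1"
    "integrable lborel (\<lambda>z. (1 + z\<^sup>2) * f z)" "(LBINT z. (1 + z\<^sup>2) * f z) = 2"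
proof -
  show *: "prob_density f" "integrable lborel (\<lambda>z. z\<^sup>2 * f z)"
    "(LBINT z. z * f z) = 0" "(LBINT z. z\<^sup>2 * f z) = 1"
    using assms unfolding standardized_density_def by auto
  note fD = prob_densityD[OF *(1)]
  note [measurable] = fD(1)
  show w: "integrable lborel (\<lambda>z. (1 + z\<^sup>2) * f z)" "(LBINT z. (1 + z\<^sup>2) * f z) = 2"
    using * fD by (simp_all add: distrib_right)
  have le: "\<bar>z\<bar> \<le> 1 + z\<^sup>2" for z :: real
    using sum_power2_ge_zero[of "\<bar>z\<bar> - 1" "\<bar>z\<bar>"] by (simp add: power2_eq_square algebra_simps)
  show "integrable lborel (\<lambda>z. z * f z)"
    by (rule Bochner_Integration.integrable_bound[OF w(1)])
       (auto intro!: AE_I2 mult_right_mono simp: abs_mult fD(2) le)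
qed

lemma standardized_std_normal: "standardized_density std_normal_density"
  using integrable_std_normal_moment[of 2] integral_std_normal_moment_odd[of 0] integral_std_normal_moment_even[of 1]
  by (simp add: standardized_density_def prob_density_std_normal mult.commute)

text \<open>For nonnegative functions with equal integrals, pointwise convergence is convergence in \<open>L\<^sup>1\<close>.
  Standardization makes the integrals equal even with the weight \<open>1 + z\<^sup>2\<close>: they are all \<open>2\<close>.\<close>
lemma weighted_scheffe:
  assumes f: "\<And>n. standardized_density (f n)"
    and lim: "\<And>z. (\<lambda>n. f n z) \<longlonglongrightarrow> std_normal_density z"
  shows "(\<lambda>n. \<integral>z. (1 + z\<^sup>2) * \<bar>f n z - std_normal_density z\<bar> \<partial>lborel) \<longlonglongrightarrow> 0"
proof -
  let ?F = "\<lambda>n z. (1 + z\<^sup>2) * f n z" and ?N = "\<lambda>z. (1 + z\<^sup>2) * std_normal_density z"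
  have ni: "(\<integral>\<^sup>+z. norm ((1 + z\<^sup>2) * h z) \<partial>lborel) = 2" if "standardized_density h" for h
  proof -
    note hD = standardized_densityD[OF that]
    have "(\<integral>\<^sup>+z. norm ((1 + z\<^sup>2) * h z) \<partial>lborel) = (\<integral>\<^sup>+z. (1 + z\<^sup>2) * h z \<partial>lborel)"
      using prob_densityD(2)[OF hD(1)] by (intro nn_integral_cong) simp
    also have "\<dots> = ennreal 2"
      using hD prob_densityD(2)[OF hD(1)] by (subst nn_integral_eq_integral) auto
    finally show ?thesis by simp
  qed
  have "(\<lambda>n. \<integral>\<^sup>+z. norm (?F n z - ?N z) \<partial>lborel) \<longlonglongrightarrow> 0"
  proof (rule Scheffe_lemma2)
    show "?F n \<in> borel_measurable lborel" for n
      using standardized_densityD(6)[OF f] by (rule borel_measurable_integrable)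
    show "AE z in lborel. (\<lambda>n. ?F n z) \<longlonglongrightarrow> ?N z" by (intro AE_I2 tendsto_intros lim)
    show "(\<integral>\<^sup>+z. norm (?F n z) \<partial>lborel) \<le> (\<integral>\<^sup>+z. norm (?N z) \<partial>lborel)" for n
      unfolding ni[OF f] ni[OF standardized_std_normal] ..
  qed (rule integrable_std_normal_weight)
  moreover have "(\<integral>\<^sup>+z. norm (?F n z - ?N z) \<partial>lborel) = ennreal (LBINT z. (1 + z\<^sup>2) * \<bar>f n z - std_normal_density z\<bar>)" for n
  proof -
    have "norm (?F n z - ?N z) = (1 + z\<^sup>2) * \<bar>f n z - std_normal_density z\<bar>" for z
      by (simp add: abs_mult flip: right_diff_distrib)
    moreover have "integrable lborel (\<lambda>z. norm (?F n z - ?N z))"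
      using standardized_densityD(6)[OF f] integrable_std_normal_weight by auto
    ultimately show ?thesis by (subst nn_integral_eq_integral) auto
  qed
  ultimately have "(\<lambda>n. ennreal (LBINT z. (1 + z\<^sup>2) * \<bar>f n z - std_normal_density z\<bar>)) \<longlonglongrightarrow> ennreal 0"
    by simp
  then show ?thesis by (rule tendsto_ennrealD[OF _ _]) (auto intro!: always_eventually integral_nonneg_AE)
qed

text \<open>For the second bound: both densities have total mass \<open>1\<close> and mean \<open>0\<close>, so \<open>exp (\<i> * u * z)\<close> can be replaced by
  \<open>exp (\<i> * u * z) - 1 - \<i> * u * z\<close> when it is integrated against their difference.\<close>
lemma
  assumes f: "standardized_density f"
  defines "\<delta> \<equiv> \<integral>z. (1 + z\<^sup>2) * \<bar>f z - std_normal_density z\<bar> \<partial>lborel"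
  shows cf_minus_gaussian_le: "cmod (cf f u - of_real (exp (- u\<^sup>2 / 2))) \<le> \<delta>"
    and cf_minus_gaussian_le_square: "cmod (cf f u - of_real (exp (- u\<^sup>2 / 2))) \<le> u\<^sup>2 / 2 * \<delta>"
proof -
  note fD = standardized_densityD[OF f] and nD = standardized_densityD[OF standardized_std_normal]
  note pf = prob_densityD[OF fD(1)] and pn = prob_densityD[OF nD(1)]
  note [measurable] = pf(1)
  let ?d = "\<lambda>z. f z - std_normal_density z"
  have dz: "?d z * z = z * f z - z * std_normal_density z" for z
    by (simp add: left_diff_distrib)
  have d: "integrable lborel ?d" "integrable lborel (\<lambda>z. ?d z * z)"
  proof -
    show "integrable lborel ?d" using pf(3) by simp
    have "integrable lborel (\<lambda>z. z * f z - z * std_normal_density z)" using fD(2) nD(2) by simp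
    then show "integrable lborel (\<lambda>z. ?d z * z)" by (simp only: dz)
  qed
  have iw: "integrable lborel (\<lambda>z. (1 + z\<^sup>2) * \<bar>?d z\<bar>)"
  proof -
    have "integrable lborel (\<lambda>z. \<bar>(1 + z\<^sup>2) * f z - (1 + z\<^sup>2) * std_normal_density z\<bar>)"
      using fD(6) nD(6) by auto
    moreover have "\<bar>(1 + z\<^sup>2) * f z - (1 + z\<^sup>2) * std_normal_density z\<bar> = (1 + z\<^sup>2) * \<bar>?d z\<bar>" for z
      by (simp add: abs_mult flip: right_diff_distrib)
    ultimately show ?thesis by simp
  qed
  have ci: "integrable lborel (\<lambda>z. h z *\<^sub>R iexp (u * z))" if "integrable lborel h" for h :: "real \<Rightarrow> real"
  proof -
    have [measurable]: "h \<in> borel_measurable borel" using that by auto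
    show ?thesis by (rule Bochner_Integration.integrable_bound[OF that]) auto
  qed
  have g: "of_real (exp (- u\<^sup>2 / 2)) = cf std_normal_density u"
    by (simp add: char_std_normal_distribution)
  have diff: "cf f u - of_real (exp (- u\<^sup>2 / 2)) = (LBINT z. ?d z *\<^sub>R iexp (u * z))"
    unfolding g cf_eq[OF fD(1)] cf_eq[OF nD(1)]
    using Bochner_Integration.integral_diff[OF ci[OF pf(3)] ci[OF pn(3)]] by (simp only: scaleR_diff_left)
  show "cmod (cf f u - of_real (exp (- u\<^sup>2 / 2))) \<le> \<delta>"
  proof -
    have "cmod (cf f u - of_real (exp (- u\<^sup>2 / 2))) \<le> (LBINT z. norm (?d z *\<^sub>R iexp (u * z)))"
      unfolding diff by (rule integral_norm_bound)
    also have "\<dots> \<le> \<delta>" unfolding \<delta>_def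
    proof (rule integral_mono'[OF iw])
      fix z
      have "1 * \<bar>?d z\<bar> \<le> (1 + z\<^sup>2) * \<bar>?d z\<bar>" by (rule mult_right_mono) auto
      then show "norm (?d z *\<^sub>R iexp (u * z)) \<le> (1 + z\<^sup>2) * \<bar>?d z\<bar>" by simp
    qed simp
    finally show ?thesis .
  qed
  have lin: "(LBINT z. ?d z *\<^sub>R (1 + \<i> * (u * z))) = 0"
  proof -
    have i2: "integrable lborel (\<lambda>z. complex_of_real (?d z))" "integrable lborel (\<lambda>z. \<i> * u * complex_of_real (?d z * z))"
      using d by (auto simp del: of_real_diff of_real_mult)
    have "(LBINT z. ?d z *\<^sub>R (1 + \<i> * (u * z))) = (LBINT z. complex_of_real (?d z) + \<i> * u * complex_of_real (?d z * z))"
      by (intro Bochner_Integration.integral_cong refl) (simp add: scaleR_conv_of_real algebra_simps)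
    also have "\<dots> = complex_of_real (LBINT z. ?d z) + \<i> * u * complex_of_real (LBINT z. ?d z * z)"
      by (simp only: Bochner_Integration.integral_add[OF i2] integral_mult_right_zero integral_complex_of_real)
    also have "(LBINT z. ?d z) = 0" using pf pn by simp
    also have "(LBINT z. ?d z * z) = 0"
      unfolding dz using Bochner_Integration.integral_diff[OF fD(2) nD(2)] fD(4) nD(4) by simp
    finally show ?thesis by simp
  qed
  have il: "integrable lborel (\<lambda>z. ?d z *\<^sub>R (1 + \<i> * (u * z)))"
  proof (rule Bochner_Integration.integrable_bound)
    show "integrable lborel (\<lambda>z. \<bar>?d z\<bar> + \<bar>u\<bar> * \<bar>?d z * z\<bar>)" using d by auto
    have lin_le: "\<bar>?d z\<bar> * cmod (1 + \<i> * (u * z)) \<le> \<bar>?d z\<bar> + \<bar>u\<bar> * \<bar>?d z * z\<bar>" for z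
    proof -
      have "cmod (1 + \<i> * (u * z)) \<le> 1 + \<bar>u\<bar> * \<bar>z\<bar>"
        using norm_triangle_ineq[of 1 "\<i> * (u * z)"] by (simp add: norm_mult)
      then have "\<bar>?d z\<bar> * cmod (1 + \<i> * (u * z)) \<le> \<bar>?d z\<bar> * (1 + \<bar>u\<bar> * \<bar>z\<bar>)"
        by (rule mult_left_mono) simp
      also have "\<dots> = \<bar>?d z\<bar> + \<bar>u\<bar> * \<bar>?d z * z\<bar>" unfolding abs_mult distrib_left mult_1_right by (simp only: mult_ac)
      finally show ?thesis .
    qed
    show "AE z in lborel. norm (?d z *\<^sub>R (1 + \<i> * (u * z))) \<le> norm (\<bar>?d z\<bar> + \<bar>u\<bar> * \<bar>?d z * z\<bar>)"

    proof (intro AE_I2)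
      fix z
      have "norm (?d z *\<^sub>R (1 + \<i> * (u * z))) = \<bar>?d z\<bar> * cmod (1 + \<i> * (u * z))" by (simp only: norm_scaleR)
      moreover have "norm (\<bar>?d z\<bar> + \<bar>u\<bar> * \<bar>?d z * z\<bar>) = \<bar>?d z\<bar> + \<bar>u\<bar> * \<bar>?d z * z\<bar>"
        unfolding real_norm_def by (intro abs_of_nonneg add_nonneg_nonneg mult_nonneg_nonneg abs_ge_zero)
      ultimately show "norm (?d z *\<^sub>R (1 + \<i> * (u * z))) \<le> norm (\<bar>?d z\<bar> + \<bar>u\<bar> * \<bar>?d z * z\<bar>)"
        using lin_le[of z] by (simp only:)
    qed
  qed simp
  have "cf f u - of_real (exp (- u\<^sup>2 / 2)) = (LBINT z. ?d z *\<^sub>R iexp (u * z)) - (LBINT z. ?d z *\<^sub>R (1 + \<i> * (u * z)))"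
    unfolding lin diff by simp
  also have "\<dots> = (LBINT z. ?d z *\<^sub>R (iexp (u * z) - (1 + \<i> * (u * z))))"
    using Bochner_Integration.integral_diff[OF ci[OF d(1)] il] by (simp only: scaleR_diff_right)
  finally have "cmod (cf f u - of_real (exp (- u\<^sup>2 / 2))) \<le> (LBINT z. norm (?d z *\<^sub>R (iexp (u * z) - (1 + \<i> * (u * z)))))"
    by (simp only: integral_norm_bound)
  also have "\<dots> \<le> (LBINT z. u\<^sup>2 / 2 * ((1 + z\<^sup>2) * \<bar>?d z\<bar>))"
  proof (rule integral_mono')
    show "integrable lborel (\<lambda>z. u\<^sup>2 / 2 * ((1 + z\<^sup>2) * \<bar>?d z\<bar>))" using iw by (rule integrable_mult_right)
    fix z
    have "cmod (iexp (u * z) - (1 + \<i> * (u * z))) \<le> (u * z)\<^sup>2 / 2"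
      using iexp_approx1[of "u * z" 1] by (simp add: numeral_2_eq_2)
    also have "\<dots> \<le> u\<^sup>2 / 2 * (1 + z\<^sup>2)" by (simp add: power_mult_distrib algebra_simps)
    finally have "\<bar>?d z\<bar> * cmod (iexp (u * z) - (1 + \<i> * (u * z))) \<le> \<bar>?d z\<bar> * (u\<^sup>2 / 2 * (1 + z\<^sup>2))"
      by (rule mult_left_mono) simp
    then show "norm (?d z *\<^sub>R (iexp (u * z) - (1 + \<i> * (u * z)))) \<le> u\<^sup>2 / 2 * ((1 + z\<^sup>2) * \<bar>?d z\<bar>)"
      by (simp only: norm_scaleR real_norm_def mult_ac)
  qed simp
  also have "\<dots> = u\<^sup>2 / 2 * \<delta>" unfolding \<delta>_def by simp
  finally show "cmod (cf f u - of_real (exp (- u\<^sup>2 / 2))) \<le> u\<^sup>2 / 2 * \<delta>" .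
qed

lemma integrable_gaussian_half: "integrable lborel (\<lambda>\<tau>::real. exp (- \<tau>\<^sup>2 / 4))"
proof -
  have "exp (- \<tau>\<^sup>2 / 4) = sqrt (4 * pi) * normal_density 0 (sqrt 2) \<tau>" for \<tau>
    by (simp add: normal_density_def)
  then show ?thesis by simp
qed

text \<open>Both sides of the difference are inverse transforms; \<open>1 / (2 * pi)\<close> is replaced by the bound \<open>1\<close>.\<close>
lemma sum_density_minus_gaussian_le:
  assumes f: "prob_density f" and C: "\<And>x. f x \<le> C" and n: "n \<ge> 3"
  shows "\<bar>sqrt n * sum_density f n (sqrt n * x) - std_normal_density x\<bar>
    \<le> (LBINT \<tau>. cmod (cf f (\<tau> / sqrt n) ^ n - of_real (exp (- \<tau>\<^sup>2 / 2))))"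
proof -
  interpret D: real_distribution "density lborel (\<lambda>x. ennreal (f x))"
    by (rule real_distribution_density[OF f])
  have [measurable]: "cf f \<in> borel_measurable borel" by (rule D.char_measurable)
  let ?r = "sqrt (real n)"
  have r: "?r > 0" using n by simp
  have int: "integrable lborel (\<lambda>\<tau>. cf f (\<tau> / ?r) ^ n)"
    using lborel_integrable_real_affine[OF integrable_cf_power[OF f C, of n], of "1 / ?r" 0] n r by simp
  have int2: "integrable lborel (\<lambda>\<tau>. iexp (- (\<tau> * x)) * cf f (\<tau> / ?r) ^ n)"
    by (rule Bochner_Integration.integrable_bound[OF int]) (auto simp: norm_mult)
  have ig: "integrable lborel (\<lambda>\<tau>::real. exp (- \<tau>\<^sup>2 / 2))"
    by (rule Bochner_Integration.integrable_bound[OF integrable_gaussian_half]) auto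
  have ig2: "integrable lborel (\<lambda>\<tau>. iexp (- (\<tau> * x)) * complex_of_real (exp (- \<tau>\<^sup>2 / 2)))"
    by (rule Bochner_Integration.integrable_bound[OF ig]) (auto simp: norm_mult)
  have "complex_of_real (sum_density f n (?r * x)) = 1 / (2 * pi) * (LBINT \<tau>. iexp (- (\<tau> * (?r * x))) * cf f \<tau> ^ n)"
    by (rule sum_density_inversion[OF f C n])
  also have "(LBINT \<tau>. iexp (- (\<tau> * (?r * x))) * cf f \<tau> ^ n) = \<bar>1 / ?r\<bar> *\<^sub>R (LBINT \<tau>. iexp (- (\<tau> * x)) * cf f (\<tau> / ?r) ^ n)"
    using r by (subst lborel_integral_real_affine[where c = "1 / ?r" and t = 0]) simp_all
  finally have 1: "complex_of_real (?r * sum_density f n (?r * x)) = 1 / (2 * pi) * (LBINT \<tau>. iexp (- (\<tau> * x)) * cf f (\<tau> / ?r) ^ n)"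
    using r by (simp add: scaleR_conv_of_real)
  have "complex_of_real (exp (- x\<^sup>2 / 2)) = (LBINT \<tau>. normal_density 0 1 \<tau> *\<^sub>R iexp (\<tau> * - x))"
    using gaussian_transform[of 1 "- x"] by simp
  also have "\<dots> = (LBINT \<tau>. (1 / sqrt (2 * pi)) *\<^sub>R (iexp (- (\<tau> * x)) * complex_of_real (exp (- \<tau>\<^sup>2 / 2))))"
    by (intro Bochner_Integration.integral_cong refl) (simp add: std_normal_density_def scaleR_conv_of_real)
  also have "\<dots> = (1 / sqrt (2 * pi)) *\<^sub>R (LBINT \<tau>. iexp (- (\<tau> * x)) * complex_of_real (exp (- \<tau>\<^sup>2 / 2)))"
    by (rule integral_scaleR_right)
  finally have g: "complex_of_real (exp (- x\<^sup>2 / 2)) = (1 / sqrt (2 * pi)) *\<^sub>R (LBINT \<tau>. iexp (- (\<tau> * x)) * complex_of_real (exp (- \<tau>\<^sup>2 / 2)))" .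
  have "complex_of_real (std_normal_density x) = (1 / sqrt (2 * pi)) *\<^sub>R complex_of_real (exp (- x\<^sup>2 / 2))"
    by (simp add: std_normal_density_def scaleR_conv_of_real)
  also have "\<dots> = (1 / (2 * pi)) *\<^sub>R (LBINT \<tau>. iexp (- (\<tau> * x)) * complex_of_real (exp (- \<tau>\<^sup>2 / 2)))"
    unfolding g scaleR_scaleR by (simp only: times_divide_times_eq real_sqrt_mult_self) simp
  finally have 2: "complex_of_real (std_normal_density x) = 1 / (2 * pi) * (LBINT \<tau>. iexp (- (\<tau> * x)) * complex_of_real (exp (- \<tau>\<^sup>2 / 2)))"
    by (simp add: scaleR_conv_of_real)
  have "\<bar>?r * sum_density f n (?r * x) - std_normal_density x\<bar> = cmod (complex_of_real (?r * sum_density f n (?r * x)) - complex_of_real (std_normal_density x))"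
    by (simp only: norm_of_real flip: of_real_diff)
  also have "\<dots> = cmod (1 / (2 * pi) * (LBINT \<tau>. iexp (- (\<tau> * x)) * (cf f (\<tau> / ?r) ^ n - of_real (exp (- \<tau>\<^sup>2 / 2)))))"
    unfolding 1 2 using Bochner_Integration.integral_diff[OF int2 ig2] by (simp only: right_diff_distrib)
  also have "\<dots> = 1 / (2 * pi) * cmod (LBINT \<tau>. iexp (- (\<tau> * x)) * (cf f (\<tau> / ?r) ^ n - of_real (exp (- \<tau>\<^sup>2 / 2))))"
    by (simp add: norm_mult norm_divide)
  also have "\<dots> \<le> 1 * cmod (LBINT \<tau>. iexp (- (\<tau> * x)) * (cf f (\<tau> / ?r) ^ n - of_real (exp (- \<tau>\<^sup>2 / 2))))"
    using pi_ge_two by (intro mult_right_mono) auto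
  also have "\<dots> \<le> 1 * (LBINT \<tau>. norm (iexp (- (\<tau> * x)) * (cf f (\<tau> / ?r) ^ n - of_real (exp (- \<tau>\<^sup>2 / 2)))))"
    by (intro mult_left_mono integral_norm_bound) simp
  finally show ?thesis by (simp add: norm_mult)
qed

text \<open>The summands may change with \<open>n\<close> independently of their number \<open>N n\<close>, because they are nearly
  normal themselves.  For \<open>\<bar>\<tau>\<bar> \<le> sqrt (N n)\<close>, the \<open>N n\<close>-th powers of the two characteristic functions
  at \<open>u = \<tau> / sqrt (N n)\<close> differ by at most \<open>N n * (u\<^sup>2 / 2) * \<delta> n = \<tau>\<^sup>2 / 2 * \<delta> n\<close>, and a Gaussian
  dominates them.  For larger \<open>\<bar>\<tau>\<bar>\<close> the characteristic function is at most \<open>5 / 6\<close>; two of its factors are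
  kept for the Plancherel bound and the others decay geometrically.\<close>
theorem local_limit_uniform:
  assumes f: "\<And>n. standardized_density (f n)"
    and lim: "\<And>z. (\<lambda>n. f n z) \<longlonglongrightarrow> std_normal_density z"
    and bdd: "\<And>n. bounded (range (f n))" and C: "eventually (\<lambda>n. \<forall>x. f n x \<le> C) sequentially"
    and N: "filterlim N at_top sequentially"
  shows "(\<lambda>n. sqrt (N n) * sum_density (f n) (N n) (sqrt (N n) * x n) - std_normal_density (x n)) \<longlonglongrightarrow> 0"
proof -
  define \<delta> where "\<delta> n = (LBINT z. (1 + z\<^sup>2) * \<bar>f n z - std_normal_density z\<bar>)" for n
  have \<delta>0: "\<delta> \<longlonglongrightarrow> 0" unfolding \<delta>_def by (rule weighted_scheffe[OF f lim])
  note pd = standardized_densityD(1)[OF f]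
  have [measurable]: "cf (f n) \<in> borel_measurable borel" for n
    using real_distribution.char_measurable[OF real_distribution_density[OF pd]] .
  have le1: "cmod (cf (f n) u) \<le> 1" for n u
    using real_distribution.cmod_char_le_1[OF real_distribution_density[OF pd]] .
  define B where "B n = (SUP x. f n x)" for n
  have B: "f n x \<le> B n" for n x unfolding B_def
    by (rule cSUP_upper) (use bdd[of n] in \<open>auto intro: bounded_imp_bdd_above\<close>)
  define A where "A n \<tau> = (if \<bar>\<tau>\<bar> \<le> sqrt (N n) then cmod (cf (f n) (\<tau> / sqrt (N n)) ^ N n - of_real (exp (- \<tau>\<^sup>2 / 2))) else exp (- \<tau>\<^sup>2 / 2))" for n \<tau>
  have [measurable]: "A n \<in> borel_measurable borel" for n unfolding A_def by measurable
  have Nr: "filterlim (\<lambda>n. sqrt (real (N n))) at_top sequentially"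
    by (intro filterlim_compose[OF sqrt_at_top] filterlim_compose[OF filterlim_real_sequentially] N)
  have N3: "eventually (\<lambda>n. N n \<ge> 3) sequentially" using N by (auto simp: filterlim_at_top)
  have \<delta>s: "eventually (\<lambda>n. \<delta> n < 1 / 6) sequentially" by (rule order_tendstoD(2)[OF \<delta>0]) simp
  have Alim: "(\<lambda>n. A n \<tau>) \<longlonglongrightarrow> 0" for \<tau>
  proof (rule Lim_null_comparison)
    show "eventually (\<lambda>n. norm (A n \<tau>) \<le> \<tau>\<^sup>2 / 2 * \<delta> n) sequentially"
      using N3 filterlim_at_top[THEN iffD1, OF Nr, rule_format, of "\<bar>\<tau>\<bar>"]
    proof eventually_elim
      case (elim n)
      let ?u = "\<tau> / sqrt (N n)"
      have u2: "?u\<^sup>2 = \<tau>\<^sup>2 / N n" by (simp add: power_divide)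
      have e: "complex_of_real (exp (- \<tau>\<^sup>2 / 2)) = of_real (exp (- ?u\<^sup>2 / 2)) ^ N n"
        using elim unfolding u2 by (simp flip: exp_of_nat_mult of_real_power)
      have "cmod (cf (f n) ?u ^ N n - of_real (exp (- ?u\<^sup>2 / 2)) ^ N n) \<le> N n * cmod (cf (f n) ?u - of_real (exp (- ?u\<^sup>2 / 2)))"
        by (rule norm_power_diff) (simp_all add: le1)
      also have "\<dots> \<le> N n * (?u\<^sup>2 / 2 * \<delta> n)"
        unfolding \<delta>_def by (intro mult_left_mono cf_minus_gaussian_le_square f) simp
      also have "\<dots> = \<tau>\<^sup>2 / 2 * \<delta> n" using elim unfolding u2 by simp
      finally show ?case using elim unfolding A_def e[symmetric] by simp
    qed
    show "(\<lambda>n. \<tau>\<^sup>2 / 2 * \<delta> n) \<longlonglongrightarrow> 0" using tendsto_mult[OF tendsto_const \<delta>0, of "\<tau>\<^sup>2 / 2"] by simp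
  qed
  have g24: "exp (- \<tau>\<^sup>2 / 2) \<le> exp (- \<tau>\<^sup>2 / 4)" for \<tau> :: real by simp
  \<comment> \<open>\<open>exp (- v) \<le> 1 - 2 / 3 * v\<close> on \<open>[0, 1 / 2]\<close> pays for the error \<open>v / 6\<close> and leaves \<open>1 - v / 2\<close>\<close>
  have near: "cmod (cf (f n) u) \<le> exp (- u\<^sup>2 / 4)" if "\<bar>u\<bar> \<le> 1" "\<delta> n < 1/6" for n u
  proof -
    define v where "v = u\<^sup>2 / 2"
    have "u\<^sup>2 \<le> 1" using that(1) by (simp add: abs_square_le_1)
    then have v: "0 \<le> v" "v \<le> 1/2" by (auto simp: v_def)
    have "cmod (cf (f n) u) \<le> cmod (of_real (exp (- u\<^sup>2 / 2))) + cmod (cf (f n) u - of_real (exp (- u\<^sup>2 / 2)))"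
      using norm_triangle_ineq[of "of_real (exp (- u\<^sup>2 / 2))" "cf (f n) u - of_real (exp (- u\<^sup>2 / 2))"] by simp
    also have "\<dots> \<le> exp (- v) + v * \<delta> n"
      using cf_minus_gaussian_le_square[OF f, of n u] by (simp add: \<delta>_def v_def)
    also have "exp (- v) \<le> 1 - 2/3 * v"
    proof -
      have "exp (- v) * (1 + v) \<le> 1"
        using exp_ge_add_one_self[of v] v by (simp add: exp_minus field_simps)
      moreover have "1 \<le> (1 - 2/3 * v) * (1 + v)" using v mult_left_mono[OF v(2) v(1)] by (simp add: algebra_simps)
      ultimately have "exp (- v) * (1 + v) \<le> (1 - 2/3 * v) * (1 + v)" by linarith
      then show ?thesis using v by simp
    qed
    also have "1 - 2/3 * v + v * \<delta> n \<le> 1 - v / 2" using mult_left_mono[of "\<delta> n" "1/6" v] that v by simp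
    also have "\<dots> \<le> exp (- (v / 2))" using exp_ge_add_one_self[of "- (v/2)"] by simp
    finally show ?thesis by (simp add: v_def)
  qed
  \<comment> \<open>\<open>exp (- (1 / 2)) \<le> 2 / 3\<close>, and the error is at most \<open>1 / 6\<close>\<close>
  have far: "cmod (cf (f n) u) \<le> 5 / 6" if "\<bar>u\<bar> \<ge> 1" "\<delta> n < 1/6" for n u
  proof -
    have "cmod (cf (f n) u) \<le> cmod (of_real (exp (- u\<^sup>2 / 2))) + cmod (cf (f n) u - of_real (exp (- u\<^sup>2 / 2)))"
      using norm_triangle_ineq[of "of_real (exp (- u\<^sup>2 / 2))" "cf (f n) u - of_real (exp (- u\<^sup>2 / 2))"] by simp
    also have "\<dots> \<le> exp (- u\<^sup>2 / 2) + \<delta> n"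
      using cf_minus_gaussian_le[OF f, of n u] by (simp add: \<delta>_def)
    also have "exp (- u\<^sup>2 / 2) \<le> exp (- (1 / 2))"
      using one_le_power[OF that(1), of 2] by simp
    also have "exp (- (1 / 2)) \<le> (2 / 3 :: real)"
      using exp_ge_add_one_self[of "1/2 :: real"] by (simp add: exp_minus field_simps)
    finally show ?thesis using that by simp
  qed
  have Abound: "eventually (\<lambda>n. \<forall>\<tau>. norm (A n \<tau>) \<le> 2 * exp (- \<tau>\<^sup>2 / 4)) sequentially"
    using N3 \<delta>s
  proof eventually_elim
    case (elim n)
    show ?case
    proof
      fix \<tau> :: real
      show "norm (A n \<tau>) \<le> 2 * exp (- \<tau>\<^sup>2 / 4)"
      proof (cases "\<bar>\<tau>\<bar> \<le> sqrt (N n)")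
        case True
        let ?u = "\<tau> / sqrt (N n)"
        have "cmod (cf (f n) ?u) \<le> exp (- ?u\<^sup>2 / 4)" using True elim by (intro near) auto
        then have "cmod (cf (f n) ?u) ^ N n \<le> exp (- ?u\<^sup>2 / 4) ^ N n" by (intro power_mono) auto
        also have "\<dots> = exp (- \<tau>\<^sup>2 / 4)" using elim by (simp add: power_divide flip: exp_of_nat_mult)
        finally have "cmod (cf (f n) ?u ^ N n) \<le> exp (- \<tau>\<^sup>2 / 4)" by (simp add: norm_power)
        moreover have "cmod (of_real (exp (- \<tau>\<^sup>2 / 2))) \<le> exp (- \<tau>\<^sup>2 / 4)" by simp
        moreover note norm_triangle_ineq4[of "cf (f n) ?u ^ N n" "of_real (exp (- \<tau>\<^sup>2 / 2))"]
        ultimately have "cmod (cf (f n) ?u ^ N n - of_real (exp (- \<tau>\<^sup>2 / 2))) \<le> 2 * exp (- \<tau>\<^sup>2 / 4)"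
          by linarith
        then show ?thesis using True unfolding A_def by (simp only: if_True real_norm_def abs_norm_cancel)
      next
        case False
        then show ?thesis using g24[of \<tau>] exp_ge_zero[of "- \<tau>\<^sup>2 / 4"] unfolding A_def by (simp del: exp_ge_zero exp_le_cancel_iff)
      qed
    qed
  qed
  have ig: "integrable lborel (\<lambda>\<tau>::real. 2 * exp (- \<tau>\<^sup>2 / 4))" using integrable_gaussian_half by simp
  have IA: "(\<lambda>n. \<integral>\<tau>. A n \<tau> \<partial>lborel) \<longlonglongrightarrow> 0"
    using integral_tendsto_eventually_dominated[where f = "\<lambda>_. 0" and s = A, OF _ _ ig Alim Abound] by simp
  have C0: "C \<ge> 0"
  proof -
    obtain n where "\<forall>x. f n x \<le> C" using eventually_happens[OF C] by auto
    then show ?thesis using prob_densityD(2)[OF pd, of n 0] by (metis order_trans)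
  qed
  define E where "E n = (6 / 5)\<^sup>2 * (2 * pi * C) * (real (N n) * (5 / 6) ^ N n)" for n
  have E0: "E \<longlonglongrightarrow> 0"
  proof -
    have "(\<lambda>n. real (N n) * (5 / 6) ^ N n) \<longlonglongrightarrow> 0"
      using filterlim_compose[OF powser_times_n_limit_0[of "5/6 :: real"] N] by simp
    from tendsto_mult[OF tendsto_const this] show ?thesis unfolding E_def by simp
  qed
  have "eventually (\<lambda>n. norm (sqrt (N n) * sum_density (f n) (N n) (sqrt (N n) * x n) - std_normal_density (x n))
      \<le> (LBINT \<tau>. A n \<tau>) + E n) sequentially"
    using N3 \<delta>s C Abound
  proof eventually_elim
    case (elim n)
    let ?r = "sqrt (N n)"
    have r: "?r > 0" using elim by simp
    have iA: "integrable lborel (A n)"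
      by (rule Bochner_Integration.integrable_bound[OF ig]) (use elim in auto)
    have isq: "integrable lborel (\<lambda>\<tau>. (cmod (cf (f n) (\<tau> / ?r)))\<^sup>2)"
      using lborel_integrable_real_affine[OF integrable_cf_square[OF pd B, of n], of "1 / ?r" 0] r by simp
    have le: "cmod (cf (f n) (\<tau> / ?r) ^ N n - of_real (exp (- \<tau>\<^sup>2 / 2)))
        \<le> A n \<tau> + (5 / 6) ^ (N n - 2) * (cmod (cf (f n) (\<tau> / ?r)))\<^sup>2" for \<tau>
    proof (cases "\<bar>\<tau>\<bar> \<le> ?r")
      case True then show ?thesis by (simp add: A_def)
    next
      case False
      have "cmod (cf (f n) (\<tau> / ?r)) \<le> 5 / 6" using False elim r by (intro far) auto
      then have "cmod (cf (f n) (\<tau> / ?r)) ^ (N n - 2) \<le> (5 / 6) ^ (N n - 2)" by (intro power_mono) auto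
      then have "cmod (cf (f n) (\<tau> / ?r)) ^ (N n - 2) * (cmod (cf (f n) (\<tau> / ?r)))\<^sup>2 \<le> (5 / 6) ^ (N n - 2) * (cmod (cf (f n) (\<tau> / ?r)))\<^sup>2"
        by (rule mult_right_mono) simp
      moreover have "cmod (cf (f n) (\<tau> / ?r)) ^ (N n - 2) * (cmod (cf (f n) (\<tau> / ?r)))\<^sup>2 = cmod (cf (f n) (\<tau> / ?r) ^ N n)"
      proof -
        have "N n = (N n - 2) + 2" using elim by simp
        then have "cmod (cf (f n) (\<tau> / ?r)) ^ N n = cmod (cf (f n) (\<tau> / ?r)) ^ (N n - 2 + 2)" by (rule arg_cong)
        then show ?thesis by (simp only: norm_power power_add)
      qed
      ultimately show ?thesis
        using False norm_triangle_ineq4[of "cf (f n) (\<tau> / ?r) ^ N n" "of_real (exp (- \<tau>\<^sup>2 / 2))"]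
        by (simp add: A_def)
    qed
    have sq: "(LBINT \<tau>. (cmod (cf (f n) (\<tau> / ?r)))\<^sup>2) \<le> ?r * (2 * pi * C)"
    proof -
      have "(LBINT \<tau>. (cmod (cf (f n) (\<tau> / ?r)))\<^sup>2) = ?r * (LBINT \<tau>. (cmod (cf (f n) \<tau>))\<^sup>2)"
        using r by (subst (2) lborel_integral_real_affine[where c = "1 / ?r" and t = 0]) simp_all
      also have "\<dots> \<le> ?r * (2 * pi * C)"
        using elim r by (intro mult_left_mono integral_cf_square_le pd) auto
      finally show ?thesis .
    qed
    have "norm (?r * sum_density (f n) (N n) (?r * x n) - std_normal_density (x n))
        \<le> (LBINT \<tau>. cmod (cf (f n) (\<tau> / ?r) ^ N n - of_real (exp (- \<tau>\<^sup>2 / 2))))"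
      using sum_density_minus_gaussian_le[OF pd B, of "N n" n "x n"] elim by simp
    also have "\<dots> \<le> (LBINT \<tau>. A n \<tau> + (5 / 6) ^ (N n - 2) * (cmod (cf (f n) (\<tau> / ?r)))\<^sup>2)"
      
    proof (rule integral_mono')
      show "integrable lborel (\<lambda>\<tau>. A n \<tau> + (5 / 6) ^ (N n - 2) * (cmod (cf (f n) (\<tau> / ?r)))\<^sup>2)"
        using iA isq by (intro Bochner_Integration.integrable_add integrable_mult_right)
      fix \<tau>
      show "cmod (cf (f n) (\<tau> / ?r) ^ N n - of_real (exp (- \<tau>\<^sup>2 / 2))) \<le> A n \<tau> + (5 / 6) ^ (N n - 2) * (cmod (cf (f n) (\<tau> / ?r)))\<^sup>2"
        by (rule le)
      then show "0 \<le> A n \<tau> + (5 / 6) ^ (N n - 2) * (cmod (cf (f n) (\<tau> / ?r)))\<^sup>2"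
        by (rule order_trans[OF norm_ge_zero])
    qed
    also have "\<dots> = (LBINT \<tau>. A n \<tau>) + (5 / 6) ^ (N n - 2) * (LBINT \<tau>. (cmod (cf (f n) (\<tau> / ?r)))\<^sup>2)"
      using iA isq by simp
    also have "(5 / 6) ^ (N n - 2) * (LBINT \<tau>. (cmod (cf (f n) (\<tau> / ?r)))\<^sup>2) \<le> (5 / 6) ^ (N n - 2) * (?r * (2 * pi * C))"
      by (intro mult_left_mono sq) simp
    also have "\<dots> \<le> (5 / 6) ^ (N n - 2) * (real (N n) * (2 * pi * C))"
    proof -
      have "?r \<le> real (N n)" using elim by (intro real_le_lsqrt) (auto simp: power2_eq_square)
      then show ?thesis using C0 by (intro mult_left_mono mult_right_mono) auto
    qed
    also have "\<dots> = E n"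
      using elim by (simp add: E_def power_diff field_simps power2_eq_square)
    finally show ?case by simp
  qed
  moreover have "(\<lambda>n. (LBINT \<tau>. A n \<tau>) + E n) \<longlonglongrightarrow> 0" using tendsto_add[OF IA E0] by simp
  ultimately show ?thesis by (rule Lim_null_comparison)
qed

section \<open>Exponential tilting and the conditional density\<close>

text \<open>The centre \<open>c\<close> is left free because cumulants can be computed from the moments about any point; the
  saddle point will be the convenient one, and \<open>0\<close> is the one for differentiation in \<open>t\<close>.\<close>
definition tilted_moment :: "(real \<Rightarrow> real) \<Rightarrow> real \<Rightarrow> nat \<Rightarrow> real \<Rightarrow> real" where
  "tilted_moment p c k t = (LBINT x. (x - c) ^ k * exp (t * x) * p x)"

locale tiltable =
  fixes p :: "real \<Rightarrow> real"
  assumes p_meas [measurable]: "p \<in> borel_measurable borel"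
    and p_nonneg: "0 \<le> p x" and p_neg: "x < 0 \<Longrightarrow> p x = 0"
    and p_integral: "(LBINT x. p x) = 1"
    and p_bound: "\<exists>B. \<forall>x. exp (t * x) * p x \<le> B"
begin

text \<open>The bound for the parameter \<open>t + 1\<close> leaves a factor \<open>exp (- x)\<close>, which is integrable on the half-line.\<close>
lemma tilted_integrable: "integrable lborel (\<lambda>x. exp (t * x) * p x)"
proof -
  obtain B where B: "\<And>x. exp ((t + 1) * x) * p x \<le> B" using p_bound by blast
  show ?thesis
  proof (rule Bochner_Integration.integrable_bound)
    show "integrable lborel (\<lambda>x. B * (exp (- x) * indicator {0..} x))"
    proof (intro integrable_mult_right integrableI_nonneg)
      have "(\<integral>\<^sup>+x. ennreal (exp (- x) * indicator {0..} x) \<partial>lborel) = (\<integral>\<^sup>+x. ennreal (x ^ 0 * exp (- x)) * indicator {0..} x \<partial>lborel)"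
        by (intro nn_integral_cong) (auto simp: indicator_def)
      then show "(\<integral>\<^sup>+x. ennreal (exp (- x) * indicator {0..} x) \<partial>lborel) < \<infinity>"
        unfolding nn_intergal_power_times_exp_Ici by simp
    qed auto
    show "AE x in lborel. norm (exp (t * x) * p x) \<le> norm (B * (exp (- x) * indicator {0..} x))"
    proof (intro AE_I2)
      fix x :: real
      show "norm (exp (t * x) * p x) \<le> norm (B * (exp (- x) * indicator {0..} x))"
      proof (cases "x < 0")
        case False
        have "exp (t * x) * p x = exp (- x) * (exp ((t + 1) * x) * p x)"
          by (simp add: algebra_simps flip: exp_add)
        also have "\<dots> \<le> exp (- x) * B" by (intro mult_left_mono B) simp
        also have "\<dots> \<le> exp (- x) * \<bar>B\<bar>" by (intro mult_left_mono) auto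
        finally show ?thesis
          using False p_nonneg[of x] by (simp add: abs_mult mult.commute)
      qed (simp add: p_neg)
    qed
  qed simp
qed

lemma tilted_moment_integrable: "integrable lborel (\<lambda>x. (x - c) ^ k * exp (t * x) * p x)"
proof (rule Bochner_Integration.integrable_bound)
  let ?w = "\<lambda>x. exp (real k * \<bar>c\<bar>) * (exp ((t + real k) * x) * p x)"
  show "integrable lborel ?w" by (intro integrable_mult_right tilted_integrable)
  show "AE x in lborel. norm ((x - c) ^ k * exp (t * x) * p x) \<le> norm (?w x)"
  proof (intro AE_I2)
    fix x :: real
    show "norm ((x - c) ^ k * exp (t * x) * p x) \<le> norm (?w x)"
    proof (cases "x < 0")
      case False
      have "\<bar>x - c\<bar> \<le> exp (\<bar>c\<bar> + x)" using exp_ge_add_one_self[of "\<bar>c\<bar> + x"] False by linarith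
      then have "\<bar>x - c\<bar> ^ k \<le> exp (\<bar>c\<bar> + x) ^ k" by (rule power_mono) simp
      also have "\<dots> = exp (real k * (\<bar>c\<bar> + x))" by (rule exp_of_nat_mult[symmetric])
      finally have "\<bar>x - c\<bar> ^ k * (exp (t * x) * p x) \<le> exp (real k * (\<bar>c\<bar> + x)) * (exp (t * x) * p x)"
        by (rule mult_right_mono) (simp add: p_nonneg)
      also have "\<dots> = ?w x" by (simp add: algebra_simps flip: exp_add)
      finally show ?thesis using p_nonneg[of x] by (simp add: abs_mult power_abs mult.assoc)
    qed (simp add: p_neg)
  qed
qed simp

abbreviation "\<Phi> t \<equiv> (LBINT x. exp (t * x) * p x)"

lemma tilted_moment_0: "tilted_moment p c 0 t = \<Phi> t"
  by (simp add: tilted_moment_def)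

lemma p_pos_set: "\<not> (AE x in lborel. p x = 0)"
proof
  assume "AE x in lborel. p x = 0"
  then have "(LBINT x. p x) = 0" by (subst integral_cong_AE[where g = "\<lambda>_. 0"]) auto
  then show False using p_integral by simp
qed

lemma tilted_nonneg_integral_pos:
  assumes [measurable]: "u \<in> borel_measurable borel" and u: "\<And>x. 0 \<le> u x" "\<And>x. x \<noteq> c \<Longrightarrow> u x \<noteq> 0"
    and int: "integrable lborel (\<lambda>x. u x * exp (t * x) * p x)"
  shows "0 < (LBINT x. u x * exp (t * x) * p x)"
proof -
  have nn: "0 \<le> u x * exp (t * x) * p x" for x using u p_nonneg by simp
  have "(LBINT x. u x * exp (t * x) * p x) \<noteq> 0"
  proof
    assume "(LBINT x. u x * exp (t * x) * p x) = 0"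
    then have "AE x in lborel. u x * exp (t * x) * p x = 0"
      using integral_nonneg_eq_0_iff_AE[OF int] nn by auto
    moreover have "AE x in lborel. x \<noteq> c" by (rule AE_lborel_singleton)
    ultimately have "AE x in lborel. p x = 0" by eventually_elim (use u(2) in auto)
    then show False using p_pos_set by simp
  qed
  moreover have "0 \<le> (LBINT x. u x * exp (t * x) * p x)" using nn by (intro integral_nonneg_AE) auto
  ultimately show ?thesis by linarith
qed

lemma \<Phi>_pos: "0 < \<Phi> t"
  using tilted_nonneg_integral_pos[of "\<lambda>_. 1" 0 t] tilted_integrable by simp

lemma abs_exp_minus_one_le: "\<bar>exp u - 1\<bar> \<le> \<bar>u\<bar> * exp \<bar>u\<bar>" for u :: real
proof (cases "u \<ge> 0")
  case True
  have "(1 - u) * exp u \<le> exp (- u) * exp u"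
    using exp_ge_add_one_self[of "- u"] by (intro mult_right_mono) auto
  then show ?thesis using True by (simp add: algebra_simps flip: exp_add)
next
  case False
  have "1 - exp u \<le> \<bar>u\<bar>" using exp_ge_add_one_self[of u] False by linarith
  also have "\<dots> \<le> \<bar>u\<bar> * exp \<bar>u\<bar>" by (simp add: mult_le_cancel_left1)
  finally show ?thesis using False by simp
qed

text \<open>Differentiation under the integral sign.  Since \<open>p\<close> lives on the half-line, the difference quotient of
  step \<open>h\<close> is dominated by the next moment at \<open>t + 1\<close> as soon as \<open>\<bar>h\<bar> < 1\<close>.\<close>
lemma tilted_moment_has_derivative:
  "(tilted_moment p 0 k has_real_derivative tilted_moment p 0 (Suc k) t) (at t)"
  unfolding DERIV_def tendsto_at_iff_sequentially comp_def
proof (intro allI impI)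
  fix S :: "nat \<Rightarrow> real" assume S: "\<forall>i. S i \<in> UNIV - {0}" "S \<longlonglongrightarrow> 0"
  let ?d = "\<lambda>i x. x ^ k * exp (t * x) * p x * ((exp (S i * x) - 1) / S i)"
  have eq: "(tilted_moment p 0 k (t + S i) - tilted_moment p 0 k t) / S i = (LBINT x. ?d i x)" for i
  proof -
    have "tilted_moment p 0 k (t + S i) - tilted_moment p 0 k t
        = (LBINT x. x ^ k * exp ((t + S i) * x) * p x - x ^ k * exp (t * x) * p x)"
      using tilted_moment_integrable[of 0 k] by (simp add: tilted_moment_def)
    then have "(tilted_moment p 0 k (t + S i) - tilted_moment p 0 k t) / S i
        = (LBINT x. (x ^ k * exp ((t + S i) * x) * p x - x ^ k * exp (t * x) * p x) / S i)"
      by simp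
    also have "\<dots> = (LBINT x. ?d i x)"
      by (intro Bochner_Integration.integral_cong refl)
         (simp add: distrib_right exp_add diff_divide_distrib right_diff_distrib left_diff_distrib)
    finally show ?thesis .
  qed
  show "(\<lambda>i. (tilted_moment p 0 k (t + S i) - tilted_moment p 0 k t) / S i) \<longlonglongrightarrow> tilted_moment p 0 (Suc k) t"
    unfolding eq unfolding tilted_moment_def
  proof (rule integral_tendsto_eventually_dominated)
    show "integrable lborel (\<lambda>x. (x - 0) ^ Suc k * exp ((t + 1) * x) * p x)"
      by (rule tilted_moment_integrable)
    fix x :: real
    have "((\<lambda>h. (exp (h * x) - 1) / h) \<longlongrightarrow> x) (at 0)"
    proof -
      have "((\<lambda>h. exp (h * x)) has_real_derivative exp (0 * x) * x) (at 0)"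
        by (auto intro!: derivative_eq_intros)
      then show ?thesis by (simp add: DERIV_def)
    qed
    then have "(\<lambda>i. (exp (S i * x) - 1) / S i) \<longlonglongrightarrow> x"
      using S unfolding tendsto_at_iff_sequentially comp_def by blast
    then have "(\<lambda>i. ?d i x) \<longlonglongrightarrow> x ^ k * exp (t * x) * p x * x" by (intro tendsto_intros)
    then show "(\<lambda>i. ?d i x) \<longlonglongrightarrow> (x - 0) ^ Suc k * exp (t * x) * p x" by (simp add: mult_ac)
  next
    have "eventually (\<lambda>i. \<bar>S i\<bar> < 1) sequentially"
      using tendsto_rabs[OF S(2)] by (intro order_tendstoD(2)) auto
    then show "eventually (\<lambda>i. \<forall>x. norm (?d i x) \<le> (x - 0) ^ Suc k * exp ((t + 1) * x) * p x) sequentially"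
    proof eventually_elim
      case (elim i)
      show ?case
      proof
        fix x
        show "norm (?d i x) \<le> (x - 0) ^ Suc k * exp ((t + 1) * x) * p x"
        proof (cases "x < 0")
          case False
          have "\<bar>exp (S i * x) - 1\<bar> \<le> \<bar>S i * x\<bar> * exp \<bar>S i * x\<bar>" by (rule abs_exp_minus_one_le)
          also have "\<dots> \<le> \<bar>S i * x\<bar> * exp x"
            using False elim mult_right_mono[of "\<bar>S i\<bar>" 1 x] by (intro mult_left_mono) (auto simp: abs_mult)
          finally have "\<bar>(exp (S i * x) - 1) / S i\<bar> \<le> x * exp x"
            using S(1) False by (simp add: abs_mult field_simps)
          then have "(x ^ k * exp (t * x) * p x) * \<bar>(exp (S i * x) - 1) / S i\<bar> \<le> (x ^ k * exp (t * x) * p x) * (x * exp x)"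
            using False by (intro mult_left_mono) (auto simp: p_nonneg)
          also have "\<dots> = (x - 0) ^ Suc k * exp ((t + 1) * x) * p x"
          proof -
            have "exp ((t + 1) * x) = exp (t * x) * exp x" by (simp add: distrib_right exp_add)
            then show ?thesis by (simp only:) simp
          qed
          finally show ?thesis using False p_nonneg[of x] by (simp add: abs_mult)
        qed (simp add: p_neg)
      qed
    qed
  qed simp_all
qed

definition "tmean t = tilted_moment p 0 1 t / \<Phi> t"
definition "tvar t = tilted_moment p (tmean t) 2 t / \<Phi> t"
definition "tsd t = sqrt (tvar t)"
definition "tcum3 t = tilted_moment p (tmean t) 3 t / \<Phi> t"

lemma tilted_moment_recentre:
  "tilted_moment p c 1 t = tilted_moment p 0 1 t - c * \<Phi> t"
  "tilted_moment p c 2 t = tilted_moment p 0 2 t - 2 * c * tilted_moment p 0 1 t + c\<^sup>2 * \<Phi> t"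
  "tilted_moment p c 3 t = tilted_moment p 0 3 t - 3 * c * tilted_moment p 0 2 t
     + 3 * c\<^sup>2 * tilted_moment p 0 1 t - c ^ 3 * \<Phi> t"
proof -
  let ?J = "\<lambda>k x. (x - 0) ^ k * exp (t * x) * p x"
  note i = tilted_moment_integrable[of 0 _ t]
  have J0: "tilted_moment p 0 0 t = \<Phi> t" by (rule tilted_moment_0)
  have "tilted_moment p c 1 t = (LBINT x. ?J 1 x - c * ?J 0 x)"
    unfolding tilted_moment_def by (intro Bochner_Integration.integral_cong refl) (simp add: algebra_simps)
  also have "\<dots> = tilted_moment p 0 1 t - c * tilted_moment p 0 0 t"
    unfolding tilted_moment_def using i by (simp only: Bochner_Integration.integral_diff integrable_mult_right integral_mult_right_zero)
  finally show "tilted_moment p c 1 t = tilted_moment p 0 1 t - c * \<Phi> t" unfolding J0 .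
  have "tilted_moment p c 2 t = (LBINT x. ?J 2 x - 2 * c * ?J 1 x + c\<^sup>2 * ?J 0 x)"
    unfolding tilted_moment_def by (intro Bochner_Integration.integral_cong refl) (simp add: algebra_simps power2_eq_square)
  also have "\<dots> = tilted_moment p 0 2 t - 2 * c * tilted_moment p 0 1 t + c\<^sup>2 * tilted_moment p 0 0 t"
    unfolding tilted_moment_def using i by (simp only: Bochner_Integration.integral_diff Bochner_Integration.integral_add
      Bochner_Integration.integrable_diff integrable_mult_right integral_mult_right_zero)
  finally show "tilted_moment p c 2 t = tilted_moment p 0 2 t - 2 * c * tilted_moment p 0 1 t + c\<^sup>2 * \<Phi> t" unfolding J0 .
  have "tilted_moment p c 3 t = (LBINT x. ?J 3 x - 3 * c * ?J 2 x + 3 * c\<^sup>2 * ?J 1 x - c ^ 3 * ?J 0 x)"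
    unfolding tilted_moment_def by (intro Bochner_Integration.integral_cong refl) (simp add: algebra_simps power2_eq_square power3_eq_cube)
  also have "\<dots> = tilted_moment p 0 3 t - 3 * c * tilted_moment p 0 2 t + 3 * c\<^sup>2 * tilted_moment p 0 1 t - c ^ 3 * tilted_moment p 0 0 t"
    unfolding tilted_moment_def using i by (simp only: Bochner_Integration.integral_diff Bochner_Integration.integral_add
      Bochner_Integration.integrable_diff Bochner_Integration.integrable_add integrable_mult_right integral_mult_right_zero)
  finally show "tilted_moment p c 3 t = tilted_moment p 0 3 t - 3 * c * tilted_moment p 0 2 t
     + 3 * c\<^sup>2 * tilted_moment p 0 1 t - c ^ 3 * \<Phi> t" unfolding J0 .
qed

text \<open>Cumulants of order two and three are invariant under translation, so they are given by the same
  polynomials in the moments about any centre.\<close>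
lemma cumulants_recentre:
  fixes c t
  defines "b \<equiv> \<lambda>k. tilted_moment p c k t / \<Phi> t"
  shows "tmean t = c + b 1" "tvar t = b 2 - (b 1)\<^sup>2" "tcum3 t = b 3 - 3 * b 1 * b 2 + 2 * (b 1) ^ 3"
proof -
  define i1 where "i1 = tilted_moment p 0 1 t / \<Phi> t"
  define i2 where "i2 = tilted_moment p 0 2 t / \<Phi> t"
  define i3 where "i3 = tilted_moment p 0 3 t / \<Phi> t"
  have ne: "\<Phi> t \<noteq> 0" using \<Phi>_pos[of t] by simp
  have r: "tilted_moment p c 1 t / \<Phi> t = i1 - c"
    "tilted_moment p c 2 t / \<Phi> t = i2 - 2 * c * i1 + c\<^sup>2"
    "tilted_moment p c 3 t / \<Phi> t = i3 - 3 * c * i2 + 3 * c\<^sup>2 * i1 - c ^ 3" for c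
    unfolding tilted_moment_recentre[of c t] i1_def i2_def i3_def using ne
    by (simp_all add: add_divide_distrib diff_divide_distrib)
  have m: "tmean t = i1" by (simp add: tmean_def i1_def)
  show "tmean t = c + b 1" unfolding b_def r m by simp
  show "tvar t = b 2 - (b 1)\<^sup>2" unfolding tvar_def b_def r m by (simp add: algebra_simps power2_eq_square)
  show "tcum3 t = b 3 - 3 * b 1 * b 2 + 2 * (b 1) ^ 3"
    unfolding tcum3_def b_def r m by (simp add: algebra_simps power2_eq_square power3_eq_cube)
qed

lemma tvar_pos: "0 < tvar t"
  unfolding tvar_def tilted_moment_def
  using tilted_nonneg_integral_pos[of "\<lambda>x. (x - tmean t)\<^sup>2" "tmean t" t] tilted_moment_integrable[of "tmean t" 2 t] \<Phi>_pos[of t]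
  by simp

lemma tsd_pos: "0 < tsd t" and tsd_square: "(tsd t)\<^sup>2 = tvar t"
  using tvar_pos[of t] by (simp_all add: tsd_def)

lemma log_mgf_has_derivative: "((\<lambda>t. ln (\<Phi> t)) has_real_derivative tmean t) (at t)"
proof -
  have "(\<Phi> has_real_derivative tilted_moment p 0 1 t) (at t)"
    using tilted_moment_has_derivative[of 0 t] by (simp add: tilted_moment_0[abs_def])
  then show ?thesis unfolding tmean_def using \<Phi>_pos[of t]
    by (auto intro!: derivative_eq_intros)
qed

lemma tmean_has_derivative: "(tmean has_real_derivative tvar t) (at t)"
proof -
  have 0: "(\<Phi> has_real_derivative tilted_moment p 0 1 t) (at t)"
    using tilted_moment_has_derivative[of 0 t] by (simp add: tilted_moment_0[abs_def])
  have 1: "(tilted_moment p 0 1 has_real_derivative tilted_moment p 0 2 t) (at t)"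
    using tilted_moment_has_derivative[of 1 t] by (simp add: numeral_2_eq_2)
  have "tvar t = (tilted_moment p 0 2 t * \<Phi> t - tilted_moment p 0 1 t * tilted_moment p 0 1 t) / (\<Phi> t * \<Phi> t)"
    using cumulants_recentre(2)[of t 0] \<Phi>_pos[of t] by (simp add: diff_divide_distrib power2_eq_square)
  then show ?thesis
    using DERIV_divide[OF 1 0] \<Phi>_pos[of t] by (simp add: tmean_def[abs_def] mult.commute)
qed

lemma tvar_has_derivative: "(tvar has_real_derivative tcum3 t) (at t)"
proof -
  have 0: "(\<Phi> has_real_derivative tilted_moment p 0 1 t) (at t)"
    using tilted_moment_has_derivative[of 0 t] by (simp add: tilted_moment_0[abs_def])
  have 2: "(tilted_moment p 0 2 has_real_derivative tilted_moment p 0 3 t) (at t)"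
    using tilted_moment_has_derivative[of 2 t] by (simp add: numeral_2_eq_2 numeral_3_eq_3)
  have v: "tvar = (\<lambda>t. tilted_moment p 0 2 t / \<Phi> t - (tmean t)\<^sup>2)"
    using cumulants_recentre(2)[of _ 0] by (auto simp: tmean_def)
  have "((\<lambda>t. tilted_moment p 0 2 t / \<Phi> t - (tmean t)\<^sup>2) has_real_derivative
      (tilted_moment p 0 3 t * \<Phi> t - tilted_moment p 0 2 t * tilted_moment p 0 1 t) / (\<Phi> t * \<Phi> t) - 2 * tmean t * tvar t) (at t)"
    using \<Phi>_pos[of t] by (auto intro!: derivative_eq_intros 0 2 tmean_has_derivative)
  moreover have "(tilted_moment p 0 3 t * \<Phi> t - tilted_moment p 0 2 t * tilted_moment p 0 1 t) / (\<Phi> t * \<Phi> t) - 2 * tmean t * tvar t = tcum3 t"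
  proof -
    define i2 where "i2 = tilted_moment p 0 2 t / \<Phi> t"
    define i3 where "i3 = tilted_moment p 0 3 t / \<Phi> t"
    have 1: "(tilted_moment p 0 3 t * \<Phi> t - tilted_moment p 0 2 t * tilted_moment p 0 1 t) / (\<Phi> t * \<Phi> t) = i3 - i2 * tmean t"
      using \<Phi>_pos[of t] by (simp add: tmean_def i2_def i3_def diff_divide_distrib)
    have 2: "tvar t = i2 - (tmean t)\<^sup>2"
      using cumulants_recentre(2)[of t 0] by (simp add: tmean_def i2_def)
    have 3: "tcum3 t = i3 - 3 * tmean t * i2 + 2 * tmean t ^ 3"
      using cumulants_recentre(3)[of t 0] by (simp add: tmean_def i2_def i3_def)
    show ?thesis unfolding 1 2 3 by (simp add: algebra_simps power2_eq_square power3_eq_cube)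
  qed
  ultimately show ?thesis unfolding v by simp
qed

lemma tmean_strict_mono: "strict_mono tmean"
  by (rule strict_monoI) (metis DERIV_pos_imp_increasing tmean_has_derivative tvar_pos)

text \<open>The density of \<open>(Y - tmean t) / tsd t\<close> when \<open>Y\<close> has density \<open>exp (t * y) * p y / \<Phi> t\<close>.\<close>
definition "std_tilt t z = tsd t * (exp (t * (tmean t + tsd t * z)) * p (tmean t + tsd t * z)) / \<Phi> t"

lemma std_tilt_integral:
  "(LBINT z. u z * std_tilt t z) = (LBINT x. u ((x - tmean t) / tsd t) * (exp (t * x) * p x)) / \<Phi> t"
  and std_tilt_integrable: "integrable lborel (\<lambda>x. u ((x - tmean t) / tsd t) * (exp (t * x) * p x))
    \<Longrightarrow> integrable lborel (\<lambda>z. u z * std_tilt t z)"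
proof -
  note s = tsd_pos[of t]
  let ?v = "\<lambda>x. u ((x - tmean t) / tsd t) * (exp (t * x) * p x)"
  have e: "u z * std_tilt t z = ?v (tmean t + tsd t * z) * (tsd t / \<Phi> t)" for z
    using s by (simp add: std_tilt_def)
  show "(LBINT z. u z * std_tilt t z) = (LBINT x. ?v x) / \<Phi> t"
    unfolding e using s by (subst (2) lborel_integral_real_affine[where c = "tsd t" and t = "tmean t"]) simp_all
  assume "integrable lborel ?v"
  from lborel_integrable_real_affine[OF this, of "tsd t" "tmean t"]
  show "integrable lborel (\<lambda>z. u z * std_tilt t z)"
    unfolding e using s by (intro integrable_mult_left) simp
qed

lemma std_tilt_standardized: "standardized_density (std_tilt t)"
proof -
  note s = tsd_pos[of t] and P = \<Phi>_pos[of t]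
  have [measurable]: "std_tilt t \<in> borel_measurable borel" unfolding std_tilt_def[abs_def] by measurable
  have nn: "0 \<le> std_tilt t z" for z using s P p_nonneg by (simp add: std_tilt_def)
  have "(LBINT z. std_tilt t z) = 1" "integrable lborel (std_tilt t)"
    using std_tilt_integral[of "\<lambda>_. 1" t] std_tilt_integrable[of "\<lambda>_. 1" t] tilted_integrable P by simp_all
  moreover have pw: "((x - tmean t) / tsd t) ^ k * (exp (t * x) * p x) = ((x - tmean t) ^ k * exp (t * x) * p x) / tsd t ^ k" for k x
    by (simp add: power_divide)
  have "integrable lborel (\<lambda>z. z\<^sup>2 * std_tilt t z)"
    using tilted_moment_integrable[of "tmean t" 2 t] by (intro std_tilt_integrable) (simp add: pw)
  moreover have "(LBINT z. z * std_tilt t z) = 0"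
  proof -
    have "(LBINT z. z ^ 1 * std_tilt t z) = tilted_moment p (tmean t) 1 t / tsd t ^ 1 / \<Phi> t"
      unfolding std_tilt_integral pw by (simp add: tilted_moment_def)
    also have "tilted_moment p (tmean t) 1 t = 0"
      using cumulants_recentre(1)[of t "tmean t"] P by simp
    finally show ?thesis by simp
  qed
  moreover have "(LBINT z. z\<^sup>2 * std_tilt t z) = 1"
  proof -
    have "(LBINT z. z\<^sup>2 * std_tilt t z) = tilted_moment p (tmean t) 2 t / (tsd t)\<^sup>2 / \<Phi> t"
      unfolding std_tilt_integral pw by (simp add: tilted_moment_def)
    also have "\<dots> = tvar t / (tsd t)\<^sup>2" by (simp add: tvar_def)
    finally show ?thesis using tvar_pos[of t] by (simp add: tsd_square)
  qed
  ultimately show ?thesis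
    unfolding standardized_density_def prob_density_def using nn by simp
qed

lemma std_tilt_bounded: "bounded (range (std_tilt t))"
proof -
  obtain B where B: "\<And>x. exp (t * x) * p x \<le> B" using p_bound by blast
  have "norm (std_tilt t z) \<le> tsd t * B / \<Phi> t" for z
  proof -
    have "0 \<le> std_tilt t z" using tsd_pos[of t] \<Phi>_pos[of t] p_nonneg by (simp add: std_tilt_def)
    moreover have "std_tilt t z \<le> tsd t * B / \<Phi> t"
      unfolding std_tilt_def using tsd_pos[of t] \<Phi>_pos[of t] by (intro divide_right_mono mult_left_mono B) auto
    ultimately show ?thesis by simp
  qed
  then show ?thesis by (auto simp: bounded_iff)
qed

text \<open>The tilting factors of the summands multiply to a function of their sum, so tilting passes through
  the convolution integral.\<close>
lemma sum_density_std_tilt: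
  "sum_density (std_tilt t) (Suc n) z = tsd t * exp (t * (real (Suc n) * tmean t + tsd t * z))
     * sum_density p (Suc n) (real (Suc n) * tmean t + tsd t * z) / \<Phi> t ^ Suc n"
proof (induction n arbitrary: z)
  case 0
  then show ?case by (simp add: std_tilt_def)
next
  case (Suc n)
  note s = tsd_pos[of t] and P = \<Phi>_pos[of t]
  let ?m = "tmean t" and ?s = "tsd t"
  let ?x = "real (Suc (Suc n)) * ?m + ?s * z"
  let ?c = "?s * ?s * exp (t * ?x) / \<Phi> t ^ Suc (Suc n)"
  have "sum_density (std_tilt t) (Suc (Suc n)) z = (LBINT y. std_tilt t y * sum_density (std_tilt t) (Suc n) (z - y))"
    by simp
  also have "\<dots> = (LBINT y. ?c * (p (?m + ?s * y) * sum_density p (Suc n) (?x - (?m + ?s * y))))"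
  proof (intro Bochner_Integration.integral_cong refl)
    fix y
    have x: "real (Suc n) * ?m + ?s * (z - y) = ?x - (?m + ?s * y)" by (simp add: algebra_simps)
    have "exp (t * (?m + ?s * y)) * exp (t * (?x - (?m + ?s * y))) = exp (t * ?x)"
      by (simp add: algebra_simps flip: exp_add)
    then show "std_tilt t y * sum_density (std_tilt t) (Suc n) (z - y) = ?c * (p (?m + ?s * y) * sum_density p (Suc n) (?x - (?m + ?s * y)))"
      unfolding Suc.IH x unfolding std_tilt_def using P by (simp add: field_simps del: sum_density.simps) 
  qed
  also have "\<dots> = ?c * (LBINT y. p (?m + ?s * y) * sum_density p (Suc n) (?x - (?m + ?s * y)))"
    by (rule integral_mult_right_zero)
  also have "(LBINT y. p (?m + ?s * y) * sum_density p (Suc n) (?x - (?m + ?s * y))) = sum_density p (Suc (Suc n)) ?x / ?s"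
    unfolding sum_density.simps
    by (subst (2) lborel_integral_real_affine[where c = ?s and t = ?m]) (use s in simp_all)
  finally show ?case using s by (simp del: sum_density.simps)
qed

text \<open>In the quotient of the densities of \<open>n - 1\<close> and \<open>n\<close> summands all tilting factors cancel but one.\<close>
lemma cond_density_via_std_tilt:
  assumes n: "n \<ge> 2"
  shows "cond_density_given_sum p n (real n * tmean t) y =
    exp (t * y) * p y / \<Phi> t * (sum_density (std_tilt t) (n - 1) ((tmean t - y) / tsd t) / sum_density (std_tilt t) n 0)"
proof -
  note s = tsd_pos[of t] and P = \<Phi>_pos[of t]
  obtain k where k: "n = Suc (Suc k)" using n by (metis One_nat_def Suc_1 Suc_le_D Suc_le_mono)
  have x: "real (Suc k) * tmean t + tsd t * ((tmean t - y) / tsd t) = real n * tmean t - y"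
  proof -
    have "tsd t * ((tmean t - y) / tsd t) = tmean t - y" using s by simp
    then show ?thesis by (simp only:) (simp add: k algebra_simps)
  qed
  have e: "exp (t * (real n * tmean t)) = exp (t * (real n * tmean t - y)) * exp (t * y)"
    by (simp add: algebra_simps flip: exp_add)
  have 1: "sum_density (std_tilt t) (n - 1) ((tmean t - y) / tsd t)
      = tsd t * exp (t * (real n * tmean t - y)) * sum_density p (n - 1) (real n * tmean t - y) / \<Phi> t ^ Suc k"
    using sum_density_std_tilt[of t k "(tmean t - y) / tsd t"] unfolding x by (simp add: k)
  have 2: "sum_density (std_tilt t) n 0 = tsd t * (exp (t * (real n * tmean t - y)) * exp (t * y)) * sum_density p n (real n * tmean t) / \<Phi> t ^ Suc (Suc k)"
    using sum_density_std_tilt[of t "Suc k" 0] unfolding e[symmetric] by (simp add: k del: sum_density.simps)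
  show ?thesis
    unfolding cond_density_given_sum_def 1 2 using s P by (simp add: field_simps)
qed

text \<open>The local limit theorem is used for the numerator at \<open>x n\<close> and for the denominator at \<open>0\<close>.  It
  controls absolute errors; boundedness of \<open>x\<close> keeps the normal density at \<open>x n\<close> away from \<open>0\<close> and so makes
  them relative errors.\<close>
lemma cond_density_asymp:
  fixes T :: "nat \<Rightarrow> real" and y :: real
  defines "x \<equiv> \<lambda>n. (tmean (T n) - y) / (tsd (T n) * sqrt (real (n - 1)))"
  assumes lim: "\<And>z. (\<lambda>n. std_tilt (T n) z) \<longlonglongrightarrow> std_normal_density z"
    and C: "eventually (\<lambda>n. \<forall>z. std_tilt (T n) z \<le> C) sequentially"
    and x: "Bseq x"
  shows "(\<lambda>n. cond_density_given_sum p n (real n * tmean (T n)) y)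
    \<sim>[sequentially] (\<lambda>n. exp (T n * y) * p y / \<Phi> (T n) * exp (- (x n)\<^sup>2 / 2))"
proof -
  let ?f = "\<lambda>n. std_tilt (T n)"
  obtain K where K: "\<And>n. \<bar>x n\<bar> \<le> K" using x unfolding Bseq_def by auto
  have LL: "(\<lambda>n. sqrt (N n) * sum_density (?f n) (N n) (sqrt (N n) * u n) - std_normal_density (u n)) \<longlonglongrightarrow> 0"
    if "filterlim N at_top sequentially" for N u
    using local_limit_uniform[of ?f, OF std_tilt_standardized lim std_tilt_bounded C that] .
  define A where "A n = sqrt (real (n - 1)) * sum_density (?f n) (n - 1) (sqrt (real (n - 1)) * x n)" for n
  define B where "B n = sqrt (real n) * sum_density (?f n) n 0" for n
  have n1: "filterlim (\<lambda>n::nat. n - 1) at_top sequentially" by (rule filterlim_minus_const_nat_at_top)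
  have A0: "(\<lambda>n. A n - std_normal_density (x n)) \<longlonglongrightarrow> 0" unfolding A_def by (rule LL[OF n1])
  have "(\<lambda>n. B n - std_normal_density 0) \<longlonglongrightarrow> 0" unfolding B_def using LL[OF filterlim_ident, of "\<lambda>_. 0"] by simp
  then have B0: "B \<longlonglongrightarrow> std_normal_density 0" by (rule LIM_zero_cancel)
  have E: "\<bar>exp ((x n)\<^sup>2 / 2)\<bar> \<le> exp (K\<^sup>2 / 2)" for n
    using power_mono[OF K[of n] abs_ge_zero, of 2] by simp
  have "(\<lambda>n. (A n - std_normal_density (x n)) * exp ((x n)\<^sup>2 / 2)) \<longlonglongrightarrow> 0"
  proof (rule Lim_null_comparison)
    have "\<bar>A n - std_normal_density (x n)\<bar> * \<bar>exp ((x n)\<^sup>2 / 2)\<bar> \<le> \<bar>A n - std_normal_density (x n)\<bar> * exp (K\<^sup>2 / 2)" for n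
      by (rule mult_left_mono[OF E]) simp
    then show "eventually (\<lambda>n. norm ((A n - std_normal_density (x n)) * exp ((x n)\<^sup>2 / 2)) \<le> \<bar>A n - std_normal_density (x n)\<bar> * exp (K\<^sup>2 / 2)) sequentially"
      by (simp add: abs_mult)
    show "(\<lambda>n. \<bar>A n - std_normal_density (x n)\<bar> * exp (K\<^sup>2 / 2)) \<longlonglongrightarrow> 0"
      using tendsto_mult[OF tendsto_rabs[OF A0] tendsto_const] by simp
  qed
  then have "(\<lambda>n. A n * exp ((x n)\<^sup>2 / 2) - std_normal_density 0) \<longlonglongrightarrow> 0"
    by (simp add: left_diff_distrib std_normal_density_def flip: exp_add)
  then have A1: "(\<lambda>n. A n * exp ((x n)\<^sup>2 / 2)) \<longlonglongrightarrow> std_normal_density 0" by (rule LIM_zero_cancel)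
  have S: "(\<lambda>n. sqrt (real n) / sqrt (real (n - 1))) \<longlonglongrightarrow> 1"
  proof -
    have "(\<lambda>n. real (Suc n) / real n) \<longlonglongrightarrow> 1" by (rule LIMSEQ_Suc_n_over_n)
    from tendsto_real_sqrt[OF this] have "(\<lambda>n. sqrt (real (Suc n)) / sqrt (real n)) \<longlonglongrightarrow> 1"
      by (simp add: real_sqrt_divide)
    then show ?thesis by (subst filterlim_sequentially_Suc[symmetric]) simp
  qed
  have nz: "std_normal_density 0 \<noteq> 0" by (simp add: std_normal_density_def)
  define R where "R n = A n * exp ((x n)\<^sup>2 / 2) / B n * (sqrt (real n) / sqrt (real (n - 1)))" for n
  have R1: "R \<longlonglongrightarrow> 1"
    using tendsto_mult[OF tendsto_divide[OF A1 B0 nz] S] nz by (simp add: R_def[abs_def])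
  have "eventually (\<lambda>n. cond_density_given_sum p n (real n * tmean (T n)) y
      = exp (T n * y) * p y / \<Phi> (T n) * exp (- (x n)\<^sup>2 / 2) * R n) sequentially"
    using eventually_ge_at_top[of 2]
  proof eventually_elim
    case (elim n)
    have sx: "sqrt (real (n - 1)) * x n = (tmean (T n) - y) / tsd (T n)"
      using elim by (simp add: x_def)
    have e: "exp (- (x n)\<^sup>2 / 2) * exp ((x n)\<^sup>2 / 2) = 1" by (simp flip: exp_add)
    have "exp (- (x n)\<^sup>2 / 2) * R n = A n / B n * (sqrt (real n) / sqrt (real (n - 1)))"
      unfolding R_def using e by (simp add: mult_ac)
    also have "\<dots> = sum_density (?f n) (n - 1) ((tmean (T n) - y) / tsd (T n)) / sum_density (?f n) n 0"
      using elim unfolding A_def B_def sx by simp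
    finally have ER: "exp (- (x n)\<^sup>2 / 2) * R n = sum_density (?f n) (n - 1) ((tmean (T n) - y) / tsd (T n)) / sum_density (?f n) n 0" .
    show ?case unfolding cond_density_via_std_tilt[OF elim] ER[symmetric] by (rule mult.assoc[symmetric])
  qed
  moreover have "(\<lambda>n. exp (T n * y) * p y / \<Phi> (T n) * exp (- (x n)\<^sup>2 / 2) * R n)
     \<sim>[sequentially] (\<lambda>n. exp (T n * y) * p y / \<Phi> (T n) * exp (- (x n)\<^sup>2 / 2) * 1)"
    using tendsto_imp_asymp_equiv_const[OF R1] by (intro asymp_equiv_mult asymp_equiv_refl) simp
  ultimately show ?thesis
    by (subst asymp_equiv_cong) (auto simp: eventually_mono)
qed

end

section \<open>Laplace asymptotics at the saddle point\<close>

text \<open>\<open>G i\<close> is the derivative of \<open>g\<close> of order \<open>i\<close>.\<close>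
locale convex_potential =
  fixes p g q :: "real \<Rightarrow> real" and G :: "nat \<Rightarrow> real \<Rightarrow> real" and Q :: real
  assumes measurable_p: "p \<in> borel_measurable borel"
    and p_eq: "p x = (if x \<ge> 0 then exp (- (g x - q x)) else 0)"
    and integral_p: "(LBINT x. p x) = 1"
    and g_pos: "x \<ge> 0 \<Longrightarrow> g x > 0"
    and g_convex: "convex_on {0..} g"
    and G_0: "G 0 = g" and G_derivs: "derivs_on {0<..} 4 G"
    and g_superlinear: "filterlim (\<lambda>x. g x / x) at_top at_top"
    and q_bound: "x \<ge> 0 \<Longrightarrow> \<bar>q x\<bar> \<le> Q"
begin

lemma Q_nonneg: "0 \<le> Q" using q_bound[of 0] by simp

lemma exp_p_bounded: "\<exists>B. \<forall>x. exp (t * x) * p x \<le> B"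
proof -
  have "eventually (\<lambda>x. \<bar>t\<bar> \<le> g x / x) at_top" using g_superlinear by (simp add: filterlim_at_top)
  then obtain X where X: "\<And>x. x \<ge> X \<Longrightarrow> \<bar>t\<bar> \<le> g x / x" by (auto simp: eventually_at_top_linorder)
  define Y where "Y = max X 1"
  have "exp (t * x) * p x \<le> exp (\<bar>t\<bar> * Y + Q)" for x
  proof (cases "x \<ge> 0")
    case True
    have "t * x \<le> \<bar>t\<bar> * x" using True by (simp add: mult_right_mono)
    moreover have "\<bar>t\<bar> * x - g x \<le> \<bar>t\<bar> * Y"
    proof (cases "x \<ge> Y")
      case True
      then have "\<bar>t\<bar> * x \<le> g x" using X[of x] by (simp add: Y_def field_simps)
      moreover have "0 \<le> \<bar>t\<bar> * Y" by (simp add: Y_def)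
      ultimately show ?thesis by linarith
    next
      case False
      then have "\<bar>t\<bar> * x \<le> \<bar>t\<bar> * Y" by (intro mult_left_mono) auto
      then show ?thesis using g_pos[OF \<open>x \<ge> 0\<close>] by linarith
    qed
    ultimately have "t * x - (g x - q x) \<le> \<bar>t\<bar> * Y + Q" using q_bound[OF True] by linarith
    then show ?thesis using True by (simp add: p_eq flip: exp_add)
  qed (simp add: p_eq)
  then show ?thesis by blast
qed

sublocale tiltable p
  by unfold_locales (use measurable_p integral_p exp_p_bounded in \<open>auto simp: p_eq\<close>)

lemma G_DERIV: "i < 4 \<Longrightarrow> x > 0 \<Longrightarrow> (G i has_real_derivative G (Suc i) x) (at x)"
  using G_derivs unfolding derivs_on_def by (metis at_within_open greaterThan_iff open_greaterThan)

lemma g_above_tangent: "x > 0 \<Longrightarrow> y \<ge> 0 \<Longrightarrow> G 1 x * (y - x) \<le> g y - g x"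
proof -
  assume x: "x > 0" and y: "y \<ge> 0"
  have "x \<in> interior {0..}" using x by simp
  moreover have "(g has_real_derivative G 1 x) (at x within {0..})"
    using G_DERIV[of 0 x] x by (simp add: G_0 has_field_derivative_at_within)
  ultimately show ?thesis using convex_on_imp_above_tangent[OF g_convex, of x y] y by simp
qed

lemma G1_mono: "0 < x \<Longrightarrow> x \<le> y \<Longrightarrow> G 1 x \<le> G 1 y"
proof -
  assume "0 < x" "x \<le> y"
  then have "0 \<le> (G 1 y - G 1 x) * (y - x)"
    using g_above_tangent[of x y] g_above_tangent[of y x] by (simp add: algebra_simps)
  then show ?thesis using \<open>x \<le> y\<close> by (cases "x = y") (auto simp: zero_le_mult_iff)
qed

lemma G1_at_top: "filterlim (G 1) at_top at_top"
  unfolding filterlim_at_top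
proof
  fix B :: real
  have "eventually (\<lambda>x. \<bar>B\<bar> + \<bar>g 1\<bar> \<le> g x / x) at_top" using g_superlinear by (simp add: filterlim_at_top)
  then show "eventually (\<lambda>x. B \<le> G 1 x) at_top"
    using eventually_gt_at_top[of 1]
  proof eventually_elim
    case (elim x)
    have "(\<bar>B\<bar> + \<bar>g 1\<bar>) * x \<le> g x" using elim by (simp add: field_simps)
    moreover have "\<bar>g 1\<bar> * 1 \<le> \<bar>g 1\<bar> * x" using elim by (intro mult_left_mono) auto
    moreover have "B * (x - 1) \<le> \<bar>B\<bar> * (x - 1)" using elim by (intro mult_right_mono) auto
    moreover have "G 1 x * (1 - x) \<le> g 1 - g x" using elim by (intro g_above_tangent) auto
    ultimately have "B * (x - 1) \<le> G 1 x * (x - 1)" by (simp add: algebra_simps)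
    then show ?case using elim by simp
  qed
qed

lemma ex_G1_eq: "eventually (\<lambda>t. \<exists>x\<ge>1. G 1 x = t) at_top"
  using eventually_ge_at_top[of "G 1 1"]
proof eventually_elim
  case (elim t)
  obtain y where y: "y \<ge> 1" "t \<le> G 1 y"
    using eventually_happens[OF eventually_conj[OF eventually_ge_at_top[of 1] G1_at_top[unfolded filterlim_at_top, rule_format, of t]]] by auto
  have "\<exists>x\<ge>1. x \<le> y \<and> G 1 x = t"
    by (rule IVT) (use elim y in \<open>auto intro!: DERIV_isCont[OF G_DERIV]\<close>)
  then show ?case by blast
qed

text \<open>The point where \<open>t * x - g x\<close> is largest; the tilted law concentrates around it.\<close>
definition "saddle t = (SOME x. x \<ge> 1 \<and> G 1 x = t)"

lemma G1_saddle: "eventually (\<lambda>t. saddle t \<ge> 1 \<and> G 1 (saddle t) = t) at_top"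
  using ex_G1_eq
proof eventually_elim
  case (elim t)
  then have "\<exists>x. x \<ge> 1 \<and> G 1 x = t" by blast
  then show ?case unfolding saddle_def by (rule someI_ex)
qed

lemma saddle_at_top: "filterlim saddle at_top at_top"
  unfolding filterlim_at_top
proof
  fix B :: real
  show "eventually (\<lambda>t. B \<le> saddle t) at_top"
    using G1_saddle eventually_gt_at_top[of "G 1 (max B 1)"]
  proof eventually_elim
    case (elim t)
    show ?case
    proof (rule ccontr)
      assume "\<not> B \<le> saddle t"
      then have "G 1 (saddle t) \<le> G 1 (max B 1)" using elim by (intro G1_mono) auto
      then show False using elim by simp
    qed
  qed
qed

text \<open>Write \<open>y = x + \<sigma> x * z\<close> around the saddle point \<open>x\<close> of \<open>t = G 1 x\<close>.  Then \<open>\<kappa> x z\<close> is the height of \<open>g\<close>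
  above its tangent at \<open>x\<close>, and \<open>exp (t * y) * p y\<close> is \<open>exp (t * x - g x)\<close> times \<open>w x z\<close>.  The scale
  \<open>\<sigma>\<close> is the one for which the quadratic part of \<open>\<kappa> x z\<close> is \<open>z\<^sup>2 / 2\<close>.\<close>
definition "\<sigma> x = 1 / sqrt (G 2 x)"

definition "\<kappa> x z = g (x + \<sigma> x * z) - g x - G 1 x * (\<sigma> x * z)"

definition "w x z = p (x + \<sigma> x * z) * exp (g x + G 1 x * (\<sigma> x * z))"

lemma w_eq: "w x z = (if x + \<sigma> x * z \<ge> 0 then exp (- \<kappa> x z + q (x + \<sigma> x * z)) else 0)"
  by (simp add: w_def p_eq \<kappa>_def algebra_simps flip: exp_add)

lemma w_nonneg: "0 \<le> w x z" by (simp add: w_eq)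

lemma w_measurable [measurable]: "w x \<in> borel_measurable borel"
  unfolding w_def[abs_def] by measurable

lemma \<kappa>_nonneg: "x > 0 \<Longrightarrow> x + \<sigma> x * z \<ge> 0 \<Longrightarrow> 0 \<le> \<kappa> x z"
  using g_above_tangent[of x "x + \<sigma> x * z"] by (simp add: \<kappa>_def)

text \<open>A convex function that vanishes at \<open>0\<close> grows at least linearly along a ray, so lower bounds at
  \<open>z = 1\<close> and \<open>z = - 1\<close> control the whole tail.\<close>
lemma \<kappa>_linear_growth:
  assumes x: "x > 0" and b: "x + \<sigma> x * e \<ge> 0" "x + \<sigma> x * (e * r) \<ge> 0" "r \<ge> 1"
  shows "r * \<kappa> x e \<le> \<kappa> x (e * r)"
proof -
  have "g ((1 - 1 / r) *\<^sub>R x + (1 / r) *\<^sub>R (x + \<sigma> x * (e * r))) \<le> (1 - 1 / r) * g x + (1 / r) * g (x + \<sigma> x * (e * r))"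
    by (rule convex_onD[OF g_convex]) (use x b in auto)
  moreover have "(1 - 1 / r) *\<^sub>R x + (1 / r) *\<^sub>R (x + \<sigma> x * (e * r)) = x + \<sigma> x * e"
    using b by (simp add: field_simps)
  ultimately have "g (x + \<sigma> x * e) \<le> (1 - 1 / r) * g x + (1 / r) * g (x + \<sigma> x * (e * r))" by simp
  then have "r * g (x + \<sigma> x * e) \<le> r * ((1 - 1 / r) * g x + (1 / r) * g (x + \<sigma> x * (e * r)))"
    using b by (intro mult_left_mono) auto
  also have "\<dots> = (r - 1) * g x + g (x + \<sigma> x * (e * r))" using b by (simp add: field_simps)
  finally show ?thesis unfolding \<kappa>_def by (simp add: algebra_simps)
qed

text \<open>The majorant for the Laplace integral.  The limits of \<open>\<kappa> x 1\<close> and \<open>\<kappa> x (- 1)\<close> are \<open>1 / 2\<close>, which leaves room for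
  the bound \<open>1 / 4\<close>.\<close>
lemma w_le_exp:
  assumes x: "x > 0" and k1: "x + \<sigma> x * 1 \<ge> 0" "1 / 4 \<le> \<kappa> x 1" and k2: "x + \<sigma> x * (- 1) \<ge> 0" "1 / 4 \<le> \<kappa> x (- 1)"
  shows "w x z \<le> exp (Q + 1 / 4) * exp (- \<bar>z\<bar> / 4)"
proof (cases "x + \<sigma> x * z \<ge> 0")
  case True
  have "\<bar>z\<bar> / 4 - 1 / 4 \<le> \<kappa> x z"
  proof (cases "\<bar>z\<bar> \<le> 1")
    case True
    then show ?thesis using \<kappa>_nonneg[OF x \<open>x + \<sigma> x * z \<ge> 0\<close>] by linarith
  next
    case False
    have "\<bar>z\<bar> / 4 \<le> \<kappa> x z"
    proof (cases "z > 0")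
      case True
      then have "\<bar>z\<bar> * \<kappa> x 1 \<le> \<kappa> x z"
        using \<kappa>_linear_growth[of x 1 z] x k1 False \<open>x + \<sigma> x * z \<ge> 0\<close> by simp
      moreover have "\<bar>z\<bar> * (1 / 4) \<le> \<bar>z\<bar> * \<kappa> x 1" using k1 by (intro mult_left_mono) auto
      ultimately show ?thesis by linarith
    next
      case False
      then have "\<bar>z\<bar> * \<kappa> x (- 1) \<le> \<kappa> x z"
        using \<kappa>_linear_growth[of x "-1" "- z"] x k2 \<open>\<not> \<bar>z\<bar> \<le> 1\<close> \<open>x + \<sigma> x * z \<ge> 0\<close> by simp
      moreover have "\<bar>z\<bar> * (1 / 4) \<le> \<bar>z\<bar> * \<kappa> x (- 1)" using k2 by (intro mult_left_mono) auto
      ultimately show ?thesis by linarith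
    qed
    then show ?thesis by linarith
  qed
  moreover have "\<bar>q (x + \<sigma> x * z)\<bar> \<le> Q" using True by (rule q_bound)
  ultimately have "- \<kappa> x z + q (x + \<sigma> x * z) \<le> Q + 1 / 4 + (- \<bar>z\<bar> / 4)" by linarith
  then show ?thesis using True by (simp add: w_eq flip: exp_add)
qed (simp add: w_eq)

text \<open>Taylor's formula on either side of \<open>x\<close>, stated for the increment \<open>u\<close>.\<close>
lemma taylor_potential:
  assumes n: "0 < n" "n \<le> 4" and x: "x > 0" and y: "x + u > 0"
  shows "\<exists>\<xi>. \<bar>\<xi>\<bar> \<le> \<bar>u\<bar> \<and> \<xi> * u \<ge> 0 \<and> g (x + u) = (\<Sum>m<n. G m x / fact m * u ^ m) + G n (x + \<xi>) / fact n * u ^ n"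
proof -
  consider "u = 0" | "u > 0" | "u < 0" by linarith
  then show ?thesis
  proof cases
    case 1
    then have "(\<Sum>m<n. G m x / fact m * u ^ m) = g x" using n(1)
      by (cases n) (simp_all add: lessThan_Suc_eq_insert_0 sum.reindex G_0)
    then show ?thesis using 1 n by (intro exI[of _ 0]) simp
  next
    case 2
    have "\<exists>t. x < t \<and> t < x + u \<and> g (x + u) = (\<Sum>m<n. (G m x / fact m) * ((x + u) - x) ^ m) + (G n t / fact n) * ((x + u) - x) ^ n"
      by (rule Taylor_up[of n G g x]) (use n x 2 G_0 in \<open>auto intro!: G_DERIV\<close>)
    then obtain t where t: "x < t" "t < x + u" "g (x + u) = (\<Sum>m<n. (G m x / fact m) * u ^ m) + (G n t / fact n) * u ^ n" by auto
    then show ?thesis using 2 by (intro exI[of _ "t - x"]) (auto simp: mult_nonneg_nonneg)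
  next
    case 3
    have "\<exists>t. x + u < t \<and> t < x \<and> g (x + u) = (\<Sum>m<n. (G m x / fact m) * ((x + u) - x) ^ m) + (G n t / fact n) * ((x + u) - x) ^ n"
      by (rule Taylor_down[of n G g _ x x]) (use n y 3 G_0 in \<open>auto intro!: G_DERIV\<close>)
    then obtain t where t: "x + u < t" "t < x" "g (x + u) = (\<Sum>m<n. (G m x / fact m) * u ^ m) + (G n t / fact n) * u ^ n" by auto
    then show ?thesis using 3 by (intro exI[of _ "t - x"]) (auto simp: mult_nonpos_nonpos)
  qed
qed

text \<open>The substitution \<open>y = x + \<sigma> x * z\<close> turns tilted moments about the saddle point into moments of \<open>w x\<close>.\<close>
lemma tilted_moment_saddle:
  assumes s: "\<sigma> x > 0"
  shows "tilted_moment p x k (G 1 x) = \<sigma> x ^ Suc k * exp (G 1 x * x - g x) * (LBINT z. z ^ k * w x z)"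
proof -
  have "tilted_moment p x k (G 1 x) = \<sigma> x * (LBINT z. (x + \<sigma> x * z - x) ^ k * exp (G 1 x * (x + \<sigma> x * z)) * p (x + \<sigma> x * z))"
    unfolding tilted_moment_def using s by (subst lborel_integral_real_affine[where c = "\<sigma> x" and t = x]) simp_all
  also have "(LBINT z. (x + \<sigma> x * z - x) ^ k * exp (G 1 x * (x + \<sigma> x * z)) * p (x + \<sigma> x * z))
      = (LBINT z. (\<sigma> x ^ k * exp (G 1 x * x - g x)) * (z ^ k * w x z))"
  proof (intro Bochner_Integration.integral_cong refl)
    fix z
    have "exp (G 1 x * (x + \<sigma> x * z)) = exp (G 1 x * x - g x) * exp (g x + G 1 x * (\<sigma> x * z))"
      by (simp add: algebra_simps flip: exp_add)
    then show "(x + \<sigma> x * z - x) ^ k * exp (G 1 x * (x + \<sigma> x * z)) * p (x + \<sigma> x * z) = (\<sigma> x ^ k * exp (G 1 x * x - g x)) * (z ^ k * w x z)"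
      unfolding w_def by (simp add: power_mult_distrib)
  qed
  also have "\<dots> = \<sigma> x ^ k * exp (G 1 x * x - g x) * (LBINT z. z ^ k * w x z)" by (rule integral_mult_right_zero)
  finally show ?thesis by simp
qed

end

lemma integrable_power_exp_abs: "integrable lborel (\<lambda>z::real. \<bar>z\<bar> ^ k * exp (- \<bar>z\<bar> / 4))"
proof -
  let ?f = "\<lambda>z::real. z ^ k * exp (- z) * indicator {0..} z"
  have f: "integrable lborel ?f"
  proof (rule integrableI_nonneg)
    have "(\<integral>\<^sup>+x. ennreal (?f x) \<partial>lborel) = (\<integral>\<^sup>+x. ennreal (x ^ k * exp (- x)) * indicator {0..} x \<partial>lborel)"
      by (intro nn_integral_cong) (auto simp: indicator_def)
    then show "(\<integral>\<^sup>+x. ennreal (?f x) \<partial>lborel) < \<infinity>"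
      unfolding nn_intergal_power_times_exp_Ici by simp
  qed (auto simp: indicator_def)
  have "integrable lborel (\<lambda>z. 4 ^ k * (?f (0 + (1/4) * z) + ?f (0 + (- 1/4) * z)))"
    by (intro integrable_mult_right Bochner_Integration.integrable_add lborel_integrable_real_affine[OF f]) auto
  then show ?thesis
  proof (rule Bochner_Integration.integrable_bound)
    show "AE z in lborel. norm (\<bar>z\<bar> ^ k * exp (- \<bar>z\<bar> / 4)) \<le> norm (4 ^ k * (?f (0 + (1/4) * z) + ?f (0 + (- 1/4) * z)))"
    proof (intro AE_I2)
      fix z :: real
      show "norm (\<bar>z\<bar> ^ k * exp (- \<bar>z\<bar> / 4)) \<le> norm (4 ^ k * (?f (0 + (1/4) * z) + ?f (0 + (- 1/4) * z)))"
      proof (cases "z = 0")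
        case False
        then show ?thesis by (cases "z > 0") (auto simp: indicator_def power_divide abs_mult)
      qed (auto simp: indicator_def power_0_left)
    qed
  qed simp
qed

text \<open>The quotient in \<open>slow\<close> is \<open>- 2 * \<sigma>'\<close>.  A positive function whose derivative tends to \<open>0\<close> is
  self-neglecting: it hardly changes over a bounded number of multiples of itself.  This is the form in
  which both regular and rapid variation of \<open>g'\<close> enter Laplace's method.\<close>
locale gaussian_regime = convex_potential +
  assumes G2_pos: "eventually (\<lambda>x. 0 < G 2 x) at_top"
    and slow: "((\<lambda>x. G 3 x / (G 2 x * sqrt (G 2 x))) \<longlongrightarrow> 0) at_top"
    and q_lim: "(q \<longlongrightarrow> 0) at_top"
begin

lemma \<sigma>_DERIV:
  assumes "x > 0" "0 < G 2 x"
  shows "(\<sigma> has_real_derivative - (G 3 x / (G 2 x * sqrt (G 2 x))) / 2) (at x)"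
proof -
  have d: "(G 2 has_real_derivative G 3 x) (at x)" using G_DERIV[of 2 x] assms by (simp add: numeral_3_eq_3 numeral_2_eq_2)
  have "((\<lambda>x. 1 / sqrt (G 2 x)) has_real_derivative - (G 3 x * (inverse (sqrt (G 2 x)) / 2)) / (sqrt (G 2 x) * sqrt (G 2 x))) (at x)"
    using assms by (auto intro!: derivative_eq_intros d)
  moreover have "- (G 3 x * (inverse (sqrt (G 2 x)) / 2)) / (sqrt (G 2 x) * sqrt (G 2 x)) = - (G 3 x / (G 2 x * sqrt (G 2 x))) / 2"
    using assms by (simp add: field_simps)
  ultimately show ?thesis unfolding \<sigma>_def[abs_def] by simp
qed

lemma \<sigma>_lipschitz:
  assumes \<eta>: "\<eta> > 0"
  shows "eventually (\<lambda>a. a > 0 \<and> (\<forall>x\<ge>a. 0 < G 2 x) \<and> (\<forall>x\<ge>a. \<forall>y\<ge>a. \<bar>\<sigma> y - \<sigma> x\<bar> \<le> \<eta> * \<bar>y - x\<bar>)) at_top"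
proof -
  have "eventually (\<lambda>x. \<bar>G 3 x / (G 2 x * sqrt (G 2 x))\<bar> < \<eta>) at_top"
    using tendsto_rabs[OF slow] \<eta> by (intro order_tendstoD(2)) auto
  with G2_pos have "eventually (\<lambda>x. 0 < G 2 x \<and> \<bar>G 3 x / (G 2 x * sqrt (G 2 x))\<bar> < \<eta>) at_top" by eventually_elim auto
  then obtain a0 where a0: "\<And>x. x \<ge> a0 \<Longrightarrow> 0 < G 2 x" "\<And>x. x \<ge> a0 \<Longrightarrow> \<bar>G 3 x / (G 2 x * sqrt (G 2 x))\<bar> < \<eta>"
    by (auto simp: eventually_at_top_linorder)
  show ?thesis
    using eventually_ge_at_top[of a0] eventually_gt_at_top[of 0]
  proof eventually_elim
    case (elim a)
    have "\<bar>\<sigma> y - \<sigma> x\<bar> \<le> \<eta> * \<bar>y - x\<bar>" if "x \<ge> a" "y \<ge> a" for x y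
    proof -
      have "norm (\<sigma> y - \<sigma> x) \<le> \<eta> * norm (y - x)"
      proof (rule field_differentiable_bound[where S = "{a..}"])
        fix z assume "z \<in> {a..}"
        then show "(\<sigma> has_field_derivative - (G 3 z / (G 2 z * sqrt (G 2 z))) / 2) (at z within {a..})"
          using elim a0 by (intro has_field_derivative_at_within[OF \<sigma>_DERIV]) auto
        show "norm (- (G 3 z / (G 2 z * sqrt (G 2 z))) / 2) \<le> \<eta>"
          using a0(2)[of z] \<open>z \<in> {a..}\<close> elim \<eta> by simp
      qed (use that in auto)
      then show ?thesis by simp
    qed
    then show ?case using elim a0 by auto
  qed
qed

text \<open>A function with derivative tending to \<open>0\<close> grows slower than the identity.\<close>
lemma \<sigma>_over_id: "((\<lambda>x. \<sigma> x / x) \<longlongrightarrow> 0) at_top"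
proof (rule tendstoI)
  fix e :: real assume e: "e > 0"
  from eventually_happens[OF \<sigma>_lipschitz[of "e / 2"]] e
  obtain a where a: "a > 0" "\<And>x. x \<ge> a \<Longrightarrow> 0 < G 2 x" "\<And>x y. x \<ge> a \<Longrightarrow> y \<ge> a \<Longrightarrow> \<bar>\<sigma> y - \<sigma> x\<bar> \<le> e / 2 * \<bar>y - x\<bar>" by auto
  show "eventually (\<lambda>x. dist (\<sigma> x / x) 0 < e) at_top"
    using eventually_ge_at_top[of a] eventually_gt_at_top[of "2 * \<sigma> a / e"]
  proof eventually_elim
    case (elim x)
    have "\<sigma> x \<le> \<sigma> a + e / 2 * (x - a)" 
    proof -
      have "\<bar>\<sigma> x - \<sigma> a\<bar> \<le> e / 2 * (x - a)" using a(3)[of a x] elim by simp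
      then show ?thesis by (simp only: abs_le_iff) linarith
    qed
    moreover have "2 * \<sigma> a < e * x" using elim e by (simp add: field_simps)
    moreover have "e * a > 0" using a e by simp
    ultimately have "\<sigma> x < e * x" by (simp add: right_diff_distrib)
    moreover have "\<sigma> x > 0" using a(2)[of x] elim by (simp add: \<sigma>_def)
    ultimately show ?case using elim a(1) by (simp add: field_simps)
  qed
qed

text \<open>As \<open>\<sigma> x = o(x)\<close>, a window of \<open>B\<close> multiples of \<open>\<sigma> x\<close> around \<open>x\<close> stays to the right of \<open>x / 2\<close>, where
  \<open>\<sigma>'\<close> is small; the mean value theorem bounds the relative change of \<open>\<sigma>\<close> over the window by \<open>B\<close> times this small
  bound.\<close>
lemma self_neglecting:
  assumes "B \<ge> 0" "\<epsilon> > 0"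
  shows "eventually (\<lambda>x. x > 0 \<and> \<sigma> x > 0 \<and> (\<forall>u. \<bar>u\<bar> \<le> B \<longrightarrow> x / 2 \<le> x + \<sigma> x * u \<and> 0 < G 2 (x + \<sigma> x * u) \<and> \<bar>\<sigma> (x + \<sigma> x * u) / \<sigma> x - 1\<bar> \<le> \<epsilon>)) at_top"
proof -
  define \<eta> where "\<eta> = \<epsilon> / (B + 1)"
  have \<eta>: "\<eta> > 0" using assms by (simp add: \<eta>_def)
  from eventually_happens[OF \<sigma>_lipschitz[OF \<eta>]]
  obtain a where a: "a > 0" "\<And>x. x \<ge> a \<Longrightarrow> 0 < G 2 x" "\<And>x y. x \<ge> a \<Longrightarrow> y \<ge> a \<Longrightarrow> \<bar>\<sigma> y - \<sigma> x\<bar> \<le> \<eta> * \<bar>y - x\<bar>" by auto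
  have "eventually (\<lambda>x. \<sigma> x / x < 1 / (2 * (B + 1))) at_top"
    using \<sigma>_over_id assms by (intro order_tendstoD(2)) auto
  then show ?thesis using eventually_ge_at_top[of "2 * a"]
  proof eventually_elim
    case (elim x)
    have x: "x > 0" "x \<ge> a" using elim a(1) by auto
    have s: "\<sigma> x > 0" using a(2)[OF x(2)] by (simp add: \<sigma>_def)
    have sx: "\<sigma> x * (B + 1) \<le> x / 2" using elim x assms by (simp add: field_simps)
    have "x / 2 \<le> x + \<sigma> x * u \<and> 0 < G 2 (x + \<sigma> x * u) \<and> \<bar>\<sigma> (x + \<sigma> x * u) / \<sigma> x - 1\<bar> \<le> \<epsilon>" if u: "\<bar>u\<bar> \<le> B" for u
    proof -
      have "\<bar>\<sigma> x * u\<bar> \<le> \<sigma> x * (B + 1)" using s u by (simp add: abs_mult)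
      then have l: "x / 2 \<le> x + \<sigma> x * u" using sx by linarith
      then have la: "x + \<sigma> x * u \<ge> a" using elim by linarith
      have "\<bar>\<sigma> (x + \<sigma> x * u) - \<sigma> x\<bar> \<le> \<eta> * \<bar>\<sigma> x * u\<bar>" using a(3)[OF x(2) la] by simp
      also have "\<dots> \<le> \<eta> * (\<sigma> x * (B + 1))" using \<eta> \<open>\<bar>\<sigma> x * u\<bar> \<le> \<sigma> x * (B + 1)\<close> by (intro mult_left_mono) auto
      also have "\<dots> = \<epsilon> * \<sigma> x" using assms by (simp add: \<eta>_def)
      finally have "\<bar>(\<sigma> (x + \<sigma> x * u) - \<sigma> x) / \<sigma> x\<bar> \<le> \<epsilon>" using s by (simp add: abs_divide field_simps)
      then have "\<bar>\<sigma> (x + \<sigma> x * u) / \<sigma> x - 1\<bar> \<le> \<epsilon>" using s by (simp add: diff_divide_distrib)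
      then show ?thesis using l la a(2) by blast
    qed
    then show ?case using x s by blast
  qed
qed

context
  fixes X :: "nat \<Rightarrow> real"
  assumes X: "filterlim X at_top sequentially"
begin

lemma window_at_top:
  assumes u: "\<And>n. \<bar>u n\<bar> \<le> B"
  shows "filterlim (\<lambda>n. X n + \<sigma> (X n) * u n) at_top sequentially"
    and "(\<lambda>n. G 2 (X n + \<sigma> (X n) * u n) / G 2 (X n)) \<longlonglongrightarrow> 1"
proof -
  have B: "B \<ge> 0" using u[of 0] by linarith
  have ev: "eventually (\<lambda>n. X n > 0 \<and> \<sigma> (X n) > 0 \<and> X n / 2 \<le> X n + \<sigma> (X n) * u n \<and> 0 < G 2 (X n + \<sigma> (X n) * u n) \<and> \<bar>\<sigma> (X n + \<sigma> (X n) * u n) / \<sigma> (X n) - 1\<bar> \<le> \<epsilon>) sequentially"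
    if "\<epsilon> > 0" for \<epsilon>
    using eventually_compose_filterlim[OF self_neglecting[OF B that] X] by eventually_elim (use u in blast)
  note ev1 = ev[OF zero_less_one]
  show "filterlim (\<lambda>n. X n + \<sigma> (X n) * u n) at_top sequentially"
  proof (rule filterlim_at_top_mono)
    show "filterlim (\<lambda>n. (1/2) * X n) at_top sequentially"
      by (rule filterlim_tendsto_pos_mult_at_top[OF tendsto_const _ X]) simp
    show "eventually (\<lambda>n. (1/2) * X n \<le> X n + \<sigma> (X n) * u n) sequentially" using ev1 by eventually_elim auto
  qed
  have r: "(\<lambda>n. \<sigma> (X n + \<sigma> (X n) * u n) / \<sigma> (X n)) \<longlonglongrightarrow> 1"
  proof (rule tendstoI)
    fix e :: real assume "e > 0"
    then show "eventually (\<lambda>n. dist (\<sigma> (X n + \<sigma> (X n) * u n) / \<sigma> (X n)) 1 < e) sequentially"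
      using ev[of "e / 2"] by (auto elim!: eventually_mono simp: dist_real_def)
  qed
  have "(\<lambda>n. 1 / (\<sigma> (X n + \<sigma> (X n) * u n) / \<sigma> (X n))\<^sup>2) \<longlonglongrightarrow> 1 / 1\<^sup>2"
    by (intro tendsto_intros r) simp
  then show "(\<lambda>n. G 2 (X n + \<sigma> (X n) * u n) / G 2 (X n)) \<longlonglongrightarrow> 1"
  proof -
    assume l: "(\<lambda>n. 1 / (\<sigma> (X n + \<sigma> (X n) * u n) / \<sigma> (X n))\<^sup>2) \<longlonglongrightarrow> 1 / 1\<^sup>2"
    have "eventually (\<lambda>n. 1 / (\<sigma> (X n + \<sigma> (X n) * u n) / \<sigma> (X n))\<^sup>2 = G 2 (X n + \<sigma> (X n) * u n) / G 2 (X n)) sequentially"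
      using ev1
    proof eventually_elim
      case (elim n)
      then have "0 < G 2 (X n)" by (simp add: \<sigma>_def zero_less_divide_iff)
      then show ?case using elim by (simp add: \<sigma>_def power_divide)
    qed
    with l show ?thesis by (simp add: Lim_transform_eventually)
  qed
qed

lemma eventually_saddle: "eventually (\<lambda>n. X n > 0 \<and> 0 < G 2 (X n) \<and> \<sigma> (X n) > 0) sequentially"
proof -
  have "eventually (\<lambda>x. x > 0 \<and> 0 < G 2 x) at_top" using G2_pos eventually_gt_at_top[of 0] by eventually_elim auto
  from eventually_compose_filterlim[OF this X] show ?thesis by (auto simp: \<sigma>_def elim!: eventually_mono)
qed

text \<open>Second-order Taylor expansion: the intermediate point lies in the window, where \<open>G 2\<close> is almost
  constant.  The argument \<open>z\<close> varies with \<open>n\<close> because exact standardization shifts it slightly.\<close>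
lemma \<kappa>_lim:
  assumes z: "z \<longlonglongrightarrow> z0"
  shows "(\<lambda>n. \<kappa> (X n) (z n)) \<longlonglongrightarrow> z0\<^sup>2 / 2"
proof -
  from convergent_imp_Bseq[OF convergentI[OF z]] obtain B where B: "\<And>n. \<bar>z n\<bar> \<le> B" unfolding Bseq_def by auto
  let ?P = "\<lambda>n \<xi>. \<bar>\<xi>\<bar> \<le> \<bar>z n\<bar> \<and> (\<kappa> (X n) (z n) = G 2 (X n + \<sigma> (X n) * \<xi>) / G 2 (X n) * ((z n)\<^sup>2 / 2))"
  have ex: "\<exists>\<xi>. ?P n \<xi>" if s: "X n > 0" "0 < G 2 (X n)" "\<sigma> (X n) > 0" and y: "X n + \<sigma> (X n) * z n > 0" for n
  proof -
    obtain \<xi> where \<xi>: "\<bar>\<xi>\<bar> \<le> \<bar>\<sigma> (X n) * z n\<bar>" "g (X n + \<sigma> (X n) * z n) = (\<Sum>m<2. G m (X n) / fact m * (\<sigma> (X n) * z n) ^ m) + G 2 (X n + \<xi>) / fact 2 * (\<sigma> (X n) * z n) ^ 2"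
      using taylor_potential[of 2 "X n" "\<sigma> (X n) * z n"] s y by auto
    have s2: "(\<sigma> (X n))\<^sup>2 = 1 / G 2 (X n)" using s by (simp add: \<sigma>_def power_divide)
    have "\<kappa> (X n) (z n) = G 2 (X n + \<xi>) / 2 * (\<sigma> (X n) * z n) ^ 2"
      unfolding \<kappa>_def \<xi>(2) by (simp add: numeral_2_eq_2 G_0)
    also have "\<dots> = G 2 (X n + \<xi>) / G 2 (X n) * ((z n)\<^sup>2 / 2)" by (simp add: power_mult_distrib s2)
    finally have "\<kappa> (X n) (z n) = G 2 (X n + \<sigma> (X n) * (\<xi> / \<sigma> (X n))) / G 2 (X n) * ((z n)\<^sup>2 / 2)" using s by simp
    moreover have "\<bar>\<xi> / \<sigma> (X n)\<bar> \<le> \<bar>z n\<bar>" using \<xi>(1) s by (simp add: abs_mult field_simps)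
    ultimately show ?thesis by blast
  qed
  \<comment> \<open>the default \<open>0\<close> keeps \<open>\<xi>\<close> within the window for all \<open>n\<close>\<close>
  define \<xi> where "\<xi> n = (if \<exists>\<xi>. ?P n \<xi> then (SOME \<xi>. ?P n \<xi>) else 0)" for n
  have \<xi>: "?P n (\<xi> n)" if "\<exists>\<xi>. ?P n \<xi>" for n
    using someI_ex[OF that] that unfolding \<xi>_def by presburger
  have \<xi>B: "\<bar>\<xi> n\<bar> \<le> B" for n
  proof (cases "\<exists>\<xi>. ?P n \<xi>")
    case True
    then show ?thesis using \<xi>[OF True] B[of n] by linarith
  next
    case False
    then have "\<xi> n = 0" unfolding \<xi>_def by (rule if_not_P)
    then show ?thesis using B[of n] by simp
  qed
  have pos: "eventually (\<lambda>n. 0 < X n + \<sigma> (X n) * z n) sequentially"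
    using window_at_top(1)[of z, OF B] by (auto simp: filterlim_at_top_dense)
  have "(\<lambda>n. G 2 (X n + \<sigma> (X n) * \<xi> n) / G 2 (X n) * ((z n)\<^sup>2 / 2)) \<longlonglongrightarrow> 1 * (z0\<^sup>2 / 2)"
    by (intro tendsto_intros window_at_top(2)[OF \<xi>B] z) simp
  moreover have "eventually (\<lambda>n. G 2 (X n + \<sigma> (X n) * \<xi> n) / G 2 (X n) * ((z n)\<^sup>2 / 2) = \<kappa> (X n) (z n)) sequentially"
    using eventually_saddle pos
  proof eventually_elim
    case (elim n)
    then show ?case using \<xi>[OF ex[of n]] by simp
  qed
  ultimately show ?thesis by (simp add: Lim_transform_eventually)
qed

lemma w_lim:
  assumes z: "z \<longlonglongrightarrow> z0"
  shows "(\<lambda>n. w (X n) (z n)) \<longlonglongrightarrow> exp (- z0\<^sup>2 / 2)"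
proof -
  from convergent_imp_Bseq[OF convergentI[OF z]] obtain B where B: "\<And>n. \<bar>z n\<bar> \<le> B" unfolding Bseq_def by auto
  note y = window_at_top(1)[OF B]
  have "(\<lambda>n. exp (- \<kappa> (X n) (z n) + q (X n + \<sigma> (X n) * z n))) \<longlonglongrightarrow> exp (- (z0\<^sup>2 / 2) + 0)"
    by (intro tendsto_intros \<kappa>_lim z filterlim_compose[OF q_lim y])
  moreover have "eventually (\<lambda>n. exp (- \<kappa> (X n) (z n) + q (X n + \<sigma> (X n) * z n)) = w (X n) (z n)) sequentially"
    using filterlim_at_top[THEN iffD1, OF y, rule_format, of 0] by eventually_elim (simp add: w_eq)
  ultimately show ?thesis by (simp add: Lim_transform_eventually)
qed

lemma w_dominated: "eventually (\<lambda>n. \<forall>z. w (X n) z \<le> exp (Q + 1 / 4) * exp (- \<bar>z\<bar> / 4)) sequentially"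
proof -
  have k: "eventually (\<lambda>n. 1 / 4 < \<kappa> (X n) e) sequentially" "eventually (\<lambda>n. X n + \<sigma> (X n) * e \<ge> 0) sequentially" if "\<bar>e\<bar> = 1" for e
  proof -
    have "e\<^sup>2 = 1" using that by (simp add: power2_eq_1_iff abs_if split: if_splits)
    then show "eventually (\<lambda>n. 1 / 4 < \<kappa> (X n) e) sequentially"
      using \<kappa>_lim[of "\<lambda>_. e" e] by (intro order_tendstoD(1)) auto
    show "eventually (\<lambda>n. X n + \<sigma> (X n) * e \<ge> 0) sequentially"
      using window_at_top(1)[of "\<lambda>_. e" 1] that by (auto simp: filterlim_at_top)
  qed
  have k': "eventually (\<lambda>n. 1 / 4 < \<kappa> (X n) 1) sequentially" "eventually (\<lambda>n. X n + \<sigma> (X n) * 1 \<ge> 0) sequentially"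
    "eventually (\<lambda>n. 1 / 4 < \<kappa> (X n) (- 1)) sequentially" "eventually (\<lambda>n. X n + \<sigma> (X n) * (- 1) \<ge> 0) sequentially"
    by (rule k; simp)+
  show ?thesis
    using k' eventually_saddle
  proof eventually_elim
    case (elim n)
    show ?case using elim by (intro allI w_le_exp) (simp_all only: less_imp_le)
  qed
qed

text \<open>Up to common factors, the moments about the saddle point.  \<open>\<mu>\<close> and \<open>v\<close> are the mean and variance
  of the tilted law in the units of \<open>z\<close>; they measure how far the saddle point and \<open>\<sigma>\<close> are from
  \<open>tmean\<close> and \<open>tsd\<close>.\<close>
definition "M k n = (LBINT z. z ^ k * w (X n) z)"

lemma power_w_dominated:
  "eventually (\<lambda>n. \<forall>z. norm (z ^ k * w (X n) z) \<le> exp (Q + 1 / 4) * (\<bar>z\<bar> ^ k * exp (- \<bar>z\<bar> / 4))) sequentially"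
  using w_dominated
proof eventually_elim
  case (elim n)
  show ?case
  proof
    fix z
    have "\<bar>z\<bar> ^ k * w (X n) z \<le> \<bar>z\<bar> ^ k * (exp (Q + 1 / 4) * exp (- \<bar>z\<bar> / 4))"
      using elim by (intro mult_left_mono) auto
    then show "norm (z ^ k * w (X n) z) \<le> exp (Q + 1 / 4) * (\<bar>z\<bar> ^ k * exp (- \<bar>z\<bar> / 4))"
      using w_nonneg[of "X n" z] by (simp add: abs_mult power_abs mult_ac)
  qed
qed

lemma M_lim: "M k \<longlonglongrightarrow> (LBINT z. z ^ k * exp (- z\<^sup>2 / 2))"
  unfolding M_def
proof (rule integral_tendsto_eventually_dominated[OF _ _ _ _ power_w_dominated])
  show "integrable lborel (\<lambda>z. exp (Q + 1 / 4) * (\<bar>z\<bar> ^ k * exp (- \<bar>z\<bar> / 4)))"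
    by (intro integrable_mult_right integrable_power_exp_abs)
  show "(\<lambda>n. z ^ k * w (X n) z) \<longlonglongrightarrow> z ^ k * exp (- z\<^sup>2 / 2)" for z
    by (intro tendsto_mult tendsto_const w_lim)
qed simp_all

lemma gaussian_integrals:
  "(LBINT z. (z::real) ^ 0 * exp (- z\<^sup>2 / 2)) = sqrt (2 * pi)"
  "(LBINT z. (z::real) ^ 1 * exp (- z\<^sup>2 / 2)) = 0"
  "(LBINT z. (z::real) ^ 2 * exp (- z\<^sup>2 / 2)) = sqrt (2 * pi)"
  "(LBINT z. (z::real) ^ 3 * exp (- z\<^sup>2 / 2)) = 0"
proof -
  have e: "z ^ k * exp (- z\<^sup>2 / 2) = sqrt (2 * pi) * (std_normal_density z * z ^ k)" for z :: real and k
    by (simp add: std_normal_density_def)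
  note m = integral_std_normal_moment_even integral_std_normal_moment_odd
  show "(LBINT z. (z::real) ^ 0 * exp (- z\<^sup>2 / 2)) = sqrt (2 * pi)"
    "(LBINT z. (z::real) ^ 1 * exp (- z\<^sup>2 / 2)) = 0"
    "(LBINT z. (z::real) ^ 2 * exp (- z\<^sup>2 / 2)) = sqrt (2 * pi)"
    "(LBINT z. (z::real) ^ 3 * exp (- z\<^sup>2 / 2)) = 0"
    unfolding e integral_mult_right_zero
    using m(1)[of 0] m(2)[of 0] m(1)[of 1] m(2)[of 1] by (simp_all add: numeral_3_eq_3)
qed

definition "\<mu> n = M 1 n / M 0 n"
definition "v n = M 2 n / M 0 n - (\<mu> n)\<^sup>2"

lemma \<mu>_lim: "\<mu> \<longlonglongrightarrow> 0" and v_lim: "v \<longlonglongrightarrow> 1" and M0_lim: "M 0 \<longlonglongrightarrow> sqrt (2 * pi)"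
proof -
  show m0: "M 0 \<longlonglongrightarrow> sqrt (2 * pi)" using M_lim[of 0] gaussian_integrals(1) by simp
  have m1: "M 1 \<longlonglongrightarrow> 0" using M_lim[of 1] gaussian_integrals(2) by simp
  have m2: "M 2 \<longlonglongrightarrow> sqrt (2 * pi)" using M_lim[of 2] gaussian_integrals(3) by simp
  show u: "\<mu> \<longlonglongrightarrow> 0" unfolding \<mu>_def[abs_def] using tendsto_divide[OF m1 m0] by simp
  show "v \<longlonglongrightarrow> 1" unfolding v_def[abs_def]
    using tendsto_diff[OF tendsto_divide[OF m2 m0] tendsto_power[OF u, of 2]] by simp
qed

lemma cumulants_saddle:
  "eventually (\<lambda>n. \<Phi> (G 1 (X n)) = \<sigma> (X n) * exp (G 1 (X n) * X n - g (X n)) * M 0 n \<and>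
     tmean (G 1 (X n)) = X n + \<sigma> (X n) * \<mu> n \<and> tvar (G 1 (X n)) = (\<sigma> (X n))\<^sup>2 * v n \<and>
     tcum3 (G 1 (X n)) = \<sigma> (X n) ^ 3 * (M 3 n / M 0 n - 3 * \<mu> n * (M 2 n / M 0 n) + 2 * \<mu> n ^ 3)) sequentially"
  using eventually_saddle
proof eventually_elim
  case (elim n)
  let ?s = "\<sigma> (X n)" and ?t = "G 1 (X n)"
  let ?K = "exp (?t * X n - g (X n))"
  note tm = tilted_moment_saddle[of "X n", folded M_def]
  have P: "\<Phi> ?t = ?s * ?K * M 0 n" using tm[of 0] elim unfolding tilted_moment_0 by simp
  have ne: "?s * ?K \<noteq> 0" using elim by simp
  have b: "tilted_moment p (X n) k ?t / \<Phi> ?t = ?s ^ k * (M k n / M 0 n)" for k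
    unfolding P using tm[of k] elim by simp
  have "tmean ?t = X n + ?s * \<mu> n"
    using cumulants_recentre(1)[of ?t "X n"] unfolding b by (simp add: \<mu>_def)
  moreover have "tvar ?t = ?s\<^sup>2 * v n"
    using cumulants_recentre(2)[of ?t "X n"] unfolding b by (simp add: \<mu>_def v_def power_mult_distrib power_divide right_diff_distrib)
  moreover have "tcum3 ?t = ?s ^ 3 * (M 3 n / M 0 n - 3 * \<mu> n * (M 2 n / M 0 n) + 2 * \<mu> n ^ 3)"
    using cumulants_recentre(3)[of ?t "X n"] unfolding b
    by (simp add: \<mu>_def power_mult_distrib algebra_simps power2_eq_square power3_eq_cube)
  ultimately show ?case using P by blast
qed

lemma tsd_saddle: "eventually (\<lambda>n. tsd (G 1 (X n)) = \<sigma> (X n) * sqrt (v n)) sequentially"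
  using cumulants_saddle eventually_saddle
  by eventually_elim (simp add: tsd_def real_sqrt_mult)

lemma tmean_saddle_lim: "(\<lambda>n. tmean (G 1 (X n)) / X n) \<longlonglongrightarrow> 1"
proof -
  have "(\<lambda>n. 1 + \<sigma> (X n) / X n * \<mu> n) \<longlonglongrightarrow> 1 + 0 * 0"
    by (intro tendsto_intros \<mu>_lim filterlim_compose[OF \<sigma>_over_id X])
  moreover have "eventually (\<lambda>n. 1 + \<sigma> (X n) / X n * \<mu> n = tmean (G 1 (X n)) / X n) sequentially"
    using cumulants_saddle eventually_saddle by eventually_elim (simp add: add_divide_distrib)
  ultimately show ?thesis by (simp add: Lim_transform_eventually)
qed

lemma tcum3_saddle_lim: "(\<lambda>n. tcum3 (G 1 (X n)) / \<sigma> (X n) ^ 3) \<longlonglongrightarrow> 0"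
proof -
  have nz: "sqrt (2 * pi) \<noteq> 0" by simp
  have "(\<lambda>n. M 3 n / M 0 n - 3 * \<mu> n * (M 2 n / M 0 n) + 2 * \<mu> n ^ 3) \<longlonglongrightarrow> 0 / sqrt (2 * pi) - 3 * 0 * (sqrt (2 * pi) / sqrt (2 * pi)) + 2 * 0 ^ 3"
    using M_lim[of 3] M_lim[of 2] unfolding gaussian_integrals
    by (intro tendsto_intros \<mu>_lim M0_lim nz)
  moreover have "eventually (\<lambda>n. M 3 n / M 0 n - 3 * \<mu> n * (M 2 n / M 0 n) + 2 * \<mu> n ^ 3 = tcum3 (G 1 (X n)) / \<sigma> (X n) ^ 3) sequentially"
    using cumulants_saddle eventually_saddle by eventually_elim simp
  ultimately show ?thesis by (simp add: Lim_transform_eventually)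
qed

lemma std_tilt_saddle:
  "eventually (\<lambda>n. \<forall>z. std_tilt (G 1 (X n)) z = sqrt (v n) * w (X n) (\<mu> n + sqrt (v n) * z) / M 0 n) sequentially"
  using cumulants_saddle tsd_saddle eventually_saddle
proof eventually_elim
  case (elim n)
  show ?case
  proof
    fix z
    let ?s = "\<sigma> (X n)" and ?t = "G 1 (X n)" and ?u = "\<mu> n + sqrt (v n) * z"
    have a: "tmean ?t + tsd ?t * z = X n + ?s * ?u" using elim by (simp add: algebra_simps)
    have "exp (?t * (X n + ?s * ?u)) = exp (?t * X n - g (X n)) * exp (g (X n) + ?t * (?s * ?u))"
      by (simp add: algebra_simps flip: exp_add)
    then have "exp (?t * (X n + ?s * ?u)) * p (X n + ?s * ?u) = exp (?t * X n - g (X n)) * w (X n) ?u"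
      by (simp add: w_def)
    then show "std_tilt ?t z = sqrt (v n) * w (X n) ?u / M 0 n"
      unfolding std_tilt_def a using elim by simp
  qed
qed

text \<open>Passing from the saddle point and \<open>\<sigma>\<close> to the exact mean and deviation only replaces the argument \<open>z\<close>
  by \<open>\<mu> n + sqrt (v n) * z\<close>, which tends to \<open>z\<close>.\<close>
theorem std_tilt_lim: "(\<lambda>n. std_tilt (G 1 (X n)) z) \<longlonglongrightarrow> std_normal_density z"
proof -
  have s: "(\<lambda>n. sqrt (v n)) \<longlonglongrightarrow> 1" using tendsto_real_sqrt[OF v_lim] by simp
  have "(\<lambda>n. \<mu> n + sqrt (v n) * z) \<longlonglongrightarrow> 0 + 1 * z" by (intro tendsto_intros \<mu>_lim s)
  then have "(\<lambda>n. w (X n) (\<mu> n + sqrt (v n) * z)) \<longlonglongrightarrow> exp (- z\<^sup>2 / 2)" using w_lim by simp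
  then have "(\<lambda>n. sqrt (v n) * w (X n) (\<mu> n + sqrt (v n) * z) / M 0 n) \<longlonglongrightarrow> 1 * exp (- z\<^sup>2 / 2) / sqrt (2 * pi)"
    by (intro tendsto_intros s M0_lim) auto
  moreover have "eventually (\<lambda>n. sqrt (v n) * w (X n) (\<mu> n + sqrt (v n) * z) / M 0 n = std_tilt (G 1 (X n)) z) sequentially"
    using std_tilt_saddle by eventually_elim simp
  ultimately show ?thesis by (simp add: Lim_transform_eventually std_normal_density_def)
qed

theorem std_tilt_eventually_le: "eventually (\<lambda>n. \<forall>z. std_tilt (G 1 (X n)) z \<le> 2 * exp (Q + 1 / 4)) sequentially"
proof -
  have v4: "eventually (\<lambda>n. v n < 4) sequentially" using v_lim by (intro order_tendstoD(2)) auto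
  have "1 < sqrt (2 * pi)" using pi_gt3 by (simp add: real_less_rsqrt)
  then have m1: "eventually (\<lambda>n. 1 < M 0 n) sequentially" using M0_lim by (intro order_tendstoD(1))
  show ?thesis
    using std_tilt_saddle v4 m1 w_dominated
  proof eventually_elim
    case (elim n)
    show ?case
    proof
      fix z
      let ?w = "w (X n) (\<mu> n + sqrt (v n) * z)"
      have "?w \<le> exp (Q + 1 / 4) * exp (- \<bar>\<mu> n + sqrt (v n) * z\<bar> / 4)" using elim by blast
      also have "\<dots> \<le> exp (Q + 1 / 4) * 1" by (intro mult_left_mono) auto
      finally have we: "?w \<le> exp (Q + 1 / 4)" by simp
      have sv: "sqrt (v n) \<le> 2" using elim real_sqrt_less_mono[of "v n" 4] by simp
      have "std_tilt (G 1 (X n)) z = sqrt (v n) * ?w / M 0 n" using elim by blast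
      also have "\<dots> \<le> 2 * exp (Q + 1 / 4) / M 0 n"
        using elim we sv w_nonneg by (intro divide_right_mono mult_mono) auto
      also have "\<dots> \<le> 2 * exp (Q + 1 / 4)" using elim by (simp add: divide_le_eq mult_le_cancel_left1)
      finally show "std_tilt (G 1 (X n)) z \<le> 2 * exp (Q + 1 / 4)" .
    qed
  qed
qed

text \<open>Asymptotic normality alone makes the third cumulant \<open>o(\<sigma>\<^sup>3)\<close>.\<close>
lemma tcum3_over_mean_lim_if_sigma_cubed_small:
  assumes "((\<lambda>x. \<sigma> x ^ 3 / x) \<longlongrightarrow> 0) at_top"
  shows "(\<lambda>n. tcum3 (G 1 (X n)) / tmean (G 1 (X n))) \<longlonglongrightarrow> 0"
proof -
  have "(\<lambda>n. tcum3 (G 1 (X n)) / \<sigma> (X n) ^ 3 * (\<sigma> (X n) ^ 3 / X n) * (1 / (tmean (G 1 (X n)) / X n))) \<longlonglongrightarrow> 0 * 0 * (1 / 1)"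
    by (intro tendsto_intros tcum3_saddle_lim filterlim_compose[OF assms X] tmean_saddle_lim) simp
  moreover have "eventually (\<lambda>n. tcum3 (G 1 (X n)) / \<sigma> (X n) ^ 3 * (\<sigma> (X n) ^ 3 / X n) * (1 / (tmean (G 1 (X n)) / X n))
      = tcum3 (G 1 (X n)) / tmean (G 1 (X n))) sequentially"
    using eventually_saddle by eventually_elim simp
  ultimately show ?thesis by (simp add: Lim_transform_eventually)
qed

end

end

section \<open>The third cumulant when odd moments must cancel\<close>

lemma abs_exp_minus_diff_le:
  fixes a b :: real
  assumes "exp (- a) \<le> D" "exp (- b) \<le> D"
  shows "\<bar>exp (- a) - exp (- b)\<bar> \<le> D * \<bar>a - b\<bar>"
proof -
  have *: "\<bar>exp (- u) - exp (- v)\<bar> \<le> exp (- u) * \<bar>u - v\<bar>" if "u \<le> v" for u v :: real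
  proof -
    have "1 - exp (u - v) \<le> v - u" using exp_ge_add_one_self[of "u - v"] by linarith
    then have "exp (- u) * (1 - exp (u - v)) \<le> exp (- u) * (v - u)" by (rule mult_left_mono) simp
    then show ?thesis using that by (simp add: algebra_simps flip: exp_add)
  qed
  show ?thesis
  proof (cases "a \<le> b")
    case True
    show ?thesis using *[OF True] mult_right_mono[OF assms(1), of "\<bar>a - b\<bar>"] by linarith
  next
    case False
    then have "\<bar>exp (- b) - exp (- a)\<bar> \<le> exp (- b) * \<bar>b - a\<bar>" by (intro *) simp
    then show ?thesis using mult_right_mono[OF assms(2), of "\<bar>a - b\<bar>"]
      unfolding abs_minus_commute[of b a] abs_minus_commute[of "exp (- b)"] by linarith
  qed
qed

context gaussian_regime
begin

context
  fixes X :: "nat \<Rightarrow> real"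
  assumes X: "filterlim X at_top sequentially"
begin

text \<open>The rate \<open>x\<^bsup>-1/2\<^esup>\<close> for \<open>w x z\<close>.  As long as \<open>\<bar>z\<bar> \<le> sqrt x / 2\<close>, the point \<open>x + \<sigma> x * z\<close> lies between \<open>x / 2\<close>
  and \<open>2 * x\<close>, so that the cubic Taylor remainder of \<open>\<kappa> x z\<close> and the value of \<open>q\<close> are both \<open>O(x\<^bsup>-1/2\<^esup>)\<close>.
  For larger \<open>\<bar>z\<bar>\<close> the factor \<open>sqrt x\<close> is itself at most \<open>2 * \<bar>z\<bar>\<close>.\<close>
lemma w_minus_gaussian:
  assumes R1: "((\<lambda>x. (\<sigma> x)\<^sup>2 / x) \<longlongrightarrow> 0) at_top"
    and R2: "eventually (\<lambda>x. \<forall>y. x / 2 \<le> y \<and> y \<le> 2 * x \<longrightarrow> \<bar>G 3 y\<bar> * \<sigma> x ^ 3 \<le> C / sqrt x) at_top"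
    and R3: "eventually (\<lambda>x. sqrt x * \<bar>q x\<bar> \<le> C') at_top"
  obtains D where "eventually (\<lambda>n. \<forall>z. sqrt (X n) * \<bar>w (X n) z - exp (- z\<^sup>2 / 2)\<bar> \<le> D * ((1 + \<bar>z\<bar> ^ 3) * exp (- \<bar>z\<bar> / 4))) sequentially"
proof -
  define d where "d = exp (Q + 1 / 4)"
  have d0: "d > 0" by (simp add: d_def)
  have gd: "exp (- (z\<^sup>2 / 2)) \<le> d * exp (- \<bar>z\<bar> / 4)" for z :: real
  proof -
    have "0 \<le> (\<bar>z\<bar> - 1 / 4)\<^sup>2" by simp
    then have "\<bar>z\<bar> / 4 \<le> z\<^sup>2 / 2 + 1 / 32" by (simp add: power2_diff power_divide)
    then have "- (z\<^sup>2 / 2) \<le> Q + 1 / 4 + (- \<bar>z\<bar> / 4)" using Q_nonneg by linarith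
    then show ?thesis unfolding d_def by (simp flip: exp_add)
  qed
  from R3 obtain a where a: "\<And>x. x \<ge> a \<Longrightarrow> sqrt x * \<bar>q x\<bar> \<le> C'" by (auto simp: eventually_at_top_linorder)
  have s1: "eventually (\<lambda>n. (\<sigma> (X n))\<^sup>2 / X n < 1) sequentially"
    using filterlim_compose[OF R1 X] by (intro order_tendstoD(2)) auto
  have c2: "eventually (\<lambda>n. \<forall>y. X n / 2 \<le> y \<and> y \<le> 2 * X n \<longrightarrow> \<bar>G 3 y\<bar> * \<sigma> (X n) ^ 3 \<le> C / sqrt (X n)) sequentially"
    using eventually_compose_filterlim[OF R2 X] .
  define D where "D = d * (\<bar>C\<bar> + 2 * \<bar>C'\<bar> + 4)"
  have "eventually (\<lambda>n. \<forall>z. sqrt (X n) * \<bar>w (X n) z - exp (- z\<^sup>2 / 2)\<bar> \<le> D * ((1 + \<bar>z\<bar> ^ 3) * exp (- \<bar>z\<bar> / 4))) sequentially"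
    using eventually_saddle[OF X] s1 c2 w_dominated[OF X] filterlim_at_top[THEN iffD1, OF X, rule_format, of "2 * \<bar>a\<bar>"]
  proof eventually_elim
    case (elim n)
    let ?x = "X n" and ?s = "\<sigma> (X n)"
    have x: "?x > 0" and G2: "G 2 ?x > 0" and s: "?s > 0" using elim by auto
    have rx: "sqrt ?x > 0" using x by simp
    have ss: "?s\<^sup>2 = 1 / G 2 ?x" using G2 by (simp add: \<sigma>_def power_divide)
    have "?s\<^sup>2 < ?x" using elim x by (simp add: field_simps)
    then have sx: "?s \<le> sqrt ?x" by (simp add: real_le_rsqrt)
    show ?case
    proof
      fix z :: real
      let ?e = "exp (- \<bar>z\<bar> / 4)"
      have e0: "?e > 0" by simp
      have wd: "w ?x z \<le> d * ?e" using elim unfolding d_def by blast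
      have z3: "\<bar>z\<bar> \<le> 1 + \<bar>z\<bar> ^ 3"
      proof (cases "\<bar>z\<bar> \<le> 1")
        case True then show ?thesis by (simp add: add_increasing2)
      next
        case False
        then have "\<bar>z\<bar> ^ 1 \<le> \<bar>z\<bar> ^ 3" by (intro power_increasing) auto
        then show ?thesis by simp
      qed
      show "sqrt ?x * \<bar>w ?x z - exp (- z\<^sup>2 / 2)\<bar> \<le> D * ((1 + \<bar>z\<bar> ^ 3) * ?e)"
      proof (cases "\<bar>z\<bar> \<le> sqrt ?x / 2")
        case True
        have "\<bar>?s * z\<bar> \<le> sqrt ?x * (sqrt ?x / 2)" unfolding abs_mult using s True sx x by (intro mult_mono) auto
        then have u: "\<bar>?s * z\<bar> \<le> ?x / 2" using x by simp
        let ?y = "?x + ?s * z"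
        have y: "?x / 2 \<le> ?y" "?y > 0" using u x by linarith+
        obtain \<xi> where \<xi>: "\<bar>\<xi>\<bar> \<le> \<bar>?s * z\<bar>"
            "g ?y = (\<Sum>m<3. G m ?x / fact m * (?s * z) ^ m) + G 3 (?x + \<xi>) / fact 3 * (?s * z) ^ 3"
          using taylor_potential[of 3 ?x "?s * z"] x y by auto
        have fact3: "fact 3 = (6 :: real)" by (simp add: fact_numeral)
        have "\<kappa> ?x z = G 2 ?x / 2 * (?s * z)\<^sup>2 + G 3 (?x + \<xi>) / 6 * (?s * z) ^ 3"
          unfolding \<kappa>_def \<xi>(2) fact3 by (simp add: numeral_3_eq_3 numeral_2_eq_2 G_0)
        also have "G 2 ?x / 2 * (?s * z)\<^sup>2 = z\<^sup>2 / 2" using G2 by (simp add: power_mult_distrib ss)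
        finally have "\<bar>\<kappa> ?x z - z\<^sup>2 / 2\<bar> = \<bar>G 3 (?x + \<xi>)\<bar> * ?s ^ 3 * \<bar>z\<bar> ^ 3 / 6"
          using s by (simp add: abs_mult power_mult_distrib power_abs)
        also have "\<dots> \<le> (C / sqrt ?x) * \<bar>z\<bar> ^ 3 / 6"
        proof -
          have "?x / 2 \<le> ?x + \<xi>" "?x + \<xi> \<le> 2 * ?x" using \<xi>(1) u x by linarith+
          then show ?thesis using elim by (intro divide_right_mono mult_right_mono) auto
        qed
        also have "\<dots> \<le> (\<bar>C\<bar> / sqrt ?x) * \<bar>z\<bar> ^ 3"
        proof -
          have "C / sqrt ?x \<le> \<bar>C\<bar> / sqrt ?x" using rx by (intro divide_right_mono) auto
          then have "(C / sqrt ?x) * \<bar>z\<bar> ^ 3 \<le> (\<bar>C\<bar> / sqrt ?x) * \<bar>z\<bar> ^ 3" by (rule mult_right_mono) simp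
          moreover have "0 \<le> (\<bar>C\<bar> / sqrt ?x) * \<bar>z\<bar> ^ 3" using rx by simp
          moreover have "t / 6 \<le> u" if "t \<le> u" "0 \<le> u" for t u :: real using that by simp
          ultimately show ?thesis by blast
        qed
        finally have k: "\<bar>\<kappa> ?x z - z\<^sup>2 / 2\<bar> \<le> (\<bar>C\<bar> / sqrt ?x) * \<bar>z\<bar> ^ 3" .
        have qy: "sqrt ?x * \<bar>q ?y\<bar> \<le> 2 * \<bar>C'\<bar>"
        proof -
          have "?y \<ge> a" using y elim by linarith
          have "u \<le> 4 * v" if "u / 2 \<le> v" "0 < v" for u v :: real using that by simp
          from this[OF y] have "?x \<le> 4 * ?y" .
          then have "sqrt ?x \<le> sqrt (4 * ?y)" by (rule real_sqrt_le_mono)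
          then have "sqrt ?x \<le> 2 * sqrt ?y" by (simp only: real_sqrt_mult real_sqrt_four)
          then have "sqrt ?x * \<bar>q ?y\<bar> \<le> 2 * sqrt ?y * \<bar>q ?y\<bar>" by (rule mult_right_mono) simp
          then show ?thesis using a[OF \<open>?y \<ge> a\<close>] by linarith
        qed
        have weq: "w ?x z = exp (- (\<kappa> ?x z - q ?y))" using y by (simp add: w_eq)
        have "\<bar>w ?x z - exp (- (z\<^sup>2 / 2))\<bar> \<le> d * ?e * \<bar>(\<kappa> ?x z - q ?y) - z\<^sup>2 / 2\<bar>"
          unfolding weq by (rule abs_exp_minus_diff_le[OF wd[unfolded weq] gd])
        also have "\<dots> \<le> d * ?e * ((\<bar>C\<bar> / sqrt ?x) * \<bar>z\<bar> ^ 3 + \<bar>q ?y\<bar>)"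
          using k d0 by (intro mult_left_mono) auto
        finally have "sqrt ?x * \<bar>w ?x z - exp (- (z\<^sup>2 / 2))\<bar> \<le> sqrt ?x * (d * ?e * ((\<bar>C\<bar> / sqrt ?x) * \<bar>z\<bar> ^ 3 + \<bar>q ?y\<bar>))"
          using rx by (intro mult_left_mono) auto
        also have "\<dots> = d * ?e * (\<bar>C\<bar> * \<bar>z\<bar> ^ 3 + sqrt ?x * \<bar>q ?y\<bar>)" using rx by (simp add: field_simps)
        also have "\<dots> \<le> d * ?e * ((\<bar>C\<bar> + 2 * \<bar>C'\<bar> + 4) * (1 + \<bar>z\<bar> ^ 3))"
        proof -
          have "0 \<le> \<bar>C'\<bar> * \<bar>z\<bar> ^ 3" "0 \<le> \<bar>z\<bar> ^ 3" "0 \<le> \<bar>C\<bar>" by simp_all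
          moreover have "(\<bar>C\<bar> + 2 * \<bar>C'\<bar> + 4) * (1 + \<bar>z\<bar> ^ 3)
              = \<bar>C\<bar> * \<bar>z\<bar> ^ 3 + (\<bar>C\<bar> + 2 * \<bar>C'\<bar> + 4 + 2 * (\<bar>C'\<bar> * \<bar>z\<bar> ^ 3) + 4 * \<bar>z\<bar> ^ 3)"
            by (simp add: algebra_simps)
          ultimately have "\<bar>C\<bar> * \<bar>z\<bar> ^ 3 + sqrt ?x * \<bar>q ?y\<bar> \<le> (\<bar>C\<bar> + 2 * \<bar>C'\<bar> + 4) * (1 + \<bar>z\<bar> ^ 3)"
            using qy by linarith
          then show ?thesis using d0 by (intro mult_left_mono) auto
        qed
        also have "\<dots> = D * ((1 + \<bar>z\<bar> ^ 3) * ?e)" by (simp add: D_def mult_ac)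
        finally show ?thesis by simp
      next
        case False
        then have sz: "sqrt ?x \<le> 2 * \<bar>z\<bar>" by linarith
        have "\<bar>w ?x z - exp (- z\<^sup>2 / 2)\<bar> \<le> 2 * (d * ?e)"
        proof -
          have "exp (- z\<^sup>2 / 2) \<le> d * ?e" "0 \<le> exp (- z\<^sup>2 / 2)" using gd[of z] by simp_all
          then show ?thesis using wd w_nonneg[of ?x z] by linarith
        qed
        then have "sqrt ?x * \<bar>w ?x z - exp (- z\<^sup>2 / 2)\<bar> \<le> (2 * \<bar>z\<bar>) * (2 * (d * ?e))"
          using sz rx by (intro mult_mono) auto
        also have "\<dots> = 4 * (d * ?e) * \<bar>z\<bar>" by simp
        also have "\<dots> \<le> 4 * (d * ?e) * (1 + \<bar>z\<bar> ^ 3)" using d0 z3 by (intro mult_left_mono) auto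
        also have "\<dots> \<le> (\<bar>C\<bar> + 2 * \<bar>C'\<bar> + 4) * (d * ?e) * (1 + \<bar>z\<bar> ^ 3)"
          using d0 by (intro mult_right_mono) auto
        also have "\<dots> = D * ((1 + \<bar>z\<bar> ^ 3) * ?e)" by (simp add: D_def mult_ac)
        finally show ?thesis .
      qed
    qed
  qed
  then show ?thesis by (rule that)
qed

text \<open>Subtracting a vanishing normal moment leaves only the error of \<open>w\<close>.\<close>
lemma odd_moment_bound:
  assumes D: "eventually (\<lambda>n. \<forall>z. sqrt (X n) * \<bar>w (X n) z - exp (- z\<^sup>2 / 2)\<bar> \<le> D * ((1 + \<bar>z\<bar> ^ 3) * exp (- \<bar>z\<bar> / 4))) sequentially"
    and k: "(LBINT z. (z::real) ^ k * exp (- z\<^sup>2 / 2)) = 0"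
  shows "\<exists>K. eventually (\<lambda>n. \<bar>sqrt (X n) * M X k n\<bar> \<le> K) sequentially"
proof -
  let ?b = "\<lambda>z::real. D * (\<bar>z\<bar> ^ k * exp (- \<bar>z\<bar> / 4) + \<bar>z\<bar> ^ (k + 3) * exp (- \<bar>z\<bar> / 4))"
  have bi: "integrable lborel ?b"
    by (intro integrable_mult_right Bochner_Integration.integrable_add integrable_power_exp_abs)
  have gi: "integrable lborel (\<lambda>z::real. z ^ k * exp (- z\<^sup>2 / 2))"
  proof -
    have "z ^ k * exp (- z\<^sup>2 / 2) = sqrt (2 * pi) * (std_normal_density z * z ^ k)" for z :: real
      by (simp add: std_normal_density_def)
    then show ?thesis by (simp only: integrable_mult_right integrable_std_normal_moment)
  qed
  have ei: "integrable lborel (\<lambda>z. exp (Q + 1 / 4) * (\<bar>z\<bar> ^ k * exp (- \<bar>z\<bar> / 4)))"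
    by (intro integrable_mult_right integrable_power_exp_abs)
  have "eventually (\<lambda>n. \<bar>sqrt (X n) * M X k n\<bar> \<le> (LBINT z. ?b z)) sequentially"
    using D power_w_dominated[OF X, of k] eventually_saddle[OF X]
  proof eventually_elim
    case (elim n)
    have wi: "integrable lborel (\<lambda>z. z ^ k * w (X n) z)"
      by (rule Bochner_Integration.integrable_bound[OF ei]) (use elim in \<open>auto intro: order_trans[OF _ abs_ge_self]\<close>)
    have "sqrt (X n) * M X k n = sqrt (X n) * (LBINT z. z ^ k * w (X n) z - z ^ k * exp (- z\<^sup>2 / 2))"
      unfolding Bochner_Integration.integral_diff[OF wi gi] k M_def[OF X] by simp
    also have "\<dots> = (LBINT z. sqrt (X n) * (z ^ k * (w (X n) z - exp (- z\<^sup>2 / 2))))"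
      by (subst integral_mult_right_zero) (simp only: right_diff_distrib)
    finally have "\<bar>sqrt (X n) * M X k n\<bar> = \<bar>\<integral>z. sqrt (X n) * (z ^ k * (w (X n) z - exp (- z\<^sup>2 / 2))) \<partial>lborel\<bar>" by (rule arg_cong)
    also have "\<dots> \<le> (LBINT z. \<bar>sqrt (X n) * (z ^ k * (w (X n) z - exp (- z\<^sup>2 / 2)))\<bar>)"
      by (rule integral_abs_bound)
    also have "\<dots> \<le> (LBINT z. ?b z)"
    proof (rule integral_mono'[OF bi])
      fix z
      have "\<bar>z\<bar> ^ k * (sqrt (X n) * \<bar>w (X n) z - exp (- z\<^sup>2 / 2)\<bar>) \<le> \<bar>z\<bar> ^ k * (D * ((1 + \<bar>z\<bar> ^ 3) * exp (- \<bar>z\<bar> / 4)))"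
        using elim by (intro mult_left_mono) auto
      also have "\<dots> = ?b z" by (simp add: algebra_simps power_add)
      finally show "\<bar>sqrt (X n) * (z ^ k * (w (X n) z - exp (- z\<^sup>2 / 2)))\<bar> \<le> ?b z"
        using elim by (simp add: abs_mult power_abs mult_ac)
      then show "0 \<le> ?b z" by (rule order_trans[OF abs_ge_zero])
    qed
    finally show ?case .
  qed
  then show ?thesis by blast
qed

text \<open>If \<open>g'\<close> grows like \<open>x\<^sup>\<beta>\<close> with \<open>\<beta> < 1 / 3\<close>, then \<open>\<sigma>\<^sup>3\<close> is not \<open>O(x)\<close> and the bound \<open>o(\<sigma>\<^sup>3)\<close> for the
  third cumulant is too weak.  Each term of that cumulant contains an odd moment, which contributes a
  further factor \<open>O(x\<^bsup>-1/2\<^esup>)\<close>; what remains after division by \<open>x\<close> is \<open>r\<^sup>3 = (\<sigma>\<^sup>2 / x)\<^bsup>3/2\<^esup>\<close>.\<close>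
lemma tcum3_over_mean_lim_by_cancellation:
  assumes R1: "((\<lambda>x. (\<sigma> x)\<^sup>2 / x) \<longlongrightarrow> 0) at_top"
    and R2: "eventually (\<lambda>x. \<forall>y. x / 2 \<le> y \<and> y \<le> 2 * x \<longrightarrow> \<bar>G 3 y\<bar> * \<sigma> x ^ 3 \<le> C / sqrt x) at_top"
    and R3: "eventually (\<lambda>x. sqrt x * \<bar>q x\<bar> \<le> C') at_top"
  shows "(\<lambda>n. tcum3 (G 1 (X n)) / tmean (G 1 (X n))) \<longlonglongrightarrow> 0"
proof -
  obtain D where D: "eventually (\<lambda>n. \<forall>z. sqrt (X n) * \<bar>w (X n) z - exp (- z\<^sup>2 / 2)\<bar> \<le> D * ((1 + \<bar>z\<bar> ^ 3) * exp (- \<bar>z\<bar> / 4))) sequentially"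
    using w_minus_gaussian[OF R1 R2 R3] .
  note gi = gaussian_integrals[OF X]
  obtain K1 where K1: "eventually (\<lambda>n. \<bar>sqrt (X n) * M X 1 n\<bar> \<le> K1) sequentially"
    using odd_moment_bound[OF D gi(2)] by blast
  obtain K3 where K3: "eventually (\<lambda>n. \<bar>sqrt (X n) * M X 3 n\<bar> \<le> K3) sequentially"
    using odd_moment_bound[OF D gi(4)] by blast
  define r where "r n = sqrt ((\<sigma> (X n))\<^sup>2 / X n)" for n
  have r0: "r \<longlonglongrightarrow> 0" unfolding r_def[abs_def] using tendsto_real_sqrt[OF filterlim_compose[OF R1 X]] by simp
  have m: "M X 0 \<longlonglongrightarrow> sqrt (2 * pi)" by (rule M0_lim[OF X])
  have nz: "sqrt (2 * pi) \<noteq> 0" by simp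
  have bnd0: "(\<lambda>n. r n ^ 3 * (sqrt (X n) * M X k n)) \<longlonglongrightarrow> 0"
    if "eventually (\<lambda>n. \<bar>sqrt (X n) * M X k n\<bar> \<le> K) sequentially" for k K
  proof (rule Lim_null_comparison)
    show "eventually (\<lambda>n. norm (r n ^ 3 * (sqrt (X n) * M X k n)) \<le> \<bar>r n\<bar> ^ 3 * K) sequentially"
      using that
    proof eventually_elim
      case (elim n)
      have "\<bar>r n\<bar> ^ 3 * \<bar>sqrt (X n) * M X k n\<bar> \<le> \<bar>r n\<bar> ^ 3 * K" by (rule mult_left_mono[OF elim]) simp
      then show ?case by (simp only: real_norm_def abs_mult[of "r n ^ 3"] power_abs)
    qed
    have "(\<lambda>n. \<bar>r n\<bar> ^ 3 * K) \<longlonglongrightarrow> \<bar>0\<bar> ^ 3 * K" by (intro tendsto_intros r0)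
    then show "(\<lambda>n. \<bar>r n\<bar> ^ 3 * K) \<longlonglongrightarrow> 0" by simp
  qed
  let ?A = "\<lambda>n. (r n ^ 3 * (sqrt (X n) * M X 3 n) / M X 0 n
      - 3 * (r n ^ 3 * (sqrt (X n) * M X 1 n) / M X 0 n) * (M X 2 n / M X 0 n)
      + 2 * (r n ^ 3 * (sqrt (X n) * M X 1 n) / M X 0 n) * (\<mu> X n)\<^sup>2) * (1 / (tmean (G 1 (X n)) / X n))"
  have "?A \<longlonglongrightarrow> (0 / sqrt (2 * pi) - 3 * (0 / sqrt (2 * pi)) * (sqrt (2 * pi) / sqrt (2 * pi)) + 2 * (0 / sqrt (2 * pi)) * 0\<^sup>2) * (1 / 1)"
    using M_lim[OF X, of 2] unfolding gi
    by (intro tendsto_intros bnd0[OF K3] bnd0[OF K1] m nz \<mu>_lim[OF X] tmean_saddle_lim[OF X]) auto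
  moreover have "eventually (\<lambda>n. ?A n = tcum3 (G 1 (X n)) / tmean (G 1 (X n))) sequentially"
    using cumulants_saddle[OF X] eventually_saddle[OF X]
  proof eventually_elim
    case (elim n)
    let ?x = "X n"
    have "sqrt ?x ^ 3 = ?x * sqrt ?x" using elim by (simp add: power3_eq_cube)
    then have rr: "r n ^ 3 * sqrt ?x = \<sigma> ?x ^ 3 / ?x"
      using elim unfolding r_def by (simp add: real_sqrt_divide power_divide)
    have t: "r n ^ 3 * (sqrt ?x * y) = \<sigma> ?x ^ 3 / ?x * y" for y using rr by (simp flip: mult.assoc)
    have "?A n = (\<sigma> ?x ^ 3 / ?x * (M X 3 n / M X 0 n - 3 * \<mu> X n * (M X 2 n / M X 0 n) + 2 * \<mu> X n ^ 3)) * (1 / (tmean (G 1 ?x) / ?x))"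
      unfolding t by (simp add: \<mu>_def[OF X] algebra_simps power2_eq_square power3_eq_cube)
    also have "\<dots> = tcum3 (G 1 ?x) / tmean (G 1 ?x)" using elim by simp
    finally show ?case .
  qed
  ultimately show ?thesis by (simp add: Lim_transform_eventually)
qed

end

end

section \<open>Regularly and rapidly varying potentials\<close>

text \<open>The inequality \<open>f (2 * x) \<le> r * f x\<close> holds for all large \<open>x\<close> at once.  Starting from a bounded stretch
  \<open>{a..2 * a}\<close>, iteration gives \<open>f x \<le> r ^ k * K\<close> beyond \<open>2 ^ k * a\<close>.  For a regularly varying function of
  negative index this takes the place of the uniform convergence theorem.\<close>
lemma tendsto_0_of_geometric_decay:
  fixes f :: "real \<Rightarrow> real"
  assumes pos: "eventually (\<lambda>x. 0 < f x) at_top"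
    and ratio: "((\<lambda>x. f (2 * x) / f x) \<longlongrightarrow> \<rho>) at_top" and \<rho>: "\<rho> < 1"
    and bdd: "eventually (\<lambda>a. \<exists>K. \<forall>x\<in>{a..2 * a}. f x \<le> K) at_top"
  shows "(f \<longlongrightarrow> 0) at_top"
proof -
  obtain r where r: "max \<rho> 0 < r" "r < 1" using \<rho> dense[of "max \<rho> 0" 1] by auto
  have "eventually (\<lambda>x. f (2 * x) / f x < r) at_top" using r by (intro order_tendstoD(2)[OF ratio]) auto
  with pos have "eventually (\<lambda>x. 0 < f x \<and> f (2 * x) \<le> r * f x) at_top"
    by eventually_elim (auto simp: field_simps)
  then obtain b where b: "\<And>x. x \<ge> b \<Longrightarrow> 0 < f x" "\<And>x. x \<ge> b \<Longrightarrow> f (2 * x) \<le> r * f x" by (auto simp: eventually_at_top_linorder)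
  have "eventually (\<lambda>a. b \<le> a \<and> 1 \<le> a \<and> (\<exists>K. \<forall>x\<in>{a..2 * a}. f x \<le> K)) at_top"
    using bdd eventually_ge_at_top[of b] eventually_ge_at_top[of 1] by eventually_elim blast
  then have "\<exists>a. b \<le> a \<and> 1 \<le> a \<and> (\<exists>K. \<forall>x\<in>{a..2 * a}. f x \<le> K)"
    by (rule eventually_happens'[rotated]) simp
  then obtain a K where a: "a \<ge> b" "a \<ge> 1" and K: "\<And>x. a \<le> x \<Longrightarrow> x \<le> 2 * a \<Longrightarrow> f x \<le> K"
    by (meson atLeastAtMost_iff)
  have base: "a \<le> x \<Longrightarrow> x \<le> 2 ^ Suc k * a \<Longrightarrow> f x \<le> K" for x k
  proof (induction k arbitrary: x)
    case 0 then show ?case using K by simp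
  next
    case (Suc k)
    show ?case
    proof (cases "x \<le> 2 * a")
      case True then show ?thesis using K Suc by simp
    next
      case False
      then have "f (x / 2) \<le> K" using Suc by (intro Suc.IH) auto
      moreover have "f (2 * (x / 2)) \<le> r * f (x / 2)" using False a by (intro b) auto
      moreover have "r * f (x / 2) \<le> 1 * f (x / 2)" using r b(1)[of "x/2"] False a by (intro mult_right_mono) auto
      ultimately show ?thesis by simp
    qed
  qed
  have glob: "f x \<le> K" if "x \<ge> a" for x
  proof -
    obtain k where "x / a < 2 ^ k" using real_arch_pow[of 2 "x / a"] by auto
    then have "x \<le> 2 ^ Suc k * a" using a that by (simp add: field_simps)
    then show ?thesis using base that by blast
  qed
  have dec: "x \<ge> 2 ^ k * a \<Longrightarrow> f x \<le> r ^ k * K" for x k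
  proof (induction k arbitrary: x)
    case 0 then show ?case using glob by simp
  next
    case (Suc k)
    have "2 ^ k * a \<ge> 1 * a" using a by (intro mult_right_mono) auto
    then have xa: "x / 2 \<ge> a" "x / 2 \<ge> 2 ^ k * a" using Suc.prems by auto
    have "f (2 * (x / 2)) \<le> r * f (x / 2)" using xa a by (intro b) auto
    also have "\<dots> \<le> r * (r ^ k * K)" using Suc.IH[OF xa(2)] r by (intro mult_left_mono) auto
    finally show ?case by simp
  qed
  show ?thesis
  proof (rule tendstoI)
    fix e :: real assume e: "e > 0"
    have "(\<lambda>k. r ^ k * K) \<longlonglongrightarrow> 0 * K" using r by (intro tendsto_intros LIMSEQ_power_zero) auto
    then have "eventually (\<lambda>k. r ^ k * K < e) sequentially" using e by (intro order_tendstoD(2)) auto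
    then obtain k where k: "r ^ k * K < e" by (auto simp: eventually_sequentially)
    show "eventually (\<lambda>x. dist (f x) 0 < e) at_top"
      using eventually_ge_at_top[of "2 ^ k * a"] pos
    proof eventually_elim
      case (elim x)
      then show ?case using dec[of k x] k by simp
    qed
  qed
qed

lemma derivs_on_DERIV:
  assumes "derivs_on {1..} 2 E" "i < 2" "x > 1"
  shows "(E i has_real_derivative E (Suc i) x) (at x)"
proof -
  have "(E i has_real_derivative E (Suc i) x) (at x within {1..})" using assms unfolding derivs_on_def by auto
  moreover have "at x within {1..} = at x" using assms(3) by (intro at_within_interior) simp
  ultimately show ?thesis by simp
qed

lemma karamata_integral_DERIV:
  assumes E: "derivs_on {1..} 2 E" and x: "x > 1"
  shows "((\<lambda>x. integral {1..x} (\<lambda>u. E 0 u / u)) has_real_derivative E 0 x / x) (at x)"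
proof -
  have "continuous_on {1..} (E 0)"
    using E unfolding derivs_on_def continuous_on_eq_continuous_within
    by (metis DERIV_continuous zero_less_numeral)
  then have "continuous_on {1..x + 1} (\<lambda>u. E 0 u / u)"
    by (intro continuous_intros) (auto intro: continuous_on_subset)
  from integral_has_real_derivative[OF this, of x] x
  have "((\<lambda>x. integral {1..x} (\<lambda>u. E 0 u / u)) has_real_derivative E 0 x / x) (at x within {1..x + 1})" by simp
  moreover have "at x within {1..x + 1} = at x" using x by (intro at_within_interior) simp
  ultimately show ?thesis by simp
qed

context convex_potential
begin

lemma G2_nonneg: "x > 0 \<Longrightarrow> 0 \<le> G 2 x"
proof (rule ccontr)
  assume x: "x > 0" "\<not> 0 \<le> G 2 x"
  have "(G 1 has_real_derivative G 2 x) (at x)" using G_DERIV[of 1 x] x by (simp add: numeral_2_eq_2)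
  from DERIV_neg_dec_right[OF this] x obtain d where d: "d > 0" "\<And>h. 0 < h \<Longrightarrow> h < d \<Longrightarrow> G 1 (x + h) < G 1 x" by auto
  from d(2)[of "d / 2"] G1_mono[of x "x + d / 2"] x d(1) show False by simp
qed

text \<open>Differentiating the Karamata representation gives \<open>G 2 x = G 1 x * (\<beta>0 + E 0 x) / x\<close> and shows that
  \<open>G 3 x\<close> is \<open>G 1 x / x\<^sup>2\<close> times a bounded function.  So \<open>\<sigma>\<^sup>2 / x\<close> is of order \<open>1 / G 1 x\<close>, and
  \<open>\<bar>G 3 y\<bar> * \<sigma> x ^ 3\<close> is of order \<open>1 / sqrt (x * G 1 x)\<close> for \<open>y\<close> comparable to \<open>x\<close>, because doubling the
  argument multiplies \<open>G 1\<close> by a bounded factor.  The condition on the index of \<open>q\<close> makes that index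
  smaller than \<open>- 1 / 2\<close>.\<close>
lemma regular_case_conditions:
  assumes "regular_case (G 1) (G 3) q"
  obtains C C' where "eventually (\<lambda>x. 0 < G 2 x) at_top"
    and "((\<lambda>x. (\<sigma> x)\<^sup>2 / x) \<longlongrightarrow> 0) at_top"
    and "eventually (\<lambda>x. \<forall>y. x / 2 \<le> y \<and> y \<le> 2 * x \<longrightarrow> \<bar>G 3 y\<bar> * \<sigma> x ^ 3 \<le> C / sqrt x) at_top"
    and "eventually (\<lambda>x. sqrt x * \<bar>q x\<bar> \<le> C') at_top"
proof -
  from assms obtain \<beta>0 \<theta> \<eta> c E where \<beta>0: "\<beta>0 > 0" and c: "c > 0"
    and rep: "eventually (\<lambda>x. G 1 x = x powr \<beta>0 * (c * exp (integral {1..x} (\<lambda>u. E 0 u / u)))) at_top"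
    and E: "derivs_on {1..} 2 E" and E0: "(E 0 \<longlongrightarrow> 0) at_top"
    and E1: "(\<lambda>x. x * \<bar>E 1 x\<bar>) \<in> O[at_top](\<lambda>_. 1)"
    and \<theta>: "\<theta> \<le> \<beta>0 - 2" and \<eta>: "\<eta> < \<theta> - 3 * \<beta>0 / 2 - 3 / 2" and qrv: "regularly_varying (\<lambda>x. \<bar>q x\<bar>) \<eta>"
    unfolding regular_case_def by blast
  from E1 obtain K where K: "K > 0" "eventually (\<lambda>x. \<bar>x * \<bar>E 1 x\<bar>\<bar> \<le> K) at_top" by (elim landau_o.bigE) auto
  have "eventually (\<lambda>x. \<bar>E 0 x\<bar> < \<beta>0 / 2) at_top" using tendsto_rabs[OF E0] \<beta>0 by (intro order_tendstoD(2)) auto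
  moreover have "eventually (\<lambda>x. 1 \<le> G 1 x) at_top" using G1_at_top by (simp add: filterlim_at_top)
  ultimately have "eventually (\<lambda>x. x > 1 \<and> \<bar>E 0 x\<bar> < \<beta>0 / 2 \<and> 1 \<le> G 1 x \<and> \<bar>x * \<bar>E 1 x\<bar>\<bar> \<le> K \<and>
      G 1 x = x powr \<beta>0 * (c * exp (integral {1..x} (\<lambda>u. E 0 u / u)))) at_top"
    using rep K(2) eventually_gt_at_top[of 1] by eventually_elim auto
  then obtain a where a': "\<And>x. x \<ge> a \<Longrightarrow> x > 1 \<and> \<bar>E 0 x\<bar> < \<beta>0 / 2 \<and> 1 \<le> G 1 x \<and> \<bar>x * \<bar>E 1 x\<bar>\<bar> \<le> K \<and>
      G 1 x = x powr \<beta>0 * (c * exp (integral {1..x} (\<lambda>u. E 0 u / u)))" by (auto simp: eventually_at_top_linorder)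
  have a: "x > 1 \<and> \<bar>E 0 x\<bar> < \<beta>0 / 2 \<and> 1 \<le> G 1 x \<and> \<bar>x * \<bar>E 1 x\<bar>\<bar> \<le> K" if "x \<ge> a" for x
    using a'[OF that] by blast
  have arep: "x powr \<beta>0 * (c * exp (integral {1..x} (\<lambda>u. E 0 u / u))) = G 1 x" if "x \<ge> a" for x
    using a'[OF that] by simp
  have G2: "G 2 x = G 1 x * (\<beta>0 + E 0 x) / x" if x: "x > a" for x
  proof -
    have x1: "x > 1" using a x by auto
    have "((\<lambda>x. x powr \<beta>0 * (c * exp (integral {1..x} (\<lambda>u. E 0 u / u)))) has_real_derivative
        (x powr \<beta>0 * (c * exp (integral {1..x} (\<lambda>u. E 0 u / u)))) * (\<beta>0 + E 0 x) / x) (at x)"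
      using x1 by (auto intro!: derivative_eq_intros karamata_integral_DERIV[OF E x1] simp: field_simps powr_diff)
    then have "(G 1 has_real_derivative G 1 x * (\<beta>0 + E 0 x) / x) (at x)"
      unfolding arep[OF less_imp_le[OF x]]
      by (rule has_field_derivative_transform_within_open[where S = "{a<..}"]) (use x arep in auto)
    moreover have "(G 1 has_real_derivative G 2 x) (at x)" using G_DERIV[of 1 x] x1 by (simp add: numeral_2_eq_2)
    ultimately show ?thesis by (rule DERIV_unique[symmetric])
  qed
  have G3: "G 3 x = G 1 x / x\<^sup>2 * ((\<beta>0 + E 0 x)\<^sup>2 + x * E 1 x - (\<beta>0 + E 0 x))" if x: "x > a" for x
  proof -
    have x1: "x > 1" using a x by auto
    have e: "(E 0 has_real_derivative E 1 x) (at x)" using derivs_on_DERIV[OF E, of 0 x] x1 by simp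
    have g: "(G 1 has_real_derivative G 2 x) (at x)" using G_DERIV[of 1 x] x1 by (simp add: numeral_2_eq_2)
    have "((\<lambda>x. G 1 x * (\<beta>0 + E 0 x) / x) has_real_derivative
        G 1 x / x\<^sup>2 * ((\<beta>0 + E 0 x)\<^sup>2 + x * E 1 x - (\<beta>0 + E 0 x))) (at x)"
      using x1 by (auto intro!: derivative_eq_intros e g[unfolded One_nat_def] simp: G2[OF x] field_simps power2_eq_square)
    then have "(G 2 has_real_derivative G 1 x / x\<^sup>2 * ((\<beta>0 + E 0 x)\<^sup>2 + x * E 1 x - (\<beta>0 + E 0 x))) (at x)"
      by (rule has_field_derivative_transform_within_open[where S = "{a<..}"]) (use x G2 in auto)
    moreover have "(G 2 has_real_derivative G 3 x) (at x)" using G_DERIV[of 2 x] x1 by (simp add: numeral_3_eq_3 numeral_2_eq_2)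
    ultimately show ?thesis by (rule DERIV_unique[symmetric])
  qed
  define b where "b = \<beta>0 / 2"
  have b: "b > 0" using \<beta>0 by (simp add: b_def)
  have Eb: "b \<le> \<beta>0 + E 0 x" "\<beta>0 + E 0 x \<le> 3 * b" if "x > a" for x using a[of x] that by (auto simp: b_def)
  have G2b: "b * (G 1 x / x) \<le> G 2 x" if x: "x > a" for x
  proof -
    have "b * (G 1 x / x) \<le> (\<beta>0 + E 0 x) * (G 1 x / x)" using Eb[OF x] a[of x] x by (intro mult_right_mono) auto
    then show ?thesis unfolding G2[OF x] by (simp add: mult_ac)
  qed
  define K' where "K' = (3 * b)\<^sup>2 + K + 3 * b"
  have K'0: "K' > 0" using b K by (simp add: K'_def add_pos_pos)
  have G3b: "\<bar>G 3 x\<bar> \<le> K' * (G 1 x / x\<^sup>2)" if x: "x > a" for x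
  proof -
    have "(\<beta>0 + E 0 x)\<^sup>2 \<le> (3 * b)\<^sup>2" using Eb[OF x] b by (intro power_mono) auto
    moreover have "\<bar>x * E 1 x\<bar> \<le> K" using a[of x] x by (simp only: abs_mult abs_idempotent less_imp_le)
    moreover have "0 \<le> (\<beta>0 + E 0 x)\<^sup>2" by simp
    ultimately have "\<bar>(\<beta>0 + E 0 x)\<^sup>2 + x * E 1 x - (\<beta>0 + E 0 x)\<bar> \<le> K'"
      using Eb[OF x] b unfolding K'_def by linarith
    moreover have h: "0 \<le> G 1 x / x\<^sup>2" using a[of x] x by simp
    ultimately have "(G 1 x / x\<^sup>2) * \<bar>(\<beta>0 + E 0 x)\<^sup>2 + x * E 1 x - (\<beta>0 + E 0 x)\<bar> \<le> (G 1 x / x\<^sup>2) * K'"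
      by (rule mult_left_mono)
    then show ?thesis unfolding G3[OF x] abs_mult abs_of_nonneg[OF h] by (simp only: mult.commute)
  qed
  have dbl: "G 1 (2 * x) \<le> exp (3 * b) * G 1 x" if x: "x > a" for x
  proof -
    have x1: "x > 1" using a x by auto
    have d: "((\<lambda>y. ln (G 1 y)) has_real_derivative (\<beta>0 + E 0 y) / y) (at y)" if y: "y \<ge> x" for y
    proof -
      have g: "(G 1 has_real_derivative G 2 y) (at y)" using G_DERIV[of 1 y] x1 y by (simp add: numeral_2_eq_2)
      have "y > a" using x y by simp
      then have Gy: "G 1 y > 0" "y > 0" using a[of y] by auto
      have "((\<lambda>y. ln (G 1 y)) has_real_derivative 1 / G 1 y * G 2 y) (at y)"
        by (rule DERIV_chain2[OF DERIV_ln_divide[OF Gy(1)] g])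
      moreover have "1 / G 1 y * G 2 y = (\<beta>0 + E 0 y) / y" using Gy G2[OF \<open>y > a\<close>] by simp
      ultimately show ?thesis by simp
    qed
    obtain y where y: "x < y" "y < 2 * x" "ln (G 1 (2 * x)) - ln (G 1 x) = (2 * x - x) * ((\<beta>0 + E 0 y) / y)"
      using MVT2[of x "2 * x" "\<lambda>y. ln (G 1 y)" "\<lambda>y. (\<beta>0 + E 0 y) / y"] d x1 by auto
    have "x * ((\<beta>0 + E 0 y) / y) = (x / y) * (\<beta>0 + E 0 y)" by simp
    also have "\<dots> \<le> 1 * (3 * b)" using Eb[of y] y x x1 b by (intro mult_mono) auto
    finally have "ln (G 1 (2 * x)) \<le> 3 * b + ln (G 1 x)" using y(3) by simp
    then have "exp (ln (G 1 (2 * x))) \<le> exp (3 * b + ln (G 1 x))" by simp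
    then show ?thesis using a[of x] a[of "2 * x"] x x1 by (simp add: exp_add)
  qed
  have C1: "eventually (\<lambda>x. 0 < G 2 x) at_top"
    using eventually_gt_at_top[of a]
  proof eventually_elim
    case (elim x)
    have "0 < b * (G 1 x / x)" using b a[of x] elim by (auto intro!: mult_pos_pos divide_pos_pos)
    then show ?case using G2b[OF elim] by linarith
  qed
  have C2: "((\<lambda>x. (\<sigma> x)\<^sup>2 / x) \<longlongrightarrow> 0) at_top"
  proof (rule Lim_null_comparison)
    show "eventually (\<lambda>x. norm ((\<sigma> x)\<^sup>2 / x) \<le> (1 / b) * (1 / G 1 x)) at_top"
      using eventually_gt_at_top[of a] C1
    proof eventually_elim
      case (elim x)
      have p: "x > 0" "G 1 x > 0" using a[of x] elim by auto
      have "b * G 1 x \<le> G 2 x * x" using G2b[OF elim(1)] p by (simp add: field_simps)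
      moreover have "0 < b * G 1 x" using b p by simp
      ultimately have "1 / (G 2 x * x) \<le> 1 / (b * G 1 x)" by (intro divide_left_mono) auto
      then show ?case using elim p by (simp add: \<sigma>_def power_divide)
    qed
    have "((\<lambda>x. 1 / G 1 x) \<longlongrightarrow> 0) at_top" using tendsto_inverse_0_at_top[OF G1_at_top] by (simp add: inverse_eq_divide)
    then have "((\<lambda>x. (1 / b) * (1 / G 1 x)) \<longlongrightarrow> (1 / b) * 0) at_top" by (intro tendsto_mult tendsto_const)
    then show "((\<lambda>x. (1 / b) * (1 / G 1 x)) \<longlongrightarrow> 0) at_top" by (simp only: mult_zero_right)
  qed
  define C where "C = 4 * K' * exp (3 * b) / (b * sqrt b)"
  have C3: "eventually (\<lambda>x. \<forall>y. x / 2 \<le> y \<and> y \<le> 2 * x \<longrightarrow> \<bar>G 3 y\<bar> * \<sigma> x ^ 3 \<le> C / sqrt x) at_top"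
    using eventually_gt_at_top[of "2 * \<bar>a\<bar>"] C1
  proof eventually_elim
    case (elim x)
    have x: "x > a" "x > 1" "G 1 x \<ge> 1" using a[of x] elim by auto
    define h where "h = G 1 x / x"
    have h: "h > 0" using x by (simp add: h_def)
    have s3: "\<sigma> x ^ 3 \<le> 1 / (b * h * sqrt (b * h))"
    proof -
      have bh: "b * h \<le> G 2 x" using G2b[OF x(1)] by (simp add: h_def)
      have "\<sigma> x ^ 3 = 1 / (G 2 x * sqrt (G 2 x))" using elim by (simp add: \<sigma>_def power3_eq_cube)
      also have "\<dots> \<le> 1 / (b * h * sqrt (b * h))"
        using bh b h elim by (intro divide_left_mono mult_mono) auto
      finally show ?thesis .
    qed
    have "\<bar>G 3 y\<bar> * \<sigma> x ^ 3 \<le> C / sqrt x" if y: "x / 2 \<le> y" "y \<le> 2 * x" for y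
    proof -
      have ya: "y > a" "y > 0" using y elim by linarith+
      have "G 1 y \<le> G 1 (2 * x)" using ya y by (intro G1_mono) auto
      also have "\<dots> \<le> exp (3 * b) * G 1 x" by (rule dbl[OF x(1)])
      finally have gy: "G 1 y \<le> exp (3 * b) * G 1 x" .
      have "(x / 2)\<^sup>2 \<le> y\<^sup>2" using y x by (intro power_mono) auto
      then have yy: "x\<^sup>2 / 4 \<le> y\<^sup>2" by (simp add: power_divide)
      have "G 1 y / y\<^sup>2 \<le> (exp (3 * b) * G 1 x) / (x\<^sup>2 / 4)"
        using gy yy x ya a[of y] by (intro frac_le) auto
      also have "\<dots> = 4 * exp (3 * b) * (h / x)" by (simp add: h_def power2_eq_square)
      finally have "\<bar>G 3 y\<bar> \<le> K' * (4 * exp (3 * b) * (h / x))"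
        using G3b[OF ya(1)] K'0 by (meson mult_left_mono less_imp_le order_trans)
      then have "\<bar>G 3 y\<bar> * \<sigma> x ^ 3 \<le> K' * (4 * exp (3 * b) * (h / x)) * (1 / (b * h * sqrt (b * h)))"
        using s3 elim by (intro mult_mono) (auto simp: \<sigma>_def)
      also have "\<dots> = C * (1 / (x * sqrt h))"
        using h b x by (simp add: C_def real_sqrt_mult field_simps)
      also have "x * sqrt h = sqrt (x * G 1 x)"
        using x by (simp add: h_def real_sqrt_divide real_sqrt_mult field_simps)
      also have "C * (1 / sqrt (x * G 1 x)) \<le> C * (1 / sqrt x)"
        using x K'0 b by (intro mult_left_mono divide_left_mono) (auto simp: C_def)
      finally show ?thesis by simp
    qed
    then show ?case by blast
  qed
  have "\<eta> < - (1 / 2)" using \<eta> \<theta> \<beta>0 by linarith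
  have "((\<lambda>x. sqrt x * \<bar>q x\<bar>) \<longlongrightarrow> 0) at_top"
  proof (rule tendsto_0_of_geometric_decay)
    from qrv obtain x0 where x0: "\<And>x. x \<ge> x0 \<Longrightarrow> 0 < \<bar>q x\<bar>" unfolding regularly_varying_def by blast
    show "eventually (\<lambda>x. 0 < sqrt x * \<bar>q x\<bar>) at_top"
      using eventually_ge_at_top[of x0] eventually_gt_at_top[of 0] by eventually_elim (use x0 in auto)
    have "((\<lambda>x. \<bar>q (2 * x)\<bar> / \<bar>q x\<bar>) \<longlongrightarrow> 2 powr \<eta>) at_top" using qrv unfolding regularly_varying_def by simp
    from tendsto_mult[OF tendsto_const this] have "((\<lambda>x. sqrt 2 * (\<bar>q (2 * x)\<bar> / \<bar>q x\<bar>)) \<longlongrightarrow> sqrt 2 * 2 powr \<eta>) at_top" .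
    then show "((\<lambda>x. sqrt (2 * x) * \<bar>q (2 * x)\<bar> / (sqrt x * \<bar>q x\<bar>)) \<longlongrightarrow> sqrt 2 * 2 powr \<eta>) at_top"
      by (rule Lim_transform_eventually)
         (use eventually_gt_at_top[of 0] in eventually_elim, simp add: real_sqrt_mult)
    have "sqrt 2 * 2 powr \<eta> = 2 powr (1 / 2 + \<eta>)" by (simp add: powr_add powr_half_sqrt)
    also have "\<dots> < 2 powr 0" using \<open>\<eta> < - (1 / 2)\<close> by (intro powr_less_mono) auto
    finally show "sqrt 2 * 2 powr \<eta> < 1" by simp
    show "eventually (\<lambda>a. \<exists>K. \<forall>x\<in>{a..2 * a}. sqrt x * \<bar>q x\<bar> \<le> K) at_top"
      using eventually_gt_at_top[of 0]
    proof eventually_elim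
      case (elim a)
      have "sqrt x * \<bar>q x\<bar> \<le> sqrt (2 * a) * Q" if "x \<in> {a..2 * a}" for x
        using that elim q_bound[of x] Q_nonneg by (intro mult_mono) auto
      then show ?case by blast
    qed
  qed
  then have "eventually (\<lambda>x. sqrt x * \<bar>q x\<bar> < 1) at_top" by (rule order_tendstoD(2)) simp
  then have "eventually (\<lambda>x. sqrt x * \<bar>q x\<bar> \<le> 1) at_top" by eventually_elim simp
  with C1 C2 C3 show ?thesis by (rule that)
qed

lemma regular_case_gaussian_regime:
  assumes G2: "eventually (\<lambda>x. 0 < G 2 x) at_top"
    and R2: "eventually (\<lambda>x. \<forall>y. x / 2 \<le> y \<and> y \<le> 2 * x \<longrightarrow> \<bar>G 3 y\<bar> * \<sigma> x ^ 3 \<le> C / sqrt x) at_top"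
    and R3: "eventually (\<lambda>x. sqrt x * \<bar>q x\<bar> \<le> C') at_top"
  shows "gaussian_regime p g q G Q"
proof unfold_locales
  have lim: "((\<lambda>x. K / sqrt x) \<longlongrightarrow> 0) at_top" for K
    by (intro tendsto_divide_0[OF tendsto_const] filterlim_at_top_imp_at_infinity sqrt_at_top)
  show "eventually (\<lambda>x. 0 < G 2 x) at_top" by (rule G2)
  show "((\<lambda>x. G 3 x / (G 2 x * sqrt (G 2 x))) \<longlongrightarrow> 0) at_top"
  proof (rule Lim_null_comparison[OF _ lim])
    show "eventually (\<lambda>x. norm (G 3 x / (G 2 x * sqrt (G 2 x))) \<le> C / sqrt x) at_top"
      using G2 R2 eventually_gt_at_top[of 0]
    proof eventually_elim
      case (elim x)
      then have "\<bar>G 3 x\<bar> * \<sigma> x ^ 3 \<le> C / sqrt x" by simp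
      then show ?case using elim by (simp add: \<sigma>_def power3_eq_cube abs_mult)
    qed
  qed
  show "(q \<longlongrightarrow> 0) at_top"
  proof (rule Lim_null_comparison[OF _ lim])
    show "eventually (\<lambda>x. norm (q x) \<le> C' / sqrt x) at_top"
      using R3 eventually_gt_at_top[of 0] by eventually_elim (simp add: field_simps)
  qed
qed

text \<open>Along \<open>x = \<psi> t\<close> the derivatives of \<open>g'\<close> are those of an inverse function: with
  \<open>D = \<psi>' = \<psi> * E 0 / t\<close> one has \<open>G 2 = 1 / D\<close>, \<open>D' = D * R / t\<close> for a bounded \<open>R\<close>, and
  \<open>G 3 / (G 2 * sqrt (G 2)) = - R / (t * sqrt D)\<close>.  Here \<open>t * sqrt D = sqrt (t * E 0 t * \<psi> t)\<close> tends to
  infinity because \<open>\<psi>\<close> does and the positive \<open>t * E 0 t\<close> is eventually nondecreasing.  Likewise \<open>\<sigma>\<^sup>3 / x = (E 0 t / t) * sqrt D\<close>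
  tends to \<open>0\<close> because \<open>\<psi> t / t\<close> is eventually nonincreasing.\<close>
lemma rapid_case_conditions:
  assumes "rapid_case (G 1) q"
  shows "gaussian_regime p g q G Q" and "((\<lambda>x. \<sigma> x ^ 3 / x) \<longlongrightarrow> 0) at_top"
proof -
  from assms obtain \<psi> c E \<eta> where inv: "eventually (\<lambda>x. \<psi> (G 1 x) = x) at_top" "eventually (\<lambda>t. G 1 (\<psi> t) = t) at_top"
    and c: "c > 0" and rep: "eventually (\<lambda>t. \<psi> t = c * exp (integral {1..t} (\<lambda>u. E 0 u / u))) at_top"
    and E: "derivs_on {1..} 2 E" and E0: "(E 0 \<longlongrightarrow> 0) at_top" and En: "eventually (\<lambda>t. E 0 t \<noteq> 0) at_top"
    and E1: "((\<lambda>t. t * E 1 t / E 0 t) \<longlongrightarrow> 0) at_top"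
    and \<eta>: "\<eta> < - (1 / 2)" and qrv: "regularly_varying (\<lambda>t. \<bar>q (\<psi> t)\<bar>) \<eta>"
    unfolding rapid_case_def inverse_at_top_def by blast
  have e1: "eventually (\<lambda>t. \<bar>t * E 1 t / E 0 t\<bar> < 1) at_top" using tendsto_rabs[OF E1] by (intro order_tendstoD(2)) auto
  have e0: "eventually (\<lambda>t. \<bar>E 0 t\<bar> < 1) at_top" using tendsto_rabs[OF E0] by (intro order_tendstoD(2)) auto
  have "eventually (\<lambda>t. t > 1 \<and> G 1 (\<psi> t) = t \<and> \<psi> t = c * exp (integral {1..t} (\<lambda>u. E 0 u / u)) \<and> \<bar>E 0 t\<bar> < 1 \<and> \<bar>t * E 1 t / E 0 t\<bar> < 1 \<and> E 0 t \<noteq> 0) at_top"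
    using inv(2) rep e1 e0 eventually_gt_at_top[of 1] En by eventually_elim auto
  then obtain a where a': "\<And>t. t \<ge> a \<Longrightarrow> t > 1 \<and> G 1 (\<psi> t) = t \<and> \<psi> t = c * exp (integral {1..t} (\<lambda>u. E 0 u / u)) \<and> \<bar>E 0 t\<bar> < 1 \<and> \<bar>t * E 1 t / E 0 t\<bar> < 1 \<and> E 0 t \<noteq> 0"
    by (auto simp: eventually_at_top_linorder)
  have a: "t > 1 \<and> \<bar>E 0 t\<bar> < 1" if "t \<ge> a" for t using a'[OF that] by blast
  have ainv: "G 1 (\<psi> t) = t" and aratio: "\<bar>t * E 1 t / E 0 t\<bar> < 1" if "t \<ge> a" for t using a'[OF that] by blast+
  have arep: "c * exp (integral {1..t} (\<lambda>u. E 0 u / u)) = \<psi> t" if "t \<ge> a" for t using a'[OF that] by simp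
  have \<psi>0: "\<psi> t > 0" if "t \<ge> a" for t using arep[OF that] c by (metis exp_gt_zero mult_pos_pos)
  define D where "D t = \<psi> t * E 0 t / t" for t
  have d\<psi>: "(\<psi> has_real_derivative D t) (at t)" if t: "t > a" for t
  proof -
    have t1: "t > 1" using a t by auto
    have "((\<lambda>t. c * exp (integral {1..t} (\<lambda>u. E 0 u / u))) has_real_derivative c * exp (integral {1..t} (\<lambda>u. E 0 u / u)) * E 0 t / t) (at t)"
      using t1 by (auto intro!: derivative_eq_intros karamata_integral_DERIV[OF E t1])
    then show ?thesis
      unfolding D_def arep[OF less_imp_le[OF t]]
      by (rule has_field_derivative_transform_within_open[where S = "{a<..}"]) (use t arep in auto)
  qed
  have prod: "G 2 (\<psi> t) * D t = 1" if t: "t > a" for t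
  proof -
    have g: "(G 1 has_real_derivative G 2 (\<psi> t)) (at (\<psi> t))" using G_DERIV[of 1 "\<psi> t"] \<psi>0[of t] t by (simp add: numeral_2_eq_2)
    have "((\<lambda>t. G 1 (\<psi> t)) has_real_derivative G 2 (\<psi> t) * D t) (at t)"
      by (rule DERIV_chain2[OF g d\<psi>[OF t]])
    moreover have "((\<lambda>t. G 1 (\<psi> t)) has_real_derivative 1) (at t)"
      by (rule has_field_derivative_transform_within_open[OF DERIV_ident, where S = "{a<..}"]) (use t ainv in auto)
    ultimately show ?thesis by (rule DERIV_unique)
  qed
  have pos: "0 < G 2 (\<psi> t)" "0 < D t" "G 2 (\<psi> t) = 1 / D t" if t: "t > a" for t
  proof -
    have "0 \<le> G 2 (\<psi> t)" using G2_nonneg \<psi>0[of t] t by simp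
    with prod[OF t] show 1: "0 < G 2 (\<psi> t)" by (metis less_eq_real_def mult_zero_left zero_neq_one)
    with prod[OF t] show 2: "0 < D t" by (metis zero_less_mult_pos zero_less_one)
    show "G 2 (\<psi> t) = 1 / D t" using prod[OF t] 2 by (simp add: field_simps)
  qed
  have Epos: "0 < E 0 t" if t: "t > a" for t
  proof -
    have p: "\<psi> t > 0" "t > 0" using \<psi>0[of t] a[of t] t by auto
    have "E 0 t = D t * t / \<psi> t" using p by (simp add: D_def)
    then show ?thesis using p pos(2)[OF t] by simp
  qed
  define R where "R t = E 0 t + t * E 1 t / E 0 t - 1" for t
  have dD: "(D has_real_derivative D t / t * R t) (at t)" if t: "t > a" for t
  proof -
    have t1: "t > 1" using a t by auto
    have e: "(E 0 has_real_derivative E 1 t) (at t)" using derivs_on_DERIV[OF E, of 0 t] t1 by simp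
    show ?thesis unfolding D_def[abs_def] using t1 Epos[OF t]
      by (auto intro!: derivative_eq_intros e d\<psi>[OF t] simp: D_def R_def field_simps power2_eq_square)
  qed
  have G3: "G 3 (\<psi> t) = - (D t / t * R t) / (D t) ^ 3" if t: "t > a" for t
  proof -
    have g: "(G 2 has_real_derivative G 3 (\<psi> t)) (at (\<psi> t))" using G_DERIV[of 2 "\<psi> t"] \<psi>0[of t] t by (simp add: numeral_3_eq_3 numeral_2_eq_2)
    have "((\<lambda>t. G 2 (\<psi> t)) has_real_derivative G 3 (\<psi> t) * D t) (at t)"
      by (rule DERIV_chain2[OF g d\<psi>[OF t]])
    moreover have "((\<lambda>t. G 2 (\<psi> t)) has_real_derivative - (D t / t * R t) / (D t)\<^sup>2) (at t)"
    proof -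
      have "((\<lambda>t. 1 / D t) has_real_derivative - (D t / t * R t) / (D t)\<^sup>2) (at t)"
        using pos(2)[OF t] by (auto intro!: derivative_eq_intros dD[OF t] simp: power2_eq_square)
      then show ?thesis
        by (rule has_field_derivative_transform_within_open[where S = "{a<..}"]) (use t pos in auto)
    qed
    ultimately have eq: "G 3 (\<psi> t) * D t = - (D t / t * R t) / (D t)\<^sup>2" by (rule DERIV_unique)
    have "G 3 (\<psi> t) = G 3 (\<psi> t) * D t / D t" using pos(2)[OF t] by simp
    also have "\<dots> = - (D t / t * R t) / (D t)\<^sup>2 / D t" by (simp only: eq)
    also have "\<dots> = - (D t / t * R t) / (D t) ^ 3" by (simp add: power2_eq_square power3_eq_cube mult.assoc)
    finally show ?thesis .
  qed
  have \<psi>_top: "filterlim \<psi> at_top at_top"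
    unfolding filterlim_at_top
  proof
    fix B :: real
    show "eventually (\<lambda>t. B \<le> \<psi> t) at_top"
      using eventually_gt_at_top[of "G 1 (max B 1)"] eventually_gt_at_top[of a]
    proof eventually_elim
      case (elim t)
      show ?case
      proof (rule ccontr)
        assume "\<not> B \<le> \<psi> t"
        then have "G 1 (\<psi> t) \<le> G 1 (max B 1)" using \<psi>0[of t] elim by (intro G1_mono) auto
        then show False using elim ainv[of t] by simp
      qed
    qed
  qed
  \<comment> \<open>every large \<open>x\<close> is \<open>\<psi> t\<close> with \<open>t = G 1 x\<close>, so limits may be computed along \<open>\<psi>\<close>\<close>
  have transfer: "(f \<longlongrightarrow> l) at_top" if "((\<lambda>t. f (\<psi> t)) \<longlongrightarrow> l) at_top" for f :: "real \<Rightarrow> real" and l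
  proof (rule Lim_transform_eventually)
    show "((\<lambda>x. f (\<psi> (G 1 x))) \<longlongrightarrow> l) at_top" by (rule filterlim_compose[OF that G1_at_top])
    show "eventually (\<lambda>x. f (\<psi> (G 1 x)) = f x) at_top" using inv(1) by eventually_elim simp
  qed
  define t0 where "t0 = a + 1"
  have tE: "t0 * E 0 t0 \<le> t * E 0 t" if "t \<ge> t0" for t
  proof (rule DERIV_nonneg_imp_nondecreasing[OF that])
    fix y assume y: "t0 \<le> y" "y \<le> t"
    then have ya: "y > a" by (simp add: t0_def)
    then have y1: "y > 1" using a by auto
    have "(E 0 has_real_derivative E 1 y) (at y)" using derivs_on_DERIV[OF E, of 0 y] y1 by simp
    then have "((\<lambda>t. t * E 0 t) has_real_derivative E 0 y + y * E 1 y) (at y)"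
      by (auto intro!: derivative_eq_intros)
    moreover have "0 \<le> E 0 y + y * E 1 y"
    proof -
      have "- 1 < y * E 1 y / E 0 y" using aratio[of y] ya by linarith
      then show ?thesis using Epos[OF ya] by (simp add: field_simps)
    qed
    ultimately show "\<exists>d. ((\<lambda>t. t * E 0 t) has_real_derivative d) (at y) \<and> 0 \<le> d" by blast
  qed
  have t0a: "t0 > a" by (simp add: t0_def)
  have tEpos: "0 < t0 * E 0 t0" using Epos[OF t0a] a[of t0] t0a by (intro mult_pos_pos) auto
  have \<psi>t: "\<psi> t / t \<le> \<psi> t0 / t0" if "t \<ge> t0" for t
  proof (rule DERIV_nonpos_imp_nonincreasing[OF that])
    fix y assume y: "t0 \<le> y" "y \<le> t"
    then have ya: "y > a" by (simp add: t0_def)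
    then have y1: "y > 1" using a by auto
    have "((\<lambda>t. \<psi> t / t) has_real_derivative (\<psi> y / y\<^sup>2) * (E 0 y - 1)) (at y)"
      using y1 by (auto intro!: derivative_eq_intros d\<psi>[OF ya] simp: D_def field_simps power2_eq_square)
    moreover have "(\<psi> y / y\<^sup>2) * (E 0 y - 1) \<le> 0" using \<psi>0[of y] a[of y] ya by (intro mult_nonneg_nonpos) auto
    ultimately show "\<exists>d. ((\<lambda>t. \<psi> t / t) has_real_derivative d) (at y) \<and> d \<le> 0" by blast
  qed
  have q0: "(q \<longlongrightarrow> 0) at_top"
  proof (rule transfer)
    have "((\<lambda>t. \<bar>q (\<psi> t)\<bar>) \<longlongrightarrow> 0) at_top"
    proof (rule tendsto_0_of_geometric_decay)
      from qrv obtain x0 where x0: "\<And>x. x \<ge> x0 \<Longrightarrow> 0 < \<bar>q (\<psi> x)\<bar>" unfolding regularly_varying_def by blast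
      then show "eventually (\<lambda>t. 0 < \<bar>q (\<psi> t)\<bar>) at_top" by (auto simp: eventually_at_top_linorder)
      show "((\<lambda>t. \<bar>q (\<psi> (2 * t))\<bar> / \<bar>q (\<psi> t)\<bar>) \<longlongrightarrow> 2 powr \<eta>) at_top" using qrv unfolding regularly_varying_def by simp
      have "2 powr \<eta> < 2 powr 0" using \<eta> by (intro powr_less_mono) auto
      then show "2 powr \<eta> < 1" by simp
      show "eventually (\<lambda>b. \<exists>K. \<forall>t\<in>{b..2 * b}. \<bar>q (\<psi> t)\<bar> \<le> K) at_top"
        using eventually_ge_at_top[of a]
      proof eventually_elim
        case (elim b)
        have "\<bar>q (\<psi> t)\<bar> \<le> Q" if "t \<in> {b..2 * b}" for t using \<psi>0[of t] that elim by (intro q_bound) auto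
        then show ?case by blast
      qed
    qed
    then show "((\<lambda>t. q (\<psi> t)) \<longlongrightarrow> 0) at_top" by (rule tendsto_rabs_zero_cancel)
  qed
  show "gaussian_regime p g q G Q"
  proof unfold_locales
    have "eventually (\<lambda>t. 0 < G 2 (\<psi> t)) at_top" using eventually_gt_at_top[of a] by eventually_elim (rule pos)
    from eventually_compose_filterlim[OF this G1_at_top] inv(1)
    show "eventually (\<lambda>x. 0 < G 2 x) at_top" by eventually_elim simp
    show "((\<lambda>x. G 3 x / (G 2 x * sqrt (G 2 x))) \<longlongrightarrow> 0) at_top"
    proof (rule transfer, rule Lim_null_comparison)
      show "eventually (\<lambda>t. norm (G 3 (\<psi> t) / (G 2 (\<psi> t) * sqrt (G 2 (\<psi> t)))) \<le> 3 / sqrt (t0 * E 0 t0 * \<psi> t)) at_top"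
        using eventually_gt_at_top[of t0]
      proof eventually_elim
        case (elim t)
        have ta: "t > a" using elim t0a by simp
        have t1: "t > 1" using a ta by auto
        note p = pos[OF ta] \<psi>0[of t]
        have R: "\<bar>R t\<bar> \<le> 3" using a[of t] aratio[of t] ta unfolding R_def by linarith
        have td: "t * sqrt (D t) = sqrt (t * E 0 t * \<psi> t)"
        proof -
          have "t * sqrt (D t) = sqrt (t\<^sup>2 * D t)" using t1 by (simp add: real_sqrt_mult)
          also have "t\<^sup>2 * D t = t * E 0 t * \<psi> t" using t1 by (simp add: D_def power2_eq_square)
          finally show ?thesis .
        qed
        have "\<bar>G 3 (\<psi> t) / (G 2 (\<psi> t) * sqrt (G 2 (\<psi> t)))\<bar> = \<bar>R t\<bar> / (t * sqrt (D t))"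
        proof -
          have "G 3 (\<psi> t) / (G 2 (\<psi> t) * sqrt (G 2 (\<psi> t))) = - R t / (t * sqrt (D t))"
          proof -
            have "sqrt (D t) * sqrt (D t) = D t" using p by simp
            then show ?thesis unfolding G3[OF ta] p(3) using p(2) t1
              by (simp add: real_sqrt_divide field_simps power3_eq_cube)
          qed
          then show ?thesis using p t1 by (simp add: abs_mult)
        qed
        also have "\<dots> \<le> 3 / (t * sqrt (D t))" using R p t1 by (intro divide_right_mono) auto
        also have "\<dots> \<le> 3 / sqrt (t0 * E 0 t0 * \<psi> t)"
          unfolding td using tE[of t] elim tEpos p ta
          by (intro divide_left_mono real_sqrt_le_mono mult_right_mono mult_pos_pos) (auto intro!: mult_pos_pos less_le_trans[OF tEpos])
        finally show ?case by simp
      qed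
      have "filterlim (\<lambda>t. sqrt (t0 * E 0 t0 * \<psi> t)) at_top at_top"
        by (rule filterlim_compose[OF sqrt_at_top filterlim_tendsto_pos_mult_at_top[OF tendsto_const tEpos \<psi>_top]])
      then show "((\<lambda>t. 3 / sqrt (t0 * E 0 t0 * \<psi> t)) \<longlongrightarrow> 0) at_top"
        by (intro tendsto_divide_0[OF tendsto_const] filterlim_at_top_imp_at_infinity)
    qed
    show "(q \<longlongrightarrow> 0) at_top" by (rule q0)
  qed
  show "((\<lambda>x. \<sigma> x ^ 3 / x) \<longlongrightarrow> 0) at_top"
  proof (rule transfer, rule Lim_null_comparison)
    show "eventually (\<lambda>t. norm (\<sigma> (\<psi> t) ^ 3 / \<psi> t) \<le> (1 / t) * sqrt (\<psi> t0 / t0)) at_top"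
      using eventually_gt_at_top[of t0]
    proof eventually_elim
      case (elim t)
      have ta: "t > a" using elim t0a by simp
      have t1: "t > 1" and Et: "0 < E 0 t" "E 0 t \<le> 1" using a[of t] Epos[OF ta] ta by auto
      have p: "0 < D t" "0 < \<psi> t" using pos[OF ta] \<psi>0[of t] ta by auto
      have s: "\<sigma> (\<psi> t) = sqrt (D t)" using pos(3)[OF ta] p by (simp add: \<sigma>_def real_sqrt_divide)
      have "\<sigma> (\<psi> t) ^ 3 / \<psi> t = (E 0 t / t) * sqrt (D t)"
        unfolding s using p by (simp add: power3_eq_cube) (simp add: D_def)
      also have "\<dots> \<le> (1 / t) * sqrt (\<psi> t0 / t0)"
      proof (intro mult_mono divide_right_mono real_sqrt_le_mono)
        have "D t = E 0 t * (\<psi> t / t)" by (simp add: D_def)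
        also have "\<dots> \<le> 1 * (\<psi> t / t)" using Et p t1 by (intro mult_right_mono) auto
        finally show "D t \<le> \<psi> t0 / t0" using \<psi>t[of t] elim by simp
      qed (use Et t1 p in auto)
      finally show ?case using s p by simp
    qed
    show "((\<lambda>t. (1 / t) * sqrt (\<psi> t0 / t0)) \<longlongrightarrow> 0) at_top"
      by (intro tendsto_mult_left_zero tendsto_divide_0[OF tendsto_const] filterlim_at_top_imp_at_infinity filterlim_ident)
  qed
qed

theorem tilt_asymptotics:
  assumes h: "regular_case (G 1) (G 3) q \<or> rapid_case (G 1) q" and T: "filterlim T at_top sequentially"
  shows "\<And>z. (\<lambda>n. std_tilt (T n) z) \<longlonglongrightarrow> std_normal_density z"
    and "eventually (\<lambda>n. \<forall>z. std_tilt (T n) z \<le> 2 * exp (Q + 1 / 4)) sequentially"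
    and "(\<lambda>n. tcum3 (T n) / tmean (T n)) \<longlonglongrightarrow> 0"
    and "filterlim (\<lambda>n. tmean (T n)) at_top sequentially"
proof -
  define X where "X n = saddle (T n)" for n
  have X: "filterlim X at_top sequentially" unfolding X_def by (rule filterlim_compose[OF saddle_at_top T])
  have TX: "eventually (\<lambda>n. G 1 (X n) = T n) sequentially"
    using eventually_compose_filterlim[OF G1_saddle T] unfolding X_def by eventually_elim simp
  have gr: "gaussian_regime p g q G Q" and sk: "(\<lambda>n. tcum3 (G 1 (X n)) / tmean (G 1 (X n))) \<longlonglongrightarrow> 0"
    using h
  proof (atomize (full), elim disjE, goal_cases)
    case 1
    then obtain C C' where c: "eventually (\<lambda>x. 0 < G 2 x) at_top" "((\<lambda>x. (\<sigma> x)\<^sup>2 / x) \<longlongrightarrow> 0) at_top"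
      "eventually (\<lambda>x. \<forall>y. x / 2 \<le> y \<and> y \<le> 2 * x \<longrightarrow> \<bar>G 3 y\<bar> * \<sigma> x ^ 3 \<le> C / sqrt x) at_top"
      "eventually (\<lambda>x. sqrt x * \<bar>q x\<bar> \<le> C') at_top" by (rule regular_case_conditions)
    have gr: "gaussian_regime p g q G Q" by (rule regular_case_gaussian_regime[OF c(1,3,4)])
    show ?case using gr gaussian_regime.tcum3_over_mean_lim_by_cancellation[OF gr X c(2-4)] by blast
  next
    case 2
    note c = rapid_case_conditions[OF 2]
    show ?case using c(1) gaussian_regime.tcum3_over_mean_lim_if_sigma_cubed_small[OF c(1) X c(2)] by blast
  qed
  show "(\<lambda>n. std_tilt (T n) z) \<longlonglongrightarrow> std_normal_density z" for z
    by (rule Lim_transform_eventually[OF gaussian_regime.std_tilt_lim[OF gr X]]) (use TX in eventually_elim, simp)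
  show "eventually (\<lambda>n. \<forall>z. std_tilt (T n) z \<le> 2 * exp (Q + 1 / 4)) sequentially"
    using gaussian_regime.std_tilt_eventually_le[OF gr X] TX by eventually_elim simp
  show "(\<lambda>n. tcum3 (T n) / tmean (T n)) \<longlonglongrightarrow> 0"
    by (rule Lim_transform_eventually[OF sk]) (use TX in eventually_elim, simp)
  show "filterlim (\<lambda>n. tmean (T n)) at_top sequentially"
  proof (rule filterlim_at_top_mono)
    show "filterlim (\<lambda>n. 1 / 2 * X n) at_top sequentially"
      by (rule filterlim_tendsto_pos_mult_at_top[OF tendsto_const _ X]) simp
    have "eventually (\<lambda>n. 1 / 2 < tmean (G 1 (X n)) / X n) sequentially"
      using gaussian_regime.tmean_saddle_lim[OF gr X] by (rule order_tendstoD(1)) simp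
    moreover have "eventually (\<lambda>n. X n > 0) sequentially" using X by (simp add: filterlim_at_top_dense)
    ultimately show "eventually (\<lambda>n. 1 / 2 * X n \<le> tmean (T n)) sequentially"
      using TX by eventually_elim (simp add: field_simps)
  qed
qed

end

section \<open>Gaussian modulation and the theorem\<close>

context tiltable
begin

text \<open>A tilted expectation: the normalizing integral of the Gaussian modulation of \<open>p\<close>, up to elementary
  factors, when \<open>\<delta>\<close> is the difference of \<open>\<alpha>\<close> and the tilting parameter.\<close>
definition "modulation t \<delta> \<beta> = (LBINT u. exp (\<delta> * (u - tmean t) - (u - tmean t)\<^sup>2 / (2 * \<beta>)) * (exp (t * u) * p u)) / \<Phi> t"

lemma complete_square_le:
  fixes v :: real
  assumes "\<beta> > 0"
  shows "\<delta> * v - v\<^sup>2 / (2 * \<beta>) \<le> \<delta>\<^sup>2 * \<beta> / 2"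
proof -
  have "0 \<le> (v - \<delta> * \<beta>)\<^sup>2 / (2 * \<beta>)" using assms by simp
  also have "(v - \<delta> * \<beta>)\<^sup>2 / (2 * \<beta>) = v\<^sup>2 / (2 * \<beta>) - \<delta> * v + \<delta>\<^sup>2 * \<beta> / 2"
    using assms by (simp add: field_simps power2_eq_square)
  finally show ?thesis by linarith
qed

text \<open>The exponent is at most \<open>\<delta>\<^sup>2 * \<beta> / 2\<close> by completing the square.  Below, \<open>exp r \<ge> 1 + r\<close> is integrated; the
  linear term vanishes because it is centred at the tilted mean.\<close>
lemma modulation_bounds:
  assumes \<beta>: "\<beta> > 0"
  shows "1 - tvar t / (2 * \<beta>) \<le> modulation t \<delta> \<beta>" and "modulation t \<delta> \<beta> \<le> exp (\<delta>\<^sup>2 * \<beta> / 2)"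
proof -
  let ?m = "tmean t"
  let ?e = "\<lambda>u. exp (\<delta> * (u - ?m) - (u - ?m)\<^sup>2 / (2 * \<beta>))"
  let ?f = "\<lambda>u. exp (t * u) * p u"
  have P: "\<Phi> t > 0" by (rule \<Phi>_pos)
  have f0: "0 \<le> ?f u" for u using p_nonneg by simp
  have ub: "?e u * ?f u \<le> exp (\<delta>\<^sup>2 * \<beta> / 2) * ?f u" for u
    using complete_square_le[OF \<beta>] f0 by (intro mult_right_mono) auto
  have ui: "integrable lborel (\<lambda>u. exp (\<delta>\<^sup>2 * \<beta> / 2) * ?f u)" by (intro integrable_mult_right tilted_integrable)
  have ei: "integrable lborel (\<lambda>u. ?e u * ?f u)"
  proof (rule Bochner_Integration.integrable_bound[OF ui])
    show "AE u in lborel. norm (?e u * ?f u) \<le> norm (exp (\<delta>\<^sup>2 * \<beta> / 2) * ?f u)"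
    proof (intro AE_I2)
      fix u
      have "0 \<le> ?e u * ?f u" by (rule mult_nonneg_nonneg[OF exp_ge_zero f0])
      then show "norm (?e u * ?f u) \<le> norm (exp (\<delta>\<^sup>2 * \<beta> / 2) * ?f u)"
        using ub[of u] unfolding real_norm_def by linarith
    qed
  qed simp
  have "(LBINT u. ?e u * ?f u) \<le> (LBINT u. exp (\<delta>\<^sup>2 * \<beta> / 2) * ?f u)"
    by (rule integral_mono[OF ei ui ub])
  then show "modulation t \<delta> \<beta> \<le> exp (\<delta>\<^sup>2 * \<beta> / 2)" using P by (simp add: modulation_def divide_le_eq)
  let ?J = "\<lambda>k u. (u - ?m) ^ k * exp (t * u) * p u"
  note i = tilted_moment_integrable[of ?m _ t]
  have m0: "tilted_moment p ?m 0 t = \<Phi> t" by (rule tilted_moment_0)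
  have m1: "tilted_moment p ?m 1 t = 0" using cumulants_recentre(1)[of t ?m] P by simp
  have m2: "tilted_moment p ?m 2 t = tvar t * \<Phi> t" using P by (simp add: tvar_def)
  have li: "integrable lborel (\<lambda>u. ?J 0 u + \<delta> * ?J 1 u - (1 / (2 * \<beta>)) * ?J 2 u)"
    by (intro Bochner_Integration.integrable_diff Bochner_Integration.integrable_add integrable_mult_right i)
  have "(LBINT u. ?J 0 u + \<delta> * ?J 1 u - (1 / (2 * \<beta>)) * ?J 2 u)
      = tilted_moment p ?m 0 t + \<delta> * tilted_moment p ?m 1 t - (1 / (2 * \<beta>)) * tilted_moment p ?m 2 t"
    unfolding tilted_moment_def using i by (simp only: Bochner_Integration.integral_diff Bochner_Integration.integral_add
      Bochner_Integration.integrable_add integrable_mult_right integral_mult_right_zero)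
  also have "\<dots> = (1 - tvar t / (2 * \<beta>)) * \<Phi> t" unfolding m0 m1 m2 by (simp add: algebra_simps)
  finally have "(1 - tvar t / (2 * \<beta>)) * \<Phi> t = (LBINT u. ?J 0 u + \<delta> * ?J 1 u - (1 / (2 * \<beta>)) * ?J 2 u)" ..
  also have "\<dots> \<le> (LBINT u. ?e u * ?f u)"
  proof (rule integral_mono[OF li ei])
    fix u
    have "(1 + (\<delta> * (u - ?m) - (u - ?m)\<^sup>2 / (2 * \<beta>))) * ?f u \<le> ?e u * ?f u"
      by (intro mult_right_mono exp_ge_add_one_self f0)
    then show "?J 0 u + \<delta> * ?J 1 u - (1 / (2 * \<beta>)) * ?J 2 u \<le> ?e u * ?f u"
      by (simp add: algebra_simps)
  qed
  finally show "1 - tvar t / (2 * \<beta>) \<le> modulation t \<delta> \<beta>"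
    using P by (simp add: modulation_def le_divide_eq)
qed

text \<open>Expanding the square in the normal density of mean \<open>\<alpha> * \<beta> + m\<close> and variance \<open>\<beta>\<close> produces the factor
  \<open>exp (\<alpha> * u)\<close>, of which \<open>exp (t * u)\<close> is the tilting and \<open>exp ((\<alpha> - t) * u)\<close> is left over.\<close>
lemma normal_modulated_eq:
  assumes \<beta>: "\<beta> > 0" and pos: "modulation t (\<alpha> - t) \<beta> > 0"
  shows "normal_modulated p (\<alpha> * \<beta> + tmean t) \<beta> y =
    exp (t * y) * p y / \<Phi> t * exp (- (tmean t - y)\<^sup>2 / (2 * \<beta>)) * (exp ((\<alpha> - t) * (y - tmean t)) / modulation t (\<alpha> - t) \<beta>)"
proof -
  let ?m = "tmean t"
  let ?E = "\<lambda>u. exp ((\<alpha> - t) * (u - ?m) - (u - ?m)\<^sup>2 / (2 * \<beta>)) * (exp (t * u) * p u)"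
  define K where "K = 1 / sqrt (2 * pi * \<beta>) * exp (- \<alpha>\<^sup>2 * \<beta> / 2 - t * ?m)"
  have K: "K > 0" using \<beta> by (simp add: K_def)
  have N: "p u * normal_density (\<alpha> * \<beta> + ?m) (sqrt \<beta>) u = K * ?E u" for u
  proof -
    have "- (u - (\<alpha> * \<beta> + ?m))\<^sup>2 / (2 * \<beta>) = (- \<alpha>\<^sup>2 * \<beta> / 2 - t * ?m) + ((\<alpha> - t) * (u - ?m) - (u - ?m)\<^sup>2 / (2 * \<beta>)) + t * u"
      using \<beta> by (simp add: field_simps power2_eq_square)
    then have "normal_density (\<alpha> * \<beta> + ?m) (sqrt \<beta>) u = 1 / sqrt (2 * pi * \<beta>) *
       exp ((- \<alpha>\<^sup>2 * \<beta> / 2 - t * ?m) + ((\<alpha> - t) * (u - ?m) - (u - ?m)\<^sup>2 / (2 * \<beta>)) + t * u)"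
      unfolding normal_density_def using \<beta> by simp
    then show ?thesis unfolding K_def exp_add by simp
  qed
  have "(LBINT u. p u * normal_density (\<alpha> * \<beta> + ?m) (sqrt \<beta>) u) = K * (LBINT u. ?E u)"
    unfolding N by (rule integral_mult_right_zero)
  also have "\<dots> = K * (modulation t (\<alpha> - t) \<beta> * \<Phi> t)" using \<Phi>_pos[of t] by (simp add: modulation_def)
  finally have "normal_modulated p (\<alpha> * \<beta> + ?m) \<beta> y = 1 / (K * (modulation t (\<alpha> - t) \<beta> * \<Phi> t)) * (K * ?E y)"
    unfolding normal_modulated_def Let_def N[symmetric] by simp
  also have "\<dots> = ?E y / (modulation t (\<alpha> - t) \<beta> * \<Phi> t)" using K by simp
  also have "?E y = exp ((\<alpha> - t) * (y - ?m)) * exp (- (?m - y)\<^sup>2 / (2 * \<beta>)) * (exp (t * y) * p y)"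
    by (simp add: power2_commute[of ?m y] flip: exp_add)
  finally show ?thesis by (simp add: mult_ac)
qed

end

lemma ratio_lim:
  fixes a s :: "nat \<Rightarrow> real"
  assumes a: "filterlim a at_top sequentially"
  shows "(\<lambda>n. real n / (real n - 1)) \<longlonglongrightarrow> 1" "(\<lambda>n. y / a n) \<longlonglongrightarrow> 0"
proof -
  have "(\<lambda>n. real (Suc n) / real n) \<longlonglongrightarrow> 1" by (rule LIMSEQ_Suc_n_over_n)
  then show "(\<lambda>n. real n / (real n - 1)) \<longlonglongrightarrow> 1" by (subst filterlim_sequentially_Suc[symmetric]) simp
  show "(\<lambda>n. y / a n) \<longlonglongrightarrow> 0"
    by (intro tendsto_divide_0[OF tendsto_const] filterlim_at_top_imp_at_infinity a)
qed

lemma null_times_bounded: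
  fixes f g :: "nat \<Rightarrow> real"
  assumes "f \<longlonglongrightarrow> 0" "Bseq g"
  shows "(\<lambda>n. f n * g n) \<longlonglongrightarrow> 0"
proof -
  obtain K where K: "\<And>n. \<bar>g n\<bar> \<le> K" using assms(2) unfolding Bseq_def by auto
  show ?thesis
  proof (rule Lim_null_comparison)
    show "eventually (\<lambda>n. norm (f n * g n) \<le> \<bar>f n\<bar> * K) sequentially"
      by (intro always_eventually allI) (simp add: abs_mult mult_left_mono K)
    show "(\<lambda>n. \<bar>f n\<bar> * K) \<longlonglongrightarrow> 0" using tendsto_mult[OF tendsto_rabs[OF assms(1)] tendsto_const] by simp
  qed
qed

context tiltable
begin

context
  fixes T :: "nat \<Rightarrow> real"
  assumes top: "filterlim (\<lambda>n. tmean (T n)) at_top sequentially"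
begin

definition "deviation y n = (tmean (T n) - y) / (tsd (T n) * sqrt (real (n - 1)))"
definition "relative_size n = tmean (T n) / (tsd (T n) * sqrt (real n))"

lemma deviation_eq:
  "eventually (\<lambda>n. deviation y n = relative_size n * ((1 - y / tmean (T n)) * sqrt (real n / (real n - 1)))) sequentially"
  using eventually_gt_at_top[of 1] filterlim_at_top_dense[THEN iffD1, OF top, rule_format, of 0]
proof eventually_elim
  case (elim n)
  have n: "real (n - 1) = real n - 1" "real n > 0" using elim by auto
  have "tmean (T n) - y = tmean (T n) * (1 - y / tmean (T n))" using elim by (simp add: right_diff_distrib)
  then show ?case unfolding deviation_def relative_size_def n(1) real_sqrt_divide using n(2) by simp
qed

lemma correction_lim: "(\<lambda>n. (1 - y / tmean (T n)) * sqrt (real n / (real n - 1))) \<longlonglongrightarrow> 1"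
  using tendsto_mult[OF tendsto_diff[OF tendsto_const ratio_lim(2)[OF top]] tendsto_real_sqrt[OF ratio_lim(1)[OF top]]]
  by simp

lemma deviation_Bseq:
  assumes "Bseq relative_size"
  shows "Bseq (deviation y)"
proof (rule Bseq_eventually_mono)
  show "Bseq (\<lambda>n. relative_size n * ((1 - y / tmean (T n)) * sqrt (real n / (real n - 1))))"
    by (rule Bseq_mult[OF assms convergent_imp_Bseq[OF convergentI[OF correction_lim]]])
  show "eventually (\<lambda>n. norm (deviation y n) \<le> norm (relative_size n * ((1 - y / tmean (T n)) * sqrt (real n / (real n - 1))))) sequentially"
    using deviation_eq[of y] by eventually_elim simp
qed

lemma deviation_lim_0:
  assumes "relative_size \<longlonglongrightarrow> 0"
  shows "deviation y \<longlonglongrightarrow> 0"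
proof (rule Lim_transform_eventually)
  show "(\<lambda>n. relative_size n * ((1 - y / tmean (T n)) * sqrt (real n / (real n - 1)))) \<longlonglongrightarrow> 0"
    using tendsto_mult[OF assms correction_lim] by simp
  show "eventually (\<lambda>n. relative_size n * ((1 - y / tmean (T n)) * sqrt (real n / (real n - 1))) = deviation y n) sequentially"
    using deviation_eq[of y] by eventually_elim simp
qed

text \<open>With \<open>\<delta> = \<alpha> - T\<close>, both \<open>\<delta> * (y - m)\<close> and \<open>\<delta>\<^sup>2 * \<beta>\<close> are, up to convergent factors, multiples of
  the third cumulant over \<open>m\<close>, with the bounded coefficient \<open>relative_size\<^sup>2\<close>; so the left-over factor and
  its normalization tend to \<open>1\<close>.\<close>
lemma normal_modulated_asymp:
  assumes R: "Bseq relative_size" and cum3: "(\<lambda>n. tcum3 (T n) / tmean (T n)) \<longlonglongrightarrow> 0"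
  defines "\<beta> \<equiv> \<lambda>n. (real n - 1) * (tsd (T n))\<^sup>2"
  defines "\<alpha> \<equiv> \<lambda>n. T n + tcum3 (T n) / (2 * (real n - 1) * (tsd (T n))\<^sup>2)"
  shows "(\<lambda>n. normal_modulated p (\<alpha> n * \<beta> n + tmean (T n)) (\<beta> n) y)
    \<sim>[sequentially] (\<lambda>n. exp (T n * y) * p y / \<Phi> (T n) * exp (- (deviation y n)\<^sup>2 / 2))"
proof -
  let ?m = "\<lambda>n. tmean (T n)"
  define \<delta> where "\<delta> n = \<alpha> n - T n" for n
  define Z where "Z n = modulation (T n) (\<delta> n) (\<beta> n)" for n
  define k where "k n = (tcum3 (T n) / ?m n) * (relative_size n * relative_size n) " for n
  have k0: "k \<longlonglongrightarrow> 0" unfolding k_def[abs_def] by (rule null_times_bounded[OF cum3 Bseq_mult[OF R R]])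
  note r1 = ratio_lim(1)[OF top]
  have ev: "eventually (\<lambda>n. 1 < n \<and> 0 < ?m n) sequentially"
    using eventually_gt_at_top[of 1] filterlim_at_top_dense[THEN iffD1, OF top, rule_format, of 0] by eventually_elim simp
  have \<delta>_eq: "\<delta> n = tcum3 (T n) / (2 * (real n - 1) * (tsd (T n))\<^sup>2)" for n by (simp add: \<delta>_def \<alpha>_def)
  have rel2: "relative_size n * relative_size n = (?m n)\<^sup>2 / ((tsd (T n))\<^sup>2 * real n)" for n
    by (simp add: relative_size_def power2_eq_square)
  have lin: "(\<lambda>n. \<delta> n * (y - ?m n)) \<longlonglongrightarrow> 0"
  proof (rule Lim_transform_eventually)
    show "(\<lambda>n. 1 / 2 * k n * (real n / (real n - 1)) * (y / ?m n - 1)) \<longlonglongrightarrow> 0"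
      using tendsto_mult[OF tendsto_mult[OF tendsto_mult[OF tendsto_const[of "1/2"] k0] r1] tendsto_diff[OF ratio_lim(2)[OF top] tendsto_const[of 1]]] by simp
    show "eventually (\<lambda>n. 1 / 2 * k n * (real n / (real n - 1)) * (y / ?m n - 1) = \<delta> n * (y - ?m n)) sequentially"
      using ev
    proof eventually_elim
      case (elim n)
      have s: "tsd (T n) > 0" by (rule tsd_pos)
      have n: "real n > 0" "real n - 1 > 0" using elim by auto
      show ?case unfolding k_def rel2 \<delta>_eq using elim s n by (simp add: divide_simps power2_eq_square)
    qed
  qed
  have quad: "(\<lambda>n. (\<delta> n)\<^sup>2 * \<beta> n / 2) \<longlonglongrightarrow> 0"
  proof (rule Lim_transform_eventually)
    show "(\<lambda>n. 1 / 8 * (tcum3 (T n) / ?m n) * k n * (real n / (real n - 1))) \<longlonglongrightarrow> 0"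
      using tendsto_mult[OF tendsto_mult[OF tendsto_mult[OF tendsto_const[of "1/8"] cum3] k0] r1] by simp
    show "eventually (\<lambda>n. 1 / 8 * (tcum3 (T n) / ?m n) * k n * (real n / (real n - 1)) = (\<delta> n)\<^sup>2 * \<beta> n / 2) sequentially"
      using ev
    proof eventually_elim
      case (elim n)
      have s: "tsd (T n) > 0" by (rule tsd_pos)
      have n: "real n > 0" "real n - 1 > 0" using elim by auto
      show ?case unfolding k_def rel2 \<delta>_eq \<beta>_def using elim s n by (simp add: divide_simps power2_eq_square) (simp add: algebra_simps)
    qed
  qed
  have \<beta>pos: "eventually (\<lambda>n. \<beta> n > 0) sequentially"
    using ev by eventually_elim (simp add: \<beta>_def tsd_pos less_imp_neq[symmetric])
  have Z1: "Z \<longlonglongrightarrow> 1"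
  proof (rule tendsto_sandwich)
    show "eventually (\<lambda>n. 1 - 1 / 2 * (real n / (real n - 1)) * (1 / real n) \<le> Z n) sequentially"
      using \<beta>pos ev
    proof eventually_elim
      case (elim n)
      have "tvar (T n) / (2 * \<beta> n) = 1 / 2 * (real n / (real n - 1)) * (1 / real n)"
        using elim tvar_pos[of "T n"] by (simp add: \<beta>_def tsd_square)
      then show ?case using modulation_bounds(1)[OF elim(1), of "T n" "\<delta> n"] by (simp add: Z_def)
    qed
    show "eventually (\<lambda>n. Z n \<le> exp ((\<delta> n)\<^sup>2 * \<beta> n / 2)) sequentially"
      using \<beta>pos by eventually_elim (simp only: Z_def modulation_bounds(2))
    show "(\<lambda>n. exp ((\<delta> n)\<^sup>2 * \<beta> n / 2)) \<longlonglongrightarrow> 1" using tendsto_exp[OF quad] by simp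
    show "(\<lambda>n. 1 - 1 / 2 * (real n / (real n - 1)) * (1 / real n)) \<longlonglongrightarrow> 1"
      using tendsto_diff[OF tendsto_const[of 1] tendsto_mult[OF tendsto_mult[OF tendsto_const[of "1/2"] r1] lim_1_over_n]] by simp
  qed
  have W: "(\<lambda>n. exp (\<delta> n * (y - ?m n)) / Z n) \<longlonglongrightarrow> 1"
    using tendsto_divide[OF tendsto_exp[OF lin] Z1] by simp
  have Zpos: "eventually (\<lambda>n. 0 < Z n) sequentially" using Z1 by (rule order_tendstoD(1)) simp
  have eq: "eventually (\<lambda>n. exp (T n * y) * p y / \<Phi> (T n) * exp (- (deviation y n)\<^sup>2 / 2) * (exp (\<delta> n * (y - ?m n)) / Z n)
      = normal_modulated p (\<alpha> n * \<beta> n + ?m n) (\<beta> n) y) sequentially"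
    using \<beta>pos Zpos ev
  proof eventually_elim
    case (elim n)
    have "real (n - 1) = real n - 1" using elim by simp
    then have "(deviation y n)\<^sup>2 = (?m n - y)\<^sup>2 / \<beta> n"
      using elim by (simp add: deviation_def \<beta>_def power_divide power_mult_distrib mult.commute)
    then have d: "- (?m n - y)\<^sup>2 / (2 * \<beta> n) = - (deviation y n)\<^sup>2 / 2" by simp
    show ?case using normal_modulated_eq[OF elim(1), of "T n" "\<alpha> n" y] elim(2)
      unfolding d Z_def \<delta>_def by simp
  qed
  have "(\<lambda>n. exp (T n * y) * p y / \<Phi> (T n) * exp (- (deviation y n)\<^sup>2 / 2) * (exp (\<delta> n * (y - ?m n)) / Z n))
     \<sim>[sequentially] (\<lambda>n. exp (T n * y) * p y / \<Phi> (T n) * exp (- (deviation y n)\<^sup>2 / 2) * 1)"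
    using tendsto_imp_asymp_equiv_const[OF W] by (intro asymp_equiv_mult asymp_equiv_refl) simp
  from asymp_equiv_transfer[OF this eq] show ?thesis by simp
qed

theorem cond_density_asymp_normal_modulated:
  assumes lim: "\<And>z. (\<lambda>n. std_tilt (T n) z) \<longlonglongrightarrow> std_normal_density z"
    and C: "eventually (\<lambda>n. \<forall>z. std_tilt (T n) z \<le> C) sequentially"
    and R: "Bseq relative_size" and cum3: "(\<lambda>n. tcum3 (T n) / tmean (T n)) \<longlonglongrightarrow> 0"
  shows "(\<lambda>n. cond_density_given_sum p n (real n * tmean (T n)) y) \<sim>[sequentially]
    (\<lambda>n. normal_modulated p ((T n + tcum3 (T n) / (2 * (real n - 1) * (tsd (T n))\<^sup>2)) * ((real n - 1) * (tsd (T n))\<^sup>2) + tmean (T n))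
       ((real n - 1) * (tsd (T n))\<^sup>2) y)"
  using asymp_equiv_trans[OF cond_density_asymp[where T = T and y = y, OF lim C, folded deviation_def, OF deviation_Bseq[OF R]]
      normal_modulated_asymp[OF R cum3, THEN asymp_equiv_symI]] .

theorem cond_density_asymp_tilted:
  assumes lim: "\<And>z. (\<lambda>n. std_tilt (T n) z) \<longlonglongrightarrow> std_normal_density z"
    and C: "eventually (\<lambda>n. \<forall>z. std_tilt (T n) z \<le> C) sequentially"
    and R: "relative_size \<longlonglongrightarrow> 0"
  shows "(\<lambda>n. cond_density_given_sum p n (real n * tmean (T n)) y) \<sim>[sequentially] (\<lambda>n. exp (T n * y) * p y / \<Phi> (T n))"
proof -
  have "(\<lambda>n. exp (- (deviation y n)\<^sup>2 / 2)) \<longlonglongrightarrow> exp (- 0\<^sup>2 / 2)"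
    by (intro tendsto_intros deviation_lim_0 R) simp
  then have e: "(\<lambda>n. exp (- (deviation y n)\<^sup>2 / 2)) \<sim>[sequentially] (\<lambda>_. 1)"
    by (intro tendsto_imp_asymp_equiv_const) simp_all
  have "(\<lambda>n. exp (T n * y) * p y / \<Phi> (T n) * exp (- (deviation y n)\<^sup>2 / 2)) \<sim>[sequentially] (\<lambda>n. exp (T n * y) * p y / \<Phi> (T n) * 1)"
    by (intro asymp_equiv_mult asymp_equiv_refl e)
  with asymp_equiv_trans[OF cond_density_asymp[where T = T and y = y, OF lim C, folded deviation_def, OF deviation_Bseq[OF convergent_imp_Bseq[OF convergentI[OF R]]]]]
  show ?thesis by simp
qed

end

end

lemma density_of_distributed:
  assumes "prob_space M" and d: "distributed M lborel Y (\<lambda>x. ennreal (p x))" and p: "\<And>x. 0 \<le> p x"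
  shows "p \<in> borel_measurable borel" "(LBINT x. p x) = 1" "mgf M Y t = (LBINT x. exp (t * x) * p x)"
proof -
  interpret prob_space M by fact
  have "(\<lambda>x. enn2real (ennreal (p x))) \<in> borel_measurable borel"
    using distributed_borel_measurable[OF d] by measurable
  then show pm: "p \<in> borel_measurable borel" by (simp add: p)
  have "(\<integral>\<^sup>+x. ennreal (p x) * 1 \<partial>lborel) = (\<integral>\<^sup>+\<omega>. 1 \<partial>M)"
    by (rule distributed_nn_integral[OF d]) simp
  then have "(\<integral>\<^sup>+x. ennreal (p x) \<partial>lborel) = 1" by (simp add: emeasure_space_1)
  then show "(LBINT x. p x) = 1" using p pm by (subst integral_eq_nn_integral) auto
  have "(LBINT x. p x * exp (t * x)) = (\<integral>\<omega>. exp (t * Y \<omega>) \<partial>M)"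
    by (rule distributed_integral[OF d]) (auto simp: p)
  then show "mgf M Y t = (LBINT x. exp (t * x) * p x)" by (simp add: mgf_def mult.commute)
qed

lemma (in tiltable) tilted_cumulants:
  assumes "mgf M Y = (\<lambda>t. \<Phi> t)"
  shows "tilted_mean M Y = tmean" "tilted_sd M Y = tsd" "tilted_mu3 M Y = tcum3"
proof -
  have d1: "deriv (\<lambda>t. ln (mgf M Y t)) = tmean" unfolding assms by (intro ext DERIV_imp_deriv log_mgf_has_derivative)
  have d2: "deriv tmean = tvar" by (intro ext DERIV_imp_deriv tmean_has_derivative)
  have d3: "deriv tvar = tcum3" by (intro ext DERIV_imp_deriv tvar_has_derivative)
  show "tilted_mean M Y = tmean" by (simp add: tilted_mean_def d1)
  then show "tilted_sd M Y = tsd" by (simp add: tilted_sd_def[abs_def] tsd_def[abs_def] d2)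
  show "tilted_mu3 M Y = tcum3" by (simp add: tilted_mu3_def numeral_3_eq_3 d1 d2 d3)
qed

text \<open>\<open>tmean\<close> is continuous and strictly increasing, so the parameter exists and is unique once \<open>a\<close> lies between
  two of its values.\<close>
lemma (in tiltable) tilt_param_props:
  assumes mean: "tilted_mean M Y = tmean" and unb: "\<And>B. \<exists>t. B \<le> tmean t" and a: "filterlim a at_top F"
  shows "eventually (\<lambda>n. tmean (tilt_param M Y (a n)) = a n) F" "filterlim (\<lambda>n. tilt_param M Y (a n)) at_top F"
proof -
  have ex: "tmean (tilt_param M Y b) = b" if b: "b \<ge> tmean 0" for b
  proof -
    obtain u where u: "b \<le> tmean u" using unb by blast
    have "0 \<le> u" using order_trans[OF b u] strict_mono_less_eq[OF tmean_strict_mono] by simp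
    moreover have "isCont tmean x" for x by (rule DERIV_isCont[OF tmean_has_derivative])
    ultimately obtain x where x: "tmean x = b" using IVT[of tmean 0 b u] b u by auto
    have "tilt_param M Y b = x" unfolding tilt_param_def mean
      by (rule the_equality) (use x tmean_strict_mono in \<open>auto simp: strict_mono_eq\<close>)
    then show ?thesis using x by simp
  qed
  show e: "eventually (\<lambda>n. tmean (tilt_param M Y (a n)) = a n) F"
    using filterlim_at_top[THEN iffD1, OF a, rule_format, of "tmean 0"] by eventually_elim (rule ex)
  show "filterlim (\<lambda>n. tilt_param M Y (a n)) at_top F"
    unfolding filterlim_at_top
  proof
    fix B
    show "eventually (\<lambda>n. B \<le> tilt_param M Y (a n)) F"
      using e filterlim_at_top[THEN iffD1, OF a, rule_format, of "tmean B"]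
    proof eventually_elim
      case (elim n)
      then have "tmean B \<le> tmean (tilt_param M Y (a n))" by simp
      then show ?case using strict_mono_less_eq[OF tmean_strict_mono] by simp
    qed
  qed
qed

lemma Bseq_of_limsup_finite:
  fixes f :: "nat \<Rightarrow> real"
  assumes "0 < liminf (\<lambda>n. ereal (f n))" "limsup (\<lambda>n. ereal (f n)) < \<infinity>"
  shows "Bseq f"
proof -
  obtain K where "limsup (\<lambda>n. ereal (f n)) < ereal K" using assms(2) less_PInf_Ex_of_nat by auto
  then have "eventually (\<lambda>n. ereal (f n) < ereal K) sequentially" by (rule Limsup_lessD)
  moreover have "eventually (\<lambda>n. 0 < ereal (f n)) sequentially" using assms(1) by (rule less_LiminfD)
  ultimately have "eventually (\<lambda>n. norm (f n) \<le> norm K) sequentially" by eventually_elim auto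
  then show ?thesis by (rule Bseq_eventually_mono) simp
qed

theorem theorem10:
  fixes M :: "'a measure" and X :: "nat \<Rightarrow> 'a \<Rightarrow> real"
    and p g q :: "real \<Rightarrow> real" and G :: "nat \<Rightarrow> real \<Rightarrow> real" and a :: "nat \<Rightarrow> real"
  defines "t \<equiv> \<lambda>n. tilt_param M (X 1) (a n)"
  defines "s \<equiv> \<lambda>n. tilted_sd M (X 1) (t n)"
  defines "\<mu>3 \<equiv> \<lambda>n. tilted_mu3 M (X 1) (t n)"
  defines "\<alpha> \<equiv> \<lambda>n. t n + \<mu>3 n / (2 * (real n - 1) * (s n)\<^sup>2)"
  defines "\<beta> \<equiv> \<lambda>n. (real n - 1) * (s n)\<^sup>2"
  assumes prob: "prob_space M"
    and indep: "prob_space.indep_vars M (\<lambda>_. borel) X {1..}"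
    and dens: "\<And>i. i \<ge> 1 \<Longrightarrow> distributed M lborel (X i) (\<lambda>x. ennreal (p x))"
    and p: "\<And>x. p x = (if x \<ge> 0 then exp (- (g x - q x)) else 0)"
    and g_pos: "\<And>x. x \<ge> 0 \<Longrightarrow> g x > 0"
    and g_convex: "convex_on {0..} g"
    and g_diff: "G 0 = g" "derivs_on {0<..} 4 G"
    and g_superlinear: "filterlim (\<lambda>x. g x / x) at_top at_top"
    and q_bounded: "bounded (q ` {0..})"
    and h_class: "regular_case (G 1) (G 3) q \<or> rapid_case (G 1) q"
    and a: "filterlim a at_top sequentially"
  shows
    "(0 < liminf (\<lambda>n. ereal (a n / (s n * sqrt (real n)))) \<and>
      limsup (\<lambda>n. ereal (a n / (s n * sqrt (real n)))) < \<infinity> \<longrightarrow>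
        (\<forall>y1. (\<lambda>n. cond_density_given_sum p n (real n * a n) y1)
           \<sim>[sequentially] (\<lambda>n. normal_modulated p (\<alpha> n * \<beta> n + a n) (\<beta> n) y1))) \<and>
     ((\<lambda>n. a n / (s n * sqrt (real n))) \<longlonglongrightarrow> 0 \<longrightarrow>
        (\<forall>y1. (\<lambda>n. cond_density_given_sum p n (real n * a n) y1)
           \<sim>[sequentially] (\<lambda>n. tilted_density_at_mean M (X 1) p (a n) y1)))"
proof -
  have p0: "0 \<le> p x" for x by (simp add: p)
  note dD = density_of_distributed[OF prob dens[of 1, simplified] p0]
  obtain Q where Q: "\<And>x. x \<ge> 0 \<Longrightarrow> \<bar>q x\<bar> \<le> Q"
    using q_bounded unfolding bounded_iff by auto
  interpret convex_potential p g q G Q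
    by unfold_locales (fact dD(1,2) p g_pos g_convex g_diff g_superlinear Q)+
  have mgf: "mgf M (X 1) = (\<lambda>t. \<Phi> t)" using dD(3) by auto
  note cum = tilted_cumulants[OF mgf]
  have unb: "\<exists>u. B \<le> tmean u" for B
  proof -
    have "eventually (\<lambda>n. B \<le> tmean (real n)) sequentially"
      using tilt_asymptotics(4)[OF h_class filterlim_real_sequentially] by (simp add: filterlim_at_top)
    then show ?thesis by (auto simp: eventually_sequentially)
  qed
  note tp = tilt_param_props[OF cum(1) unb a, folded t_def]
  have teq: "eventually (\<lambda>n. tmean (t n) = a n) sequentially" using tp(1) by (simp add: t_def)
  have ttop: "filterlim t at_top sequentially" using tp(2) by (simp add: t_def)
  note as = tilt_asymptotics[OF h_class ttop]
  have s: "s n = tsd (t n)" and \<mu>3: "\<mu>3 n = tcum3 (t n)" for n by (simp_all add: s_def \<mu>3_def cum del: One_nat_def)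
  have rel: "eventually (\<lambda>n. relative_size t n = a n / (s n * sqrt (real n))) sequentially"
    using teq by eventually_elim (simp add: relative_size_def[OF as(4)] s)
  have cond: "eventually (\<lambda>n. cond_density_given_sum p n (real n * tmean (t n)) y = cond_density_given_sum p n (real n * a n) y) sequentially" for y
    using teq by eventually_elim simp
  show ?thesis
  proof (intro conjI impI allI)
    fix y
    assume "0 < liminf (\<lambda>n. ereal (a n / (s n * sqrt (real n)))) \<and> limsup (\<lambda>n. ereal (a n / (s n * sqrt (real n)))) < \<infinity>"
    then have "Bseq (\<lambda>n. a n / (s n * sqrt (real n)))" by (intro Bseq_of_limsup_finite) auto
    then have "Bseq (relative_size t)"
      by (rule Bseq_eventually_mono[rotated]) (use rel in eventually_elim, simp)
    from cond_density_asymp_normal_modulated[OF as(4) as(1) as(2) this as(3), of y]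
    show "(\<lambda>n. cond_density_given_sum p n (real n * a n) y) \<sim>[sequentially] (\<lambda>n. normal_modulated p (\<alpha> n * \<beta> n + a n) (\<beta> n) y)"
      by (rule asymp_equiv_transfer[OF _ cond]) (use teq in eventually_elim, simp add: \<alpha>_def \<beta>_def s \<mu>3)
  next
    fix y
    assume "(\<lambda>n. a n / (s n * sqrt (real n))) \<longlonglongrightarrow> 0"
    then have "relative_size t \<longlonglongrightarrow> 0"
      by (rule Lim_transform_eventually) (use rel in eventually_elim, simp)
    from cond_density_asymp_tilted[OF as(4) as(1) as(2) this, of y]
    show "(\<lambda>n. cond_density_given_sum p n (real n * a n) y) \<sim>[sequentially] (\<lambda>n. tilted_density_at_mean M (X 1) p (a n) y)"
      by (rule asymp_equiv_transfer[OF _ cond])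
         (intro always_eventually allI, simp add: tilted_density_at_mean_def tilted_density_def mgf t_def del: One_nat_def)
  qed
qed

end
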